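(* (i) Fractional Brownian motion $B^H$ on $[0,T]$ with Hurst parameter $H\in(0,1)$ has an indefinite Wiener integral. (ii) If $B^H$ is a fractional Brownian motion on $[0,T]$ with $H>\frac12$, and $\sigma$ is a deterministic measurable function on $[0,T]$ satisfying $\epsilon\le\sigma\le\epsilon^{-1}$ for some $\epsilon\in(0,1)$, then the fractional Wiener integral $X_t=\int_0^t\sigma(s)\,dB^H_s$, $t\in[0,T]$, has an indefinite Wiener integral. (iii) Suppose that $X_t=X^{(1)}_t+\gamma X^{(2)}_t$, $t\in[0,T]$, where $\gamma\ne0$ is a constant and $X^{(i)}$, $i=1,2$, are independent centered Gaussian processes. If $X^{(1)}$ and $X^{(2)}$ have indefinite Wiener integrals, then so does $X$.
   Context: All processes are measurable centered Gaussian processes on $[0,T]$, $T>0$, starting at $0$ at time $0$, on a complete probability space. For such a process $X$ with covariance $R(t,s)=\mathbb E[X_tX_s]$, the space of deterministic integrands $\mathfrak H_X$ is the Hilbert space obtained as closure (completion) of the linear span of the indicator functions $\mathbf 1_{(0,t]}$, $t\in[0,T]$, with inner product $\langle \mathbf 1_{(0,t]},\mathbf 1_{(0,s]}\rangle_{\mathfrak H_X}=R(t,s)$. The Wiener integral is the linear isometry $I:\mathfrak H_X\to L^2(\Omega)$ determined by $I(\mathbf 1_{(0,t]})=X_t$. $X$ has an indefinite Wiener integral if for every $r\in[0,T]$ there is a continuous linear operator $\mathbb I_r:\mathfrak H_X\to\mathfrak H_X$ with $\mathbb I_r(\mathbf 1_{(0,t]})=\mathbf 1_{(0,t\wedge r]}$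 for all $t\in[0,T]$. Fractional Brownian motion $B^H$ with Hurst parameter $H\in(0,1)$ is the centered Gaussian process with covariance $\frac12\left(t^{2H}+s^{2H}-|t-s|^{2H}\right)$. For $H>\frac12$ and bounded measurable $\sigma$, $\int_0^t\sigma(s)\,dB^H_s$ denotes the Wiener integral of $\sigma\mathbf 1_{(0,t]}$ with respect to $B^H$ (bounded measurable functions belong to $\mathfrak H_{B^H}$, with $\langle f,g\rangle_{\mathfrak H_{B^H}}=H(2H-1)\int_0^T\int_0^Tf(u)g(v)|u-v|^{2H-2}\,du\,dv$). *)

theory Defs
  imports "HOL-Probability.Probability"
begin

section \<open>Centered Gaussian processes on $[0,T]$\<close>

text \<open>Processes are functions of time and outcome; only their values at times in
  $[0,T]$ matter. Degenerate Gaussian laws (almost surely zero) are included.\<close>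

definition centered_gaussian :: "'a measure \<Rightarrow> ('a \<Rightarrow> real) \<Rightarrow> bool" where
  "centered_gaussian M Y \<longleftrightarrow>
     (Y \<in> borel_measurable M \<and> (AE \<omega> in M. Y \<omega> = 0)) \<or>
     (\<exists>s>0. distributed M lborel Y (normal_density 0 s))"

definition measurable_process :: "'a measure \<Rightarrow> real \<Rightarrow> (real \<Rightarrow> 'a \<Rightarrow> real) \<Rightarrow> bool" where
  "measurable_process M T X \<longleftrightarrow>
     (\<lambda>(t, \<omega>). X t \<omega>) \<in> borel_measurable (restrict_space borel {0..T} \<Otimes>\<^sub>M M)"

definition centered_gaussian_process :: "'a measure \<Rightarrow> real \<Rightarrow> (real \<Rightarrow> 'a \<Rightarrow> real) \<Rightarrow> bool" where
  "centered_gaussian_process M T X \<longleftrightarrow>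
     measurable_process M T X \<and>
     (AE \<omega> in M. X 0 \<omega> = 0) \<and>
     (\<forall>A c. finite A \<and> A \<subseteq> {0..T} \<longrightarrow> centered_gaussian M (\<lambda>\<omega>. \<Sum>t\<in>A. c t * X t \<omega>))"

definition covariance :: "'a measure \<Rightarrow> (real \<Rightarrow> 'a \<Rightarrow> real) \<Rightarrow> real \<Rightarrow> real \<Rightarrow> real" where
  "covariance M X t s = (\<integral>\<omega>. X t \<omega> * X s \<omega> \<partial>M)"

definition fbm_cov :: "real \<Rightarrow> real \<Rightarrow> real \<Rightarrow> real" where
  "fbm_cov H t s = (t powr (2 * H) + s powr (2 * H) - \<bar>t - s\<bar> powr (2 * H)) / 2"

definition fractional_brownian_motion ::
    "'a measure \<Rightarrow> real \<Rightarrow> real \<Rightarrow> (real \<Rightarrow> 'a \<Rightarrow> real) \<Rightarrow> bool" where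
  "fractional_brownian_motion M T H B \<longleftrightarrow>
     0 < H \<and> H < 1 \<and>
     centered_gaussian_process M T B \<and>
     (\<forall>t\<in>{0..T}. \<forall>s\<in>{0..T}. covariance M B t s = fbm_cov H t s)"

text \<open>Independence of the two families as random elements of the path space
  with the product sigma-algebra.\<close>

definition independent_processes ::
    "'a measure \<Rightarrow> real \<Rightarrow> (real \<Rightarrow> 'a \<Rightarrow> real) \<Rightarrow> (real \<Rightarrow> 'a \<Rightarrow> real) \<Rightarrow> bool" where
  "independent_processes M T X Y \<longleftrightarrow>
     prob_space.indep_var M
       (Pi\<^sub>M {0..T} (\<lambda>_. borel)) (\<lambda>\<omega>. \<lambda>t\<in>{0..T}. X t \<omega>)
       (Pi\<^sub>M {0..T} (\<lambda>_. borel)) (\<lambda>\<omega>. \<lambda>t\<in>{0..T}. Y t \<omega>)"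


section \<open>The space of deterministic integrands\<close>

text \<open>The linear span of the indicators of $(0,t]$, $t \in [0,T]$.\<close>

definition step_rep :: "real \<Rightarrow> real set \<Rightarrow> (real \<Rightarrow> real) \<Rightarrow> (real \<Rightarrow> real) \<Rightarrow> bool" where
  "step_rep T A c f \<longleftrightarrow>
     finite A \<and> A \<subseteq> {0..T} \<and> f = (\<lambda>x. \<Sum>t\<in>A. c t * indicator {0<..t} x)"

definition step_funs :: "real \<Rightarrow> (real \<Rightarrow> real) set" where
  "step_funs T = {f. \<exists>A c. step_rep T A c f}"

text \<open>The bilinear form on step functions determined by the covariance \<open>R\<close>. The value does not
  depend on the representations as soon as \<open>R\<close> vanishes when one of its arguments is zero, which
  is the case for a process starting at zero; see \<open>step_inner_eq\<close> below.\<close>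

definition step_inner ::
    "real \<Rightarrow> (real \<Rightarrow> real \<Rightarrow> real) \<Rightarrow> (real \<Rightarrow> real) \<Rightarrow> (real \<Rightarrow> real) \<Rightarrow> real" where
  "step_inner T R f g =
     (THE v. \<forall>A c B d. step_rep T A c f \<longrightarrow> step_rep T B d g \<longrightarrow>
        v = (\<Sum>t\<in>A. \<Sum>s\<in>B. c t * d s * R t s))"

definition step_norm :: "real \<Rightarrow> (real \<Rightarrow> real \<Rightarrow> real) \<Rightarrow> (real \<Rightarrow> real) \<Rightarrow> real" where
  "step_norm T R f = sqrt (step_inner T R f f)"

text \<open>The form may be degenerate, so the Hilbert space is the Cauchy completion of the quotient by
  its kernel: Cauchy sequences of step functions modulo sequences of seminorm tending to zero.\<close>

definition cauchy_steps :: "real \<Rightarrow> (real \<Rightarrow> real \<Rightarrow> real) \<Rightarrow> (nat \<Rightarrow> real \<Rightarrow> real) set" where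
  "cauchy_steps T R =
     {F. (\<forall>n. F n \<in> step_funs T) \<and>
         (\<forall>e>0. \<exists>N. \<forall>m\<ge>N. \<forall>n\<ge>N. step_norm T R (\<lambda>x. F m x - F n x) < e)}"

definition cauchy_equiv ::
    "real \<Rightarrow> (real \<Rightarrow> real \<Rightarrow> real) \<Rightarrow> ((nat \<Rightarrow> real \<Rightarrow> real) \<times> (nat \<Rightarrow> real \<Rightarrow> real)) set" where
  "cauchy_equiv T R =
     {(F, G). F \<in> cauchy_steps T R \<and> G \<in> cauchy_steps T R \<and>
        (\<lambda>n. step_norm T R (\<lambda>x. F n x - G n x)) \<longlonglongrightarrow> 0}"

type_synonym integrand = "(nat \<Rightarrow> real \<Rightarrow> real) set"

definition integrands :: "real \<Rightarrow> (real \<Rightarrow> real \<Rightarrow> real) \<Rightarrow> integrand set" where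
  "integrands T R = cauchy_steps T R // cauchy_equiv T R"

definition integrand_add ::
    "real \<Rightarrow> (real \<Rightarrow> real \<Rightarrow> real) \<Rightarrow> integrand \<Rightarrow> integrand \<Rightarrow> integrand" where
  "integrand_add T R h k =
     (\<Union>F\<in>h. \<Union>G\<in>k. cauchy_equiv T R `` {\<lambda>n x. F n x + G n x})"

definition integrand_scale ::
    "real \<Rightarrow> (real \<Rightarrow> real \<Rightarrow> real) \<Rightarrow> real \<Rightarrow> integrand \<Rightarrow> integrand" where
  "integrand_scale T R a h = (\<Union>F\<in>h. cauchy_equiv T R `` {\<lambda>n x. a * F n x})"

definition integrand_inner ::
    "real \<Rightarrow> (real \<Rightarrow> real \<Rightarrow> real) \<Rightarrow> integrand \<Rightarrow> integrand \<Rightarrow> real" where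
  "integrand_inner T R h k =
     (THE v. \<forall>F\<in>h. \<forall>G\<in>k. (\<lambda>n. step_inner T R (F n) (G n)) \<longlonglongrightarrow> v)"

definition integrand_norm :: "real \<Rightarrow> (real \<Rightarrow> real \<Rightarrow> real) \<Rightarrow> integrand \<Rightarrow> real" where
  "integrand_norm T R h = sqrt (integrand_inner T R h h)"

text \<open>The class of the indicator function of $(0,t]$.\<close>

definition integrand_indicator :: "real \<Rightarrow> (real \<Rightarrow> real \<Rightarrow> real) \<Rightarrow> real \<Rightarrow> integrand" where
  "integrand_indicator T R t = cauchy_equiv T R `` {\<lambda>n. indicator {0<..t}}"

text \<open>As in \<^const>\<open>bounded_linear\<close>, continuity of a linear operator is boundedness.\<close>

definition continuous_linear_operator ::
    "real \<Rightarrow> (real \<Rightarrow> real \<Rightarrow> real) \<Rightarrow> (integrand \<Rightarrow> integrand) \<Rightarrow> bool" where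
  "continuous_linear_operator T R J \<longleftrightarrow>
     (\<forall>h\<in>integrands T R. J h \<in> integrands T R) \<and>
     (\<forall>h\<in>integrands T R. \<forall>k\<in>integrands T R.
        J (integrand_add T R h k) = integrand_add T R (J h) (J k)) \<and>
     (\<forall>a. \<forall>h\<in>integrands T R.
        J (integrand_scale T R a h) = integrand_scale T R a (J h)) \<and>
     (\<exists>K. \<forall>h\<in>integrands T R. integrand_norm T R (J h) \<le> K * integrand_norm T R h)"

definition has_indefinite_wiener_integral ::
    "'a measure \<Rightarrow> real \<Rightarrow> (real \<Rightarrow> 'a \<Rightarrow> real) \<Rightarrow> bool" where
  "has_indefinite_wiener_integral M T X \<longleftrightarrow>
     (\<forall>r\<in>{0..T}. \<exists>J. continuous_linear_operator T (covariance M X) J \<and>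
        (\<forall>t\<in>{0..T}. J (integrand_indicator T (covariance M X) t)
                     = integrand_indicator T (covariance M X) (min t r)))"


section \<open>Wiener integrals\<close>

text \<open>\<open>step_wiener M T X f Y\<close>: the random variable \<open>Y\<close> is the Wiener integral of the step function
  \<open>f\<close>. Since $X_0 = 0$ almost surely, \<open>Y\<close> is determined by \<open>f\<close> up to null sets.\<close>

definition step_wiener ::
    "'a measure \<Rightarrow> real \<Rightarrow> (real \<Rightarrow> 'a \<Rightarrow> real) \<Rightarrow> (real \<Rightarrow> real) \<Rightarrow> ('a \<Rightarrow> real) \<Rightarrow> bool" where
  "step_wiener M T X f Y \<longleftrightarrow>
     (\<exists>A c. step_rep T A c f \<and> (AE \<omega> in M. Y \<omega> = (\<Sum>t\<in>A. c t * X t \<omega>))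
            \<and> Y \<in> borel_measurable M)"

text \<open>\<open>is_wiener_integral M T X h Y\<close>: the random variable \<open>Y\<close> represents the value at \<open>h\<close> of the
  isometry from the space of integrands into $L^2$, that is, \<open>Y\<close> is the $L^2$-limit of the integrals
  along a sequence representing \<open>h\<close>. By isometry the choice of the sequence is immaterial.\<close>

definition is_wiener_integral ::
    "'a measure \<Rightarrow> real \<Rightarrow> (real \<Rightarrow> 'a \<Rightarrow> real) \<Rightarrow> integrand \<Rightarrow> ('a \<Rightarrow> real) \<Rightarrow> bool" where
  "is_wiener_integral M T X h Y \<longleftrightarrow>
     h \<in> integrands T (covariance M X) \<and>
     Y \<in> borel_measurable M \<and> integrable M (\<lambda>\<omega>. (Y \<omega>)\<^sup>2) \<and>
     (\<exists>F\<in>h. \<exists>S. (\<forall>n. step_wiener M T X (F n) (S n)) \<and>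
        (\<lambda>n. \<integral>\<omega>. (S n \<omega> - Y \<omega>)\<^sup>2 \<partial>M) \<longlonglongrightarrow> 0)"

definition fbm_form :: "real \<Rightarrow> real \<Rightarrow> (real \<Rightarrow> real) \<Rightarrow> (real \<Rightarrow> real) \<Rightarrow> real" where
  "fbm_form H T f g =
     H * (2 * H - 1) *
     (LINT u:{0..T}|lebesgue. (LINT v:{0..T}|lebesgue.
        f u * g v * \<bar>u - v\<bar> powr (2 * H - 2)))"

text \<open>For \<open>H > 1/2\<close>, the element of the space of integrands of fractional Brownian motion given by
  a bounded measurable function \<open>f\<close>: the class of all sequences of step functions converging to \<open>f\<close>
  in the norm of \<open>fbm_form\<close>, which on step functions agrees with \<open>step_inner T (fbm_cov H)\<close>.\<close>

definition fbm_integrand :: "real \<Rightarrow> real \<Rightarrow> (real \<Rightarrow> real) \<Rightarrow> integrand" where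
  "fbm_integrand H T f =
     {F. (\<forall>n. F n \<in> step_funs T) \<and>
         (\<lambda>n. fbm_form H T (\<lambda>x. F n x - f x) (\<lambda>x. F n x - f x)) \<longlonglongrightarrow> 0}"

text \<open>\<open>X\<close> is the process $X_t = \int_0^t \sigma(s)\,dB^H_s$, each $X_t$ being determined up to null
  sets.\<close>

definition fractional_wiener_process ::
    "'a measure \<Rightarrow> real \<Rightarrow> real \<Rightarrow> (real \<Rightarrow> 'a \<Rightarrow> real) \<Rightarrow> (real \<Rightarrow> real)
      \<Rightarrow> (real \<Rightarrow> 'a \<Rightarrow> real) \<Rightarrow> bool" where
  "fractional_wiener_process M T H B \<sigma> X \<longleftrightarrow>
     measurable_process M T X \<and>
     (\<forall>t\<in>{0..T}. is_wiener_integral M T B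
        (fbm_integrand H T (\<lambda>s. \<sigma> s * indicator {0<..t} s)) (X t))"


section \<open>Well-definedness of the form on step functions\<close>

lemma step_sum_zero_coeffs:
  fixes e :: "real \<Rightarrow> real"
  assumes "finite C" and z: "\<And>x. (\<Sum>t\<in>C. e t * indicator {0<..t} x) = 0"
    and "t \<in> C" "t > 0"
  shows "e t = 0"
proof (rule ccontr)
  assume "e t \<noteq> 0"
  define N where "N = {t\<in>C. t > 0 \<and> e t \<noteq> 0}"
  have N: "finite N" "N \<noteq> {}" using assms \<open>e t \<noteq> 0\<close> by (auto simp: N_def)
  define m where "m = Max N"
  have m: "m \<in> N" and le: "\<And>t. t \<in> N \<Longrightarrow> t \<le> m" using N by (auto simp: m_def)
  have "(\<Sum>t\<in>C. e t * indicator {0<..t} m) = (\<Sum>t\<in>C. if t = m then e t else 0)"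
    using m le by (intro sum.cong refl) (force simp: N_def indicator_def)
  also have "\<dots> = e m" using m \<open>finite C\<close> by (simp add: N_def)
  finally show False using z m by (simp add: N_def)
qed

lemma step_rep_sum_eq:
  fixes K :: "real \<Rightarrow> real"
  assumes "step_rep T A c f" "step_rep T B d f" "K 0 = 0"
  shows "(\<Sum>t\<in>A. c t * K t) = (\<Sum>t\<in>B. d t * K t)"
proof -
  have fin: "finite A" "finite B" and sub: "A \<subseteq> {0..T}" "B \<subseteq> {0..T}"
    using assms by (auto simp: step_rep_def)
  define e where "e t = (if t \<in> A then c t else 0) - (if t \<in> B then d t else 0)" for t
  have ext: "(\<Sum>t\<in>A \<union> B. e t * L t) = (\<Sum>t\<in>A. c t * L t) - (\<Sum>t\<in>B. d t * L t)"
    for L :: "real \<Rightarrow> real"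
  proof -
    have "(\<Sum>t\<in>A \<union> B. (if t \<in> A then c t else 0) * L t) = (\<Sum>t\<in>A. c t * L t)"
      using fin by (intro sum.mono_neutral_cong_right) auto
    moreover have "(\<Sum>t\<in>A \<union> B. (if t \<in> B then d t else 0) * L t) = (\<Sum>t\<in>B. d t * L t)"
      using fin by (intro sum.mono_neutral_cong_right) auto
    ultimately show ?thesis by (simp add: e_def left_diff_distrib sum_subtractf)
  qed
  have "(\<Sum>t\<in>A. c t * indicator {0<..t} x) = (\<Sum>t\<in>B. d t * indicator {0<..t} x)" for x
    using assms(1,2) unfolding step_rep_def by metis
  then have z: "(\<Sum>t\<in>A \<union> B. e t * indicator {0<..t} x) = 0" for x
    using ext[of "\<lambda>t. indicator {0<..t} x"] by simp
  have "e t * K t = 0" if "t \<in> A \<union> B" for t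
  proof (cases "t = 0")
    case False
    with that sub have "t > 0" by force
    then show ?thesis using step_sum_zero_coeffs[of "A \<union> B" e t] z fin that by simp
  qed (simp add: assms(3))
  then have "(\<Sum>t\<in>A \<union> B. e t * K t) = 0" by (simp add: sum.neutral)
  then show ?thesis using ext[of K] by simp
qed

lemma step_inner_eq:
  assumes R: "\<And>t. t \<in> {0..T} \<Longrightarrow> R 0 t = 0" "\<And>t. t \<in> {0..T} \<Longrightarrow> R t 0 = 0"
    and f: "step_rep T A c f" and g: "step_rep T B d g"
  shows "step_inner T R f g = (\<Sum>t\<in>A. \<Sum>s\<in>B. c t * d s * R t s)"
proof -
  have *: "(\<Sum>t\<in>A. \<Sum>s\<in>B. c t * d s * R t s) = (\<Sum>t\<in>A'. \<Sum>s\<in>B'. c' t * d' s * R t s)"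
    if f': "step_rep T A' c' f" and g': "step_rep T B' d' g" for A' c' B' d'
  proof -
    have sub: "B \<subseteq> {0..T}" "A' \<subseteq> {0..T}" using g f' by (auto simp: step_rep_def)
    have "(\<Sum>t\<in>A. \<Sum>s\<in>B. c t * d s * R t s) = (\<Sum>t\<in>A. c t * (\<Sum>s\<in>B. d s * R t s))"
      by (simp add: sum_distrib_left mult.assoc)
    also have "\<dots> = (\<Sum>t\<in>A'. c' t * (\<Sum>s\<in>B. d s * R t s))"
      using sub by (intro step_rep_sum_eq[OF f f'] sum.neutral) (auto simp: R subset_iff)
    also have "\<dots> = (\<Sum>t\<in>A'. c' t * (\<Sum>s\<in>B'. d' s * R t s))"
      using sub by (intro sum.cong refl arg_cong2[where f = "(*)"] step_rep_sum_eq[OF g g'])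
        (auto simp: R subset_iff)
    also have "\<dots> = (\<Sum>t\<in>A'. \<Sum>s\<in>B'. c' t * d' s * R t s)"
      by (simp add: sum_distrib_left mult.assoc)
    finally show ?thesis .
  qed
  show ?thesis
    unfolding step_inner_def using * f g by (intro the_equality) blast+
qed

end

theory Submission
  imports Defs
begin

text \<open>An operator sending the class of \<open>1\<^bsub>(0,t]\<^esub>\<close> to that of \<open>1\<^bsub>(0,min t r]\<^esub>\<close> must be
truncation to \<open>(0,r]\<close> on all step functions, and conversely truncation extends to the completion as
soon as it is bounded in the norm. So the existence of an indefinite Wiener integral is the estimate
\<open>Var (\<Sum> c\<^sub>t X\<^bsub>min t r\<^esub>) \<le> K Var (\<Sum> c\<^sub>t X\<^sub>t)\<close>, with \<open>K\<close> independent of the finite sum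
(\<open>indefinite_wiener_integral_iff\<close>). In this form the statement on sums of independent processes is
immediate, because variances of independent variables add up.

For fractional Brownian motion, put \<open>\<alpha> = H - 1/2\<close>, so that \<open>\<bar>\<alpha>\<bar> < 1/2\<close>. The Mandelbrot-van Ness
representation identifies \<open>Var (\<Sum> c\<^sub>t B\<^sub>t)\<close>, up to a constant, with the square integral over the
line of \<open>\<phi> x = \<Sum> c\<^sub>t ((t - x)\<^sub>+\<^sup>\<alpha> - (- x)\<^sub>+\<^sup>\<alpha>)\<close> (\<open>mvn_kernel_covariance\<close>). Let \<open>\<theta>\<close> be the function
belonging in the same way to the part of the integrand on \<open>(r,T]\<close>. Two facts give the estimate. On
\<open>x > r\<close> the functions \<open>\<theta>\<close> and \<open>\<phi>\<close> agree, since the increments before \<open>r\<close> do not contribute there.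
And the values of \<open>\<theta>\<close> on \<open>x < r\<close> are determined by those on \<open>x > r\<close>: they are given by an
integral operator with the kernel \<open>a\<^sup>\<alpha> y\<^sup>-\<^sup>\<alpha> / (a + y)\<close> (\<open>tail_kernel_reproduces\<close>), homogeneous of
degree \<open>-1\<close> and bounded on \<open>L\<^sup>2(0,\<infinity>)\<close> by the Schur test precisely when \<open>\<bar>\<alpha>\<bar> < 1/2\<close>
(\<open>tail_kernel_schur\<close>). Hence \<open>\<integral>\<theta>\<^sup>2 \<le> L \<integral>\<phi>\<^sup>2\<close>, and truncation, which corresponds to \<open>\<phi> - \<theta>\<close>, is
bounded (\<open>fbm_truncation_bound\<close>). The argument is the same for \<open>H\<close> below and above \<open>1/2\<close>.

For \<open>X\<^sub>t = \<integral>\<^sub>0\<^sup>t \<sigma> dB\<close> with \<open>H > 1/2\<close>, the isometry gives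
\<open>Var (\<Sum> c\<^sub>t X\<^sub>t) = \<parallel>\<sigma> f\<parallel>\<^sup>2\<close> for the step function \<open>f = \<Sum> c\<^sub>t 1\<^bsub>(0,t]\<^esub>\<close>, in the norm of the form
\<open>fbm_form\<close>, and truncating \<open>f\<close> truncates \<open>\<sigma> f\<close>. It therefore suffices to have the truncation
estimate of fractional Brownian motion for bounded measurable integrands (\<open>fbm_form_truncate_le\<close>),
where it follows from the one for step functions by dominated convergence.\<close>

section \<open>Positive semidefinite forms on function spaces\<close>

text \<open>Three instances of this structure occur: step functions with the form given by a covariance, bounded
measurable functions with \<^const>\<open>fbm_form\<close>, and square integrable random variables with the
expectation of the product. None of the forms has to be definite.\<close>

locale semi_inner =
  fixes V :: "('b \<Rightarrow> real) set" and B :: "('b \<Rightarrow> real) \<Rightarrow> ('b \<Rightarrow> real) \<Rightarrow> real"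
  assumes zero_mem: "(\<lambda>x. 0) \<in> V"
    and add_mem: "f \<in> V \<Longrightarrow> g \<in> V \<Longrightarrow> (\<lambda>x. f x + g x) \<in> V"
    and scale_mem: "f \<in> V \<Longrightarrow> (\<lambda>x. a * f x) \<in> V"
    and form_add: "f \<in> V \<Longrightarrow> g \<in> V \<Longrightarrow> h \<in> V \<Longrightarrow> B (\<lambda>x. f x + g x) h = B f h + B g h"
    and form_scale: "f \<in> V \<Longrightarrow> h \<in> V \<Longrightarrow> B (\<lambda>x. a * f x) h = a * B f h"
    and form_sym: "f \<in> V \<Longrightarrow> g \<in> V \<Longrightarrow> B f g = B g f"
    and form_pos: "f \<in> V \<Longrightarrow> B f f \<ge> 0"
begin

definition N :: "('b \<Rightarrow> real) \<Rightarrow> real" where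
  "N f = sqrt (B f f)"

lemma diff_mem: "f \<in> V \<Longrightarrow> g \<in> V \<Longrightarrow> (\<lambda>x. f x - g x) \<in> V"
  using add_mem[OF _ scale_mem[of g "-1"]] by simp

lemma form_diff: "f \<in> V \<Longrightarrow> g \<in> V \<Longrightarrow> h \<in> V \<Longrightarrow> B (\<lambda>x. f x - g x) h = B f h - B g h"
  using form_add[OF _ scale_mem[of g "-1"], of f h] form_scale[of g h "-1"] by simp

lemma form_add_right: "f \<in> V \<Longrightarrow> g \<in> V \<Longrightarrow> h \<in> V \<Longrightarrow> B h (\<lambda>x. f x + g x) = B h f + B h g"
  using form_add[of f g h] form_sym add_mem by simp

lemma form_diff_right: "f \<in> V \<Longrightarrow> g \<in> V \<Longrightarrow> h \<in> V \<Longrightarrow> B h (\<lambda>x. f x - g x) = B h f - B h g"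
  using form_diff[of f g h] form_sym diff_mem by simp

lemma form_scale_right: "f \<in> V \<Longrightarrow> h \<in> V \<Longrightarrow> B h (\<lambda>x. a * f x) = a * B h f"
  using form_scale[of f h a] form_sym scale_mem by simp

lemma form_zero: "h \<in> V \<Longrightarrow> B (\<lambda>x. 0) h = 0"
  using form_scale[of "\<lambda>x. 0" h 0] zero_mem by simp

lemma sum_mem: "(\<And>i. i \<in> I \<Longrightarrow> f i \<in> V) \<Longrightarrow> (\<lambda>x. \<Sum>i\<in>I. c i * f i x) \<in> V"
  by (induction I rule: infinite_finite_induct) (auto intro!: add_mem scale_mem zero_mem)

lemma form_sum:
  assumes "\<And>i. i \<in> I \<Longrightarrow> f i \<in> V" "h \<in> V"
  shows "B (\<lambda>x. \<Sum>i\<in>I. c i * f i x) h = (\<Sum>i\<in>I. c i * B (f i) h)"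
  using assms
  by (induction I rule: infinite_finite_induct)
    (auto simp: form_zero form_add form_scale scale_mem sum_mem)

lemma form_sum_sum:
  assumes f: "\<And>i. i \<in> I \<Longrightarrow> f i \<in> V"
  shows "B (\<lambda>x. \<Sum>i\<in>I. c i * f i x) (\<lambda>x. \<Sum>j\<in>I. c j * f j x)
    = (\<Sum>i\<in>I. \<Sum>j\<in>I. c i * c j * B (f i) (f j))"
proof -
  have "B (f i) (\<lambda>x. \<Sum>j\<in>I. c j * f j x) = (\<Sum>j\<in>I. c j * B (f i) (f j))" if i: "i \<in> I" for i
  proof -
    have "B (f i) (\<lambda>x. \<Sum>j\<in>I. c j * f j x) = B (\<lambda>x. \<Sum>j\<in>I. c j * f j x) (f i)"
      by (rule form_sym[OF f[OF i] sum_mem[OF f]])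
    also have "\<dots> = (\<Sum>j\<in>I. c j * B (f j) (f i))"
      by (rule form_sum[OF f f[OF i]])
    also have "\<dots> = (\<Sum>j\<in>I. c j * B (f i) (f j))"
      using form_sym[OF f f[OF i]] by (intro sum.cong) auto
    finally show ?thesis .
  qed
  moreover have "B (\<lambda>x. \<Sum>i\<in>I. c i * f i x) (\<lambda>x. \<Sum>j\<in>I. c j * f j x)
      = (\<Sum>i\<in>I. c i * B (f i) (\<lambda>x. \<Sum>j\<in>I. c j * f j x))"
    by (rule form_sum[OF f sum_mem[OF f]])
  ultimately show ?thesis by (simp add: sum_distrib_left mult.assoc)
qed

lemma N_nonneg: "f \<in> V \<Longrightarrow> N f \<ge> 0"
  by (simp add: N_def form_pos)

lemma N_sq: "f \<in> V \<Longrightarrow> (N f)\<^sup>2 = B f f"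
  by (simp add: N_def form_pos)

lemma N_scale: "f \<in> V \<Longrightarrow> N (\<lambda>x. a * f x) = \<bar>a\<bar> * N f"
  unfolding N_def
  by (simp add: form_scale form_scale_right scale_mem real_sqrt_mult flip: mult.assoc power2_eq_square)

lemma N_minus_commute: "f \<in> V \<Longrightarrow> g \<in> V \<Longrightarrow> N (\<lambda>x. f x - g x) = N (\<lambda>x. g x - f x)"
  using N_scale[OF diff_mem[of f g], of "-1"] by (simp add: minus_diff_eq)

lemma Cauchy_Schwarz:
  assumes "f \<in> V" "g \<in> V"
  shows "\<bar>B f g\<bar> \<le> N f * N g"
proof -
  have nonneg: "0 \<le> B f f + 2 * t * B f g + t\<^sup>2 * B g g" for t
  proof -
    have "0 \<le> B (\<lambda>x. f x + t * g x) (\<lambda>x. f x + t * g x)"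
      by (intro form_pos add_mem scale_mem assms)
    also have "\<dots> = B f f + 2 * t * B f g + t\<^sup>2 * B g g"
      using assms form_sym[of g f]
      by (simp add: form_add form_add_right form_scale form_scale_right add_mem scale_mem
          power2_eq_square algebra_simps)
    finally show ?thesis .
  qed
  have "(B f g)\<^sup>2 \<le> B f f * B g g"
  proof (cases "B g g = 0")
    case True
    have "B f g = 0"
    proof (rule ccontr)
      assume "B f g \<noteq> 0"
      \<comment> \<open>If g is a null vector, the expression is affine in the parameter and would become negative.\<close>
      then show False using nonneg[of "- (B f f + 1) / (2 * B f g)"] True
        by (simp add: field_simps)
    qed
    then show ?thesis using True by simp
  next
    case False
    then have "B g g > 0" using form_pos[OF assms(2)] by simp
    then show ?thesis
      \<comment> \<open>The minimiser of the quadratic polynomial in the parameter.\<close>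
      using nonneg[of "- B f g / B g g"] by (simp add: field_simps power2_eq_square)
  qed
  then have "sqrt ((B f g)\<^sup>2) \<le> sqrt (B f f * B g g)" by (rule real_sqrt_le_mono)
  then show ?thesis by (simp only: N_def real_sqrt_mult real_sqrt_abs)
qed

lemma N_add_le:
  assumes "f \<in> V" "g \<in> V"
  shows "N (\<lambda>x. f x + g x) \<le> N f + N g"
proof -
  have "(N (\<lambda>x. f x + g x))\<^sup>2 = B f f + 2 * B f g + B g g"
    using assms form_sym[of g f] by (simp add: N_sq form_add form_add_right add_mem)
  also have "\<dots> \<le> (N f + N g)\<^sup>2"
    using Cauchy_Schwarz[OF assms] assms by (simp add: power2_sum N_sq)
  finally show ?thesis
    by (rule power2_le_imp_le) (simp add: N_nonneg assms)
qed

lemma N_diff_le: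
  assumes "f \<in> V" "g \<in> V"
  shows "\<bar>N f - N g\<bar> \<le> N (\<lambda>x. f x - g x)"
  using N_add_le[OF diff_mem[OF assms] assms(2)] N_add_le[OF diff_mem[OF assms(2,1)] assms(1)]
    N_minus_commute[OF assms] by simp

lemma N_tendsto:
  assumes "\<And>n. F n \<in> V" "f \<in> V" "(\<lambda>n. N (\<lambda>x. F n x - f x)) \<longlonglongrightarrow> 0"
  shows "(\<lambda>n. N (F n)) \<longlonglongrightarrow> N f"
proof -
  have "(\<lambda>n. N (F n) - N f) \<longlonglongrightarrow> 0"
    by (rule Lim_null_comparison[OF _ assms(3)])
      (intro always_eventually allI, use N_diff_le assms in simp)
  then show ?thesis by (simp add: LIM_zero_iff)
qed

lemma N_add_tendsto_0:
  assumes V: "\<And>n. F n \<in> V" "\<And>n. G n \<in> V"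
    and "(\<lambda>n. N (F n)) \<longlonglongrightarrow> 0" "(\<lambda>n. N (G n)) \<longlonglongrightarrow> 0"
  shows "(\<lambda>n. N (\<lambda>x. F n x + G n x)) \<longlonglongrightarrow> 0"
proof (rule Lim_null_comparison)
  show "(\<lambda>n. N (F n) + N (G n)) \<longlonglongrightarrow> 0" using tendsto_add[OF assms(3,4)] by simp
  show "\<forall>\<^sub>F n in sequentially. norm (N (\<lambda>x. F n x + G n x)) \<le> N (F n) + N (G n)"
    by (intro always_eventually allI) (use V N_add_le in \<open>simp add: N_nonneg add_mem\<close>)
qed

lemma N_scale_tendsto_0:
  assumes "\<And>n. F n \<in> V" "(\<lambda>n. N (F n)) \<longlonglongrightarrow> 0"
  shows "(\<lambda>n. N (\<lambda>x. a * F n x)) \<longlonglongrightarrow> 0"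
  using tendsto_mult_left[OF assms(2), of "\<bar>a\<bar>"] assms(1) by (simp add: N_scale)

text \<open>The comparison sequences \<open>F'\<close> and \<open>G'\<close> need not converge to an element of the space; convergence of
their norms keeps the error terms of the Cauchy-Schwarz inequality bounded. This covers the
completion, where limits are only represented by sequences.\<close>

lemma form_tendsto_same:
  assumes V: "\<And>n. F n \<in> V" "\<And>n. F' n \<in> V" "\<And>n. G n \<in> V" "\<And>n. G' n \<in> V"
    and F: "(\<lambda>n. N (\<lambda>x. F n x - F' n x)) \<longlonglongrightarrow> 0" and G: "(\<lambda>n. N (\<lambda>x. G n x - G' n x)) \<longlonglongrightarrow> 0"
    and lF: "(\<lambda>n. N (F' n)) \<longlonglongrightarrow> l" and lG: "(\<lambda>n. N (G n)) \<longlonglongrightarrow> l'"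
  shows "(\<lambda>n. B (F n) (G n) - B (F' n) (G' n)) \<longlonglongrightarrow> 0"
proof (rule Lim_null_comparison)
  show "\<forall>\<^sub>F n in sequentially. norm (B (F n) (G n) - B (F' n) (G' n))
      \<le> N (\<lambda>x. F n x - F' n x) * N (G n) + N (F' n) * N (\<lambda>x. G n x - G' n x)"
  proof (rule always_eventually, rule allI)
    fix n
    have "B (F n) (G n) - B (F' n) (G' n)
        = B (\<lambda>x. F n x - F' n x) (G n) + B (F' n) (\<lambda>x. G n x - G' n x)"
      using V by (simp add: form_diff form_diff_right)
    then show "norm (B (F n) (G n) - B (F' n) (G' n))
      \<le> N (\<lambda>x. F n x - F' n x) * N (G n) + N (F' n) * N (\<lambda>x. G n x - G' n x)"
      using Cauchy_Schwarz[OF diff_mem[OF V(1,2)] V(3), of n n n]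
        Cauchy_Schwarz[OF V(2) diff_mem[OF V(3,4)], of n n n] by simp
  qed
  show "(\<lambda>n. N (\<lambda>x. F n x - F' n x) * N (G n) + N (F' n) * N (\<lambda>x. G n x - G' n x)) \<longlonglongrightarrow> 0"
    using tendsto_add[OF tendsto_mult[OF F lG] tendsto_mult[OF lF G]] by simp
qed

end

section \<open>The completion of the step functions\<close>

lemma step_rep_extend:
  assumes "step_rep T A c f" "A \<subseteq> C" "finite C" "C \<subseteq> {0..T}"
  shows "step_rep T C (\<lambda>t. if t \<in> A then c t else 0) f"
proof -
  have "(\<Sum>t\<in>A. c t * indicator {0<..t} x) =
     (\<Sum>t\<in>C. (if t \<in> A then c t else 0) * indicator {0<..t} x)" for x :: real
    using assms by (intro sum.mono_neutral_cong_left) auto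
  then show ?thesis using assms by (simp add: step_rep_def)
qed

lemma step_funs_common:
  assumes "f \<in> step_funs T" "g \<in> step_funs T"
  obtains A c d where "step_rep T A c f" "step_rep T A d g"
proof -
  obtain A c B d where *: "step_rep T A c f" "step_rep T B d g"
    using assms by (auto simp: step_funs_def)
  then have AB: "finite (A \<union> B)" "A \<union> B \<subseteq> {0..T}" by (simp_all add: step_rep_def)
  show ?thesis
    by (rule that[OF step_rep_extend[OF *(1) _ AB] step_rep_extend[OF *(2) _ AB]]) auto
qed

lemma step_rep_add:
  "step_rep T A c f \<Longrightarrow> step_rep T A d g \<Longrightarrow> step_rep T A (\<lambda>t. c t + d t) (\<lambda>x. f x + g x)"
  by (auto simp only: step_rep_def sum.distrib distrib_right)

lemma step_rep_scale:
  "step_rep T A c f \<Longrightarrow> step_rep T A (\<lambda>t. a * c t) (\<lambda>x. a * f x)"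
  by (auto simp only: step_rep_def sum_distrib_left mult.assoc)

lemma indicator_step_rep: "t \<in> {0..T} \<Longrightarrow> step_rep T {t} (\<lambda>_. 1) (indicator {0<..t})"
  by (simp add: step_rep_def)

lemma indicator_step_fun: "t \<in> {0..T} \<Longrightarrow> indicator {0<..t} \<in> step_funs T"
  using indicator_step_rep by (auto simp: step_funs_def)

locale cov_kernel =
  fixes T :: real and R :: "real \<Rightarrow> real \<Rightarrow> real"
  assumes kernel_sym: "t \<in> {0..T} \<Longrightarrow> s \<in> {0..T} \<Longrightarrow> R t s = R s t"
    and kernel_zero: "t \<in> {0..T} \<Longrightarrow> R 0 t = 0"
    and kernel_psd: "finite A \<Longrightarrow> A \<subseteq> {0..T} \<Longrightarrow> 0 \<le> (\<Sum>t\<in>A. \<Sum>s\<in>A. c t * c s * R t s)"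
begin

lemma kernel_zero': "t \<in> {0..T} \<Longrightarrow> R t 0 = 0"
  using kernel_sym[of t 0] kernel_zero[of t] by force

lemma step_inner_rep:
  "step_rep T A c f \<Longrightarrow> step_rep T B d g \<Longrightarrow>
    step_inner T R f g = (\<Sum>t\<in>A. \<Sum>s\<in>B. c t * d s * R t s)"
  by (rule step_inner_eq) (simp_all add: kernel_zero kernel_zero')

sublocale semi_inner "step_funs T" "step_inner T R"
proof
  show "(\<lambda>x. 0) \<in> step_funs T"
    by (auto simp: step_funs_def step_rep_def intro!: exI[of _ "{}"])
next
  fix f g assume "f \<in> step_funs T" "g \<in> step_funs T"
  then show "(\<lambda>x. f x + g x) \<in> step_funs T"
    by (metis (mono_tags) step_funs_common step_rep_add step_funs_def mem_Collect_eq)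
next
  fix f a assume "f \<in> step_funs T"
  then show "(\<lambda>x. a * f x) \<in> step_funs T"
    using step_rep_scale by (fastforce simp: step_funs_def)
next
  fix f g h assume fg: "f \<in> step_funs T" "g \<in> step_funs T" and h: "h \<in> step_funs T"
  obtain A c d where 1: "step_rep T A c f" "step_rep T A d g" by (rule step_funs_common[OF fg])
  obtain B e where 2: "step_rep T B e h" using h by (auto simp: step_funs_def)
  show "step_inner T R (\<lambda>x. f x + g x) h = step_inner T R f h + step_inner T R g h"
    using step_inner_rep[OF 1(1) 2] step_inner_rep[OF 1(2) 2]
      step_inner_rep[OF step_rep_add[OF 1] 2]
    by (simp add: sum.distrib distrib_right)
next
  fix f h a assume "f \<in> step_funs T" and h: "h \<in> step_funs T"
  then obtain A c B e where 1: "step_rep T A c f" and 2: "step_rep T B e h"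
    by (auto simp: step_funs_def)
  show "step_inner T R (\<lambda>x. a * f x) h = a * step_inner T R f h"
    using step_inner_rep[OF 1 2] step_inner_rep[OF step_rep_scale[OF 1] 2]
    by (simp add: sum_distrib_left mult.assoc)
next
  fix f g assume fg: "f \<in> step_funs T" "g \<in> step_funs T"
  obtain A c d where 1: "step_rep T A c f" "step_rep T A d g" by (rule step_funs_common[OF fg])
  then have sub: "A \<subseteq> {0..T}" by (simp add: step_rep_def)
  have "step_inner T R f g = (\<Sum>t\<in>A. \<Sum>s\<in>A. c t * d s * R t s)"
    using 1 by (rule step_inner_rep)
  also have "\<dots> = (\<Sum>s\<in>A. \<Sum>t\<in>A. c t * d s * R t s)" by (rule sum.swap)
  also have "\<dots> = (\<Sum>s\<in>A. \<Sum>t\<in>A. d s * c t * R s t)"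
    using sub by (intro sum.cong refl) (auto simp: kernel_sym subset_iff)
  also have "\<dots> = step_inner T R g f" using step_inner_rep[OF 1(2) 1(1)] by simp
  finally show "step_inner T R f g = step_inner T R g f" .
next
  fix f assume "f \<in> step_funs T"
  then obtain A c where 1: "step_rep T A c f" by (auto simp: step_funs_def)
  then show "0 \<le> step_inner T R f f"
    using step_inner_rep[OF 1 1] by (auto simp: step_rep_def intro!: kernel_psd)
qed

lemma step_norm_eq_N: "step_norm T R = N"
  by (rule ext) (simp add: step_norm_def N_def)

lemma inner_indicator: "t \<in> {0..T} \<Longrightarrow> s \<in> {0..T} \<Longrightarrow>
    step_inner T R (indicator {0<..t}) (indicator {0<..s}) = R t s"
  using step_inner_rep[OF indicator_step_rep indicator_step_rep] by simp

lemma inner_sum_indicator: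
  assumes "\<And>i. i \<in> I \<Longrightarrow> b i \<in> {0..T}"
  shows "step_inner T R (\<lambda>x. \<Sum>i\<in>I. c i * indicator {0<..b i} x)
      (\<lambda>x. \<Sum>i\<in>I. c i * indicator {0<..b i} x) = (\<Sum>i\<in>I. \<Sum>j\<in>I. c i * c j * R (b i) (b j))"
  using form_sum_sum[of I "\<lambda>i. indicator {0<..b i}" c] assms
  by (simp add: indicator_step_fun inner_indicator cong: sum.cong)

abbreviation "C \<equiv> cauchy_steps T R"
abbreviation "E \<equiv> cauchy_equiv T R"

lemma cauchy_memD: "F \<in> C \<Longrightarrow> F n \<in> step_funs T"
  by (simp add: cauchy_steps_def)

lemma equiv_cauchy: "equiv C E"
proof (rule equivI)
  show "E \<subseteq> C \<times> C" by (auto simp: cauchy_equiv_def)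
  show "refl_on C E"
    by (rule refl_onI) (auto simp: cauchy_equiv_def step_norm_eq_N N_def form_zero zero_mem)
  show "sym E"
    by (rule symI)
      (auto simp: cauchy_equiv_def step_norm_eq_N N_minus_commute[OF cauchy_memD cauchy_memD])
  show "trans E"
  proof (rule transI)
    fix F G K assume "(F, G) \<in> E" "(G, K) \<in> E"
    then have mem: "F \<in> C" "G \<in> C" "K \<in> C"
      and lim: "(\<lambda>n. N (\<lambda>x. F n x - G n x)) \<longlonglongrightarrow> 0" "(\<lambda>n. N (\<lambda>x. G n x - K n x)) \<longlonglongrightarrow> 0"
      by (auto simp: cauchy_equiv_def step_norm_eq_N)
    have "(\<lambda>n. N (\<lambda>x. (F n x - G n x) + (G n x - K n x))) \<longlonglongrightarrow> 0"
      using mem lim by (intro N_add_tendsto_0 diff_mem cauchy_memD)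
    then show "(F, K) \<in> E" using mem by (simp add: cauchy_equiv_def step_norm_eq_N)
  qed
qed

lemma cauchy_memI:
  assumes "\<And>n. F n \<in> step_funs T"
    and "\<And>e. e > 0 \<Longrightarrow> \<exists>k. \<forall>m\<ge>k. \<forall>n\<ge>k. N (\<lambda>x. F m x - F n x) < e"
  shows "F \<in> C"
  using assms by (simp add: cauchy_steps_def step_norm_eq_N)

lemma cauchyD: "F \<in> C \<Longrightarrow> e > 0 \<Longrightarrow> \<exists>k. \<forall>m\<ge>k. \<forall>n\<ge>k. N (\<lambda>x. F m x - F n x) < e"
  by (simp add: cauchy_steps_def step_norm_eq_N)

lemma cauchy_add:
  assumes "F \<in> C" "G \<in> C"
  shows "(\<lambda>n x. F n x + G n x) \<in> C"
proof (rule cauchy_memI)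
  fix n show "(\<lambda>x. F n x + G n x) \<in> step_funs T" using assms by (intro add_mem cauchy_memD)
next
  fix e :: real assume "e > 0"
  obtain k where k: "\<And>m n. m \<ge> k \<Longrightarrow> n \<ge> k \<Longrightarrow> N (\<lambda>x. F m x - F n x) < e / 2"
    using cauchyD[OF assms(1), of "e / 2"] \<open>e > 0\<close> by auto
  obtain l where l: "\<And>m n. m \<ge> l \<Longrightarrow> n \<ge> l \<Longrightarrow> N (\<lambda>x. G m x - G n x) < e / 2"
    using cauchyD[OF assms(2), of "e / 2"] \<open>e > 0\<close> by auto
  have "N (\<lambda>x. F m x + G m x - (F n x + G n x)) < e" if "m \<ge> max k l" "n \<ge> max k l" for m n
  proof -
    have "N (\<lambda>x. (F m x - F n x) + (G m x - G n x)) \<le> N (\<lambda>x. F m x - F n x) + N (\<lambda>x. G m x - G n x)"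
      using assms by (intro N_add_le diff_mem cauchy_memD)
    also have "\<dots> < e" using k[of m n] l[of m n] that by simp
    finally show ?thesis by (simp add: algebra_simps)
  qed
  then show "\<exists>k. \<forall>m\<ge>k. \<forall>n\<ge>k. N (\<lambda>x. F m x + G m x - (F n x + G n x)) < e" by blast
qed

text \<open>An operator on step functions that is Lipschitz for the seminorm acts termwise on Cauchy sequences.
Scaling and truncation are the two cases in use.\<close>

lemma cauchy_bounded_image:
  assumes "F \<in> C" and mem: "\<And>n. L (F n) \<in> step_funs T"
    and le: "\<And>m n. N (\<lambda>x. L (F m) x - L (F n) x) \<le> K * N (\<lambda>x. F m x - F n x)"
  shows "(\<lambda>n. L (F n)) \<in> C"
proof (rule cauchy_memI)
  fix e :: real assume "e > 0"
  then obtain k where k: "\<And>m n. m \<ge> k \<Longrightarrow> n \<ge> k \<Longrightarrow> N (\<lambda>x. F m x - F n x) < e / (\<bar>K\<bar> + 1)"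
    using cauchyD[OF assms(1), of "e / (\<bar>K\<bar> + 1)"] by auto
  have "N (\<lambda>x. L (F m) x - L (F n) x) < e" if "m \<ge> k" "n \<ge> k" for m n
  proof -
    have nn: "N (\<lambda>x. F m x - F n x) \<ge> 0" using assms(1) by (intro N_nonneg diff_mem cauchy_memD)
    have "N (\<lambda>x. L (F m) x - L (F n) x) \<le> (\<bar>K\<bar> + 1) * N (\<lambda>x. F m x - F n x)"
      using le[of m n] nn by (smt (verit) mult_right_mono)
    also have "\<dots> < e" using k[OF that] by (simp add: field_simps)
    finally show ?thesis .
  qed
  then show "\<exists>k. \<forall>m\<ge>k. \<forall>n\<ge>k. N (\<lambda>x. L (F m) x - L (F n) x) < e" by blast
qed (rule mem)

lemma cauchy_scale: "F \<in> C \<Longrightarrow> (\<lambda>n x. a * F n x) \<in> C"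
  by (rule cauchy_bounded_image[where L = "\<lambda>f x. a * f x" and K = "\<bar>a\<bar>"])
    (auto simp: scale_mem cauchy_memD N_scale diff_mem simp flip: right_diff_distrib)

lemma cauchy_const: "f \<in> step_funs T \<Longrightarrow> (\<lambda>n. f) \<in> C"
  by (rule cauchy_memI) (auto simp: N_def form_zero zero_mem)

lemma integrandsE:
  assumes "h \<in> integrands T R"
  obtains F where "F \<in> C" "h = E `` {F}"
  using assms by (auto simp: integrands_def elim: quotientE)

lemma class_mem: "F \<in> C \<Longrightarrow> E `` {F} \<in> integrands T R"
  by (auto simp: integrands_def intro: quotientI)

lemma class_eqI:
  assumes "F \<in> C" "G \<in> C" "(\<lambda>n. N (\<lambda>x. F n x - G n x)) \<longlonglongrightarrow> 0"
  shows "E `` {F} = E `` {G}"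
  using assms by (intro equiv_class_eq[OF equiv_cauchy]) (simp add: cauchy_equiv_def step_norm_eq_N)

lemma equivD:
  assumes "(F, G) \<in> E"
  shows "F \<in> C" "G \<in> C" "(\<lambda>n. N (\<lambda>x. F n x - G n x)) \<longlonglongrightarrow> 0"
  using assms by (auto simp: cauchy_equiv_def step_norm_eq_N)

lemma class_add:
  assumes "F \<in> C" "G \<in> C"
  shows "integrand_add T R (E `` {F}) (E `` {G}) = E `` {\<lambda>n x. F n x + G n x}"
  unfolding integrand_add_def
proof (rule UN_equiv_class2[OF equiv_cauchy equiv_cauchy congruent2I' assms])
  fix F F' G G' assume *: "(F, F') \<in> E" "(G, G') \<in> E"
  have "(\<lambda>n. N (\<lambda>x. (F n x - F' n x) + (G n x - G' n x))) \<longlonglongrightarrow> 0"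
    using equivD[OF *(1)] equivD[OF *(2)] by (intro N_add_tendsto_0 diff_mem cauchy_memD)
  then show "E `` {\<lambda>n x. F n x + G n x} = E `` {\<lambda>n x. F' n x + G' n x}"
    using equivD[OF *(1)] equivD[OF *(2)]
    by (intro class_eqI cauchy_add) (auto simp: algebra_simps)
qed

text \<open>A termwise operation that respects null sequences is well defined on the completion, so the union
over all representatives reduces to the value at any one of them.\<close>

lemma class_UN:
  assumes "F \<in> C" and cauchy: "\<And>F. F \<in> C \<Longrightarrow> (\<lambda>n. L (F n)) \<in> C"
    and lim: "\<And>F G. (F, G) \<in> E \<Longrightarrow> (\<lambda>n. N (\<lambda>x. L (F n) x - L (G n) x)) \<longlonglongrightarrow> 0"
  shows "(\<Union>F\<in>E `` {F}. E `` {\<lambda>n. L (F n)}) = E `` {\<lambda>n. L (F n)}"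
  by (rule UN_equiv_class[OF equiv_cauchy congruentI assms(1)])
    (intro class_eqI cauchy lim, auto dest: equivD)

lemma class_scale:
  assumes "F \<in> C"
  shows "integrand_scale T R a (E `` {F}) = E `` {\<lambda>n x. a * F n x}"
  unfolding integrand_scale_def
proof (rule class_UN[where L = "\<lambda>f x. a * f x", OF assms cauchy_scale])
  fix F G assume "(F, G) \<in> E"
  then have "(\<lambda>n. N (\<lambda>x. a * (F n x - G n x))) \<longlonglongrightarrow> 0"
    by (intro N_scale_tendsto_0 diff_mem cauchy_memD) (auto dest: equivD)
  then show "(\<lambda>n. N (\<lambda>x. a * F n x - a * G n x)) \<longlonglongrightarrow> 0" by (simp add: algebra_simps)
qed

text \<open>The norms of a Cauchy sequence of step functions converge, and by Cauchy-Schwarz the inner products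
of any two representatives of its class have the same limit, the square of the limit of the norms.\<close>

lemma class_norm:
  assumes F: "F \<in> C"
  shows "(\<lambda>n. N (F n)) \<longlonglongrightarrow> integrand_norm T R (E `` {F})"
proof -
  have "Cauchy (\<lambda>n. N (F n))"
  proof (rule metric_CauchyI)
    fix e :: real assume "e > 0"
    then obtain k where k: "\<And>m n. m \<ge> k \<Longrightarrow> n \<ge> k \<Longrightarrow> N (\<lambda>x. F m x - F n x) < e"
      using cauchyD[OF F, of e] by auto
    have "dist (N (F m)) (N (F n)) < e" if "m \<ge> k" "n \<ge> k" for m n
      using N_diff_le[OF cauchy_memD[OF F] cauchy_memD[OF F], of m n] k[OF that]
      by (simp add: dist_real_def)
    then show "\<exists>k. \<forall>m\<ge>k. \<forall>n\<ge>k. dist (N (F m)) (N (F n)) < e" by blast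
  qed
  then obtain l where l: "(\<lambda>n. N (F n)) \<longlonglongrightarrow> l"
    by (auto simp: Cauchy_convergent_iff convergent_def)
  have "l \<ge> 0"
    using l N_nonneg[OF cauchy_memD[OF F]] by (intro LIMSEQ_le_const) auto
  have lim: "(\<lambda>n. step_inner T R (F' n) (G n)) \<longlonglongrightarrow> l\<^sup>2" if "F' \<in> E `` {F}" "G \<in> E `` {F}" for F' G
  proof -
    have *: "(F', F) \<in> E" "(G, F) \<in> E"
      using that equiv_cauchy by (auto simp: equiv_def sym_def)
    note F' = equivD[OF *(1)] and G = equivD[OF *(2)]
    have "(\<lambda>n. (N (G n) - N (F n)) + N (F n)) \<longlonglongrightarrow> 0 + l"
      using N_diff_le[OF cauchy_memD[OF G(1)] cauchy_memD[OF F]]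
      by (intro tendsto_add l Lim_null_comparison[OF _ G(3)] always_eventually) simp
    then have "(\<lambda>n. N (G n)) \<longlonglongrightarrow> l" by simp
    then have "(\<lambda>n. step_inner T R (F' n) (G n) - step_inner T R (F n) (F n)) \<longlonglongrightarrow> 0"
      using F' G l by (intro form_tendsto_same cauchy_memD)
    moreover have "(\<lambda>n. step_inner T R (F n) (F n)) \<longlonglongrightarrow> l\<^sup>2"
      using tendsto_power[OF l, of 2] by (simp add: N_sq[OF cauchy_memD[OF F]])
    ultimately show ?thesis using tendsto_add by fastforce
  qed
  have F0: "F \<in> E `` {F}" by (rule equiv_class_self[OF equiv_cauchy F])
  have "integrand_inner T R (E `` {F}) (E `` {F}) = l\<^sup>2"
    unfolding integrand_inner_def
  proof (rule the_equality)
    show "\<forall>F'\<in>E `` {F}. \<forall>G\<in>E `` {F}. (\<lambda>n. step_inner T R (F' n) (G n)) \<longlonglongrightarrow> l\<^sup>2" using lim by blast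
    fix v assume "\<forall>F'\<in>E `` {F}. \<forall>G\<in>E `` {F}. (\<lambda>n. step_inner T R (F' n) (G n)) \<longlonglongrightarrow> v"
    then show "v = l\<^sup>2" using F0 lim LIMSEQ_unique by blast
  qed
  then show ?thesis using l \<open>l \<ge> 0\<close> by (simp add: integrand_norm_def)
qed

lemma class_norm_const: "f \<in> step_funs T \<Longrightarrow> integrand_norm T R (E `` {\<lambda>n. f}) = N f"
  by (rule LIMSEQ_unique[OF class_norm[OF cauchy_const] tendsto_const])

end

section \<open>Operators extending the truncation\<close>

definition truncate :: "real \<Rightarrow> (real \<Rightarrow> real) \<Rightarrow> real \<Rightarrow> real" where
  "truncate r f = (\<lambda>x. f x * indicator {0<..r} x)"

text \<open>If \<open>R\<close> is the covariance of a process \<open>X\<close>, the two double sums are the variances of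
\<open>\<Sum> c\<^sub>t X\<^bsub>min t r\<^esub>\<close> and of \<open>\<Sum> c\<^sub>t X\<^sub>t\<close>.\<close>

definition truncation_bounded :: "real \<Rightarrow> (real \<Rightarrow> real \<Rightarrow> real) \<Rightarrow> real \<Rightarrow> bool" where
  "truncation_bounded T R r \<longleftrightarrow>
     (\<exists>K. \<forall>A c. finite A \<longrightarrow> A \<subseteq> {0..T} \<longrightarrow>
        (\<Sum>t\<in>A. \<Sum>s\<in>A. c t * c s * R (min t r) (min s r))
          \<le> K * (\<Sum>t\<in>A. \<Sum>s\<in>A. c t * c s * R t s))"

lemma truncate_sum:
  "truncate r (\<lambda>x. \<Sum>t\<in>A. c t * indicator {0<..t} x) = (\<lambda>x. \<Sum>t\<in>A. c t * indicator {0<..min t r} x)"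
  unfolding truncate_def sum_distrib_right
  by (intro ext sum.cong refl) (auto simp: indicator_def)

context cov_kernel
begin

lemma truncate_mem:
  assumes "f \<in> step_funs T" "r \<in> {0..T}"
  shows "truncate r f \<in> step_funs T"
proof -
  obtain A c where A: "step_rep T A c f" using assms(1) by (auto simp: step_funs_def)
  then have "f = (\<lambda>x. \<Sum>t\<in>A. c t * indicator {0<..t} x)" and sub: "A \<subseteq> {0..T}"
    by (simp_all only: step_rep_def)
  then have "truncate r f = (\<lambda>x. \<Sum>t\<in>A. c t * indicator {0<..min t r} x)"
    by (simp only: truncate_sum)
  also have "\<dots> \<in> step_funs T"
    using sub assms(2) by (intro sum_mem indicator_step_fun) (auto simp: min_def)
  finally show ?thesis .
qed

lemma truncate_diff: "truncate r (\<lambda>x. f x - g x) = (\<lambda>x. truncate r f x - truncate r g x)"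
  by (simp add: truncate_def left_diff_distrib)

lemma N_truncate_le:
  assumes "truncation_bounded T R r" and r: "r \<in> {0..T}"
  shows "\<exists>K. \<forall>f\<in>step_funs T. N (truncate r f) \<le> K * N f"
proof -
  obtain K where K: "\<And>A c. finite A \<Longrightarrow> A \<subseteq> {0..T} \<Longrightarrow>
      (\<Sum>t\<in>A. \<Sum>s\<in>A. c t * c s * R (min t r) (min s r)) \<le> K * (\<Sum>t\<in>A. \<Sum>s\<in>A. c t * c s * R t s)"
    using assms(1) unfolding truncation_bounded_def by blast
  show ?thesis
  \<comment> \<open>The constant K bounds squares of norms and may be negative if the form vanishes identically.\<close>
  proof (rule exI[of _ "sqrt \<bar>K\<bar>"], rule ballI)
    fix f assume f: "f \<in> step_funs T"
    obtain A c where A: "step_rep T A c f" using f by (auto simp: step_funs_def)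
    have eq: "f = (\<lambda>x. \<Sum>t\<in>A. c t * indicator {0<..t} x)" and sub: "A \<subseteq> {0..T}" "finite A"
      using A by (simp_all only: step_rep_def)
    have "step_inner T R (truncate r f) (truncate r f)
        = (\<Sum>t\<in>A. \<Sum>s\<in>A. c t * c s * R (min t r) (min s r))"
      unfolding eq truncate_sum
      by (rule inner_sum_indicator) (use sub r in \<open>auto simp: min_def\<close>)
    also have "\<dots> \<le> K * (\<Sum>t\<in>A. \<Sum>s\<in>A. c t * c s * R t s)"
      by (rule K[OF sub(2,1)])
    also have "\<dots> \<le> \<bar>K\<bar> * (\<Sum>t\<in>A. \<Sum>s\<in>A. c t * c s * R t s)"
      by (intro mult_right_mono kernel_psd sub) simp
    also have "\<dots> = \<bar>K\<bar> * step_inner T R f f"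
      by (simp only: step_inner_rep[OF A A])
    finally have "sqrt (step_inner T R (truncate r f) (truncate r f)) \<le> sqrt (\<bar>K\<bar> * step_inner T R f f)"
      by (rule real_sqrt_le_mono)
    then show "N (truncate r f) \<le> sqrt \<bar>K\<bar> * N f" by (simp only: N_def real_sqrt_mult)
  qed
qed

text \<open>The operator is truncation applied termwise to a representing Cauchy sequence. Boundedness on step
functions makes it well defined on classes, and the bound survives the passage to the limit.\<close>

lemma truncation_operator_exists:
  assumes "truncation_bounded T R r" and r: "r \<in> {0..T}"
  shows "\<exists>J. continuous_linear_operator T R J \<and>
     (\<forall>t\<in>{0..T}. J (integrand_indicator T R t) = integrand_indicator T R (min t r))"
proof -
  obtain K where K: "\<And>f. f \<in> step_funs T \<Longrightarrow> N (truncate r f) \<le> K * N f"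
    using N_truncate_le[OF assms] by blast
  have K_diff: "N (\<lambda>x. truncate r f x - truncate r g x) \<le> K * N (\<lambda>x. f x - g x)"
    if "f \<in> step_funs T" "g \<in> step_funs T" for f g
    using K[OF diff_mem[OF that]] by (simp only: truncate_diff)
  have cauchy: "(\<lambda>n. truncate r (F n)) \<in> C" if F: "F \<in> C" for F
    by (rule cauchy_bounded_image[where L = "truncate r", OF F truncate_mem[OF cauchy_memD[OF F] r]])
      (rule K_diff[OF cauchy_memD[OF F] cauchy_memD[OF F]])
  define J where "J h = (\<Union>F\<in>h. E `` {\<lambda>n. truncate r (F n)})" for h
  have J: "J (E `` {F}) = E `` {\<lambda>n. truncate r (F n)}" if F: "F \<in> C" for F
    unfolding J_def
  proof (rule class_UN[where L = "truncate r", OF F cauchy])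
    fix F G assume FG: "(F, G) \<in> E"
    note FG = equivD[OF this]
    show "(\<lambda>n. N (\<lambda>x. truncate r (F n) x - truncate r (G n) x)) \<longlonglongrightarrow> 0"
    proof (rule Lim_null_comparison)
      show "(\<lambda>n. K * N (\<lambda>x. F n x - G n x)) \<longlonglongrightarrow> 0"
        using tendsto_mult_left[OF FG(3), of K] by simp
      have "norm (N (\<lambda>x. truncate r (F n) x - truncate r (G n) x)) \<le> K * N (\<lambda>x. F n x - G n x)" for n
        using K_diff[OF cauchy_memD[OF FG(1)] cauchy_memD[OF FG(2)], of n n]
          N_nonneg[OF diff_mem[OF cauchy_memD[OF cauchy[OF FG(1)]] cauchy_memD[OF cauchy[OF FG(2)]]], of n n]
        by simp
      then show "\<forall>\<^sub>F n in sequentially. norm (N (\<lambda>x. truncate r (F n) x - truncate r (G n) x))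
          \<le> K * N (\<lambda>x. F n x - G n x)" by simp
    qed
  qed
  have add: "J (integrand_add T R h k) = integrand_add T R (J h) (J k)"
    if h: "h \<in> integrands T R" and k: "k \<in> integrands T R" for h k
  proof -
    obtain F where F: "F \<in> C" "h = E `` {F}" by (rule integrandsE[OF h])
    obtain G where G: "G \<in> C" "k = E `` {G}" by (rule integrandsE[OF k])
    have "truncate r (\<lambda>x. F n x + G n x) = (\<lambda>x. truncate r (F n) x + truncate r (G n) x)" for n
      by (simp add: truncate_def distrib_right)
    then show ?thesis
      by (simp only: F(2) G(2) class_add[OF F(1) G(1)] J[OF F(1)] J[OF G(1)] J[OF cauchy_add[OF F(1) G(1)]]
          class_add[OF cauchy[OF F(1)] cauchy[OF G(1)]])
  qed
  have scale: "J (integrand_scale T R a h) = integrand_scale T R a (J h)"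
    if h: "h \<in> integrands T R" for a h
  proof -
    obtain F where F: "F \<in> C" "h = E `` {F}" by (rule integrandsE[OF h])
    have "truncate r (\<lambda>x. a * F n x) = (\<lambda>x. a * truncate r (F n) x)" for n
      by (simp add: truncate_def mult.assoc)
    then show ?thesis
      by (simp only: F(2) class_scale[OF F(1)] J[OF F(1)] J[OF cauchy_scale[OF F(1)]]
          class_scale[OF cauchy[OF F(1)]])
  qed
  have mem: "J h \<in> integrands T R" if h: "h \<in> integrands T R" for h
  proof -
    obtain F where F: "F \<in> C" "h = E `` {F}" by (rule integrandsE[OF h])
    show ?thesis by (simp only: F(2) J[OF F(1)] class_mem[OF cauchy[OF F(1)]])
  qed
  have norm: "integrand_norm T R (J h) \<le> K * integrand_norm T R h" if h: "h \<in> integrands T R" for h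
  proof -
    obtain F where F: "F \<in> C" "h = E `` {F}" by (rule integrandsE[OF h])
    show ?thesis
      unfolding F(2) J[OF F(1)]
      by (rule LIMSEQ_le[OF class_norm[OF cauchy[OF F(1)]] tendsto_mult_left[OF class_norm[OF F(1)]]])
        (use K[OF cauchy_memD[OF F(1)]] in auto)
  qed
  have "J (integrand_indicator T R t) = integrand_indicator T R (min t r)" if t: "t \<in> {0..T}" for t
  proof -
    have "truncate r (indicator {0<..t}) = indicator {0<..min t r}"
      by (auto simp: truncate_def indicator_def)
    then show ?thesis
      unfolding integrand_indicator_def J[OF cauchy_const[OF indicator_step_fun[OF t]]] by simp
  qed
  moreover have "continuous_linear_operator T R J"
    unfolding continuous_linear_operator_def
    by (intro conjI allI ballI exI[of _ K]) (simp_all add: add scale mem norm)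
  ultimately show ?thesis by blast
qed

text \<open>By linearity, any operator with the prescribed values on indicators sends the class of a step
function to the class of its truncation, so its bound restricts to step functions.\<close>

lemma truncation_bounded_of_operator:
  assumes J: "continuous_linear_operator T R J"
    and ind: "\<And>t. t \<in> {0..T} \<Longrightarrow> J (integrand_indicator T R t) = integrand_indicator T R (min t r)"
    and r: "r \<in> {0..T}"
  shows "truncation_bounded T R r"
proof -
  have J_add: "J (integrand_add T R h k) = integrand_add T R (J h) (J k)"
    if "h \<in> integrands T R" "k \<in> integrands T R" for h k
    using J that by (simp add: continuous_linear_operator_def)
  have J_scale: "J (integrand_scale T R a h) = integrand_scale T R a (J h)"
    if "h \<in> integrands T R" for a h
    using J that by (simp add: continuous_linear_operator_def)
  obtain K where K: "\<And>h. h \<in> integrands T R \<Longrightarrow> integrand_norm T R (J h) \<le> K * integrand_norm T R h"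
    using J unfolding continuous_linear_operator_def by blast
  have mem_f: "(\<lambda>x. \<Sum>t\<in>A. c t * indicator {0<..t} x) \<in> step_funs T" if "A \<subseteq> {0..T}" for A and c :: "real \<Rightarrow> real"
    using that by (intro sum_mem indicator_step_fun) auto
  have mem_g: "(\<lambda>x. \<Sum>t\<in>A. c t * indicator {0<..min t r} x) \<in> step_funs T"
    if "A \<subseteq> {0..T}" for A and c :: "real \<Rightarrow> real"
    using that r by (intro sum_mem indicator_step_fun) (auto simp: min_def)
  have J_step: "J (E `` {\<lambda>n x. \<Sum>t\<in>A. c t * indicator {0<..t} x})
      = E `` {\<lambda>n x. \<Sum>t\<in>A. c t * indicator {0<..min t r} x}"
    if "finite A" "A \<subseteq> {0..T}" for A and c :: "real \<Rightarrow> real"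
    using that
  proof (induction A)
    \<comment> \<open>The operator is only known to be additive and homogeneous; the value at zero comes from scaling by zero.\<close>
    case empty
    have 0: "(\<lambda>n. (\<lambda>x. 0)) \<in> C" by (rule cauchy_const[OF zero_mem])
    have "J (E `` {\<lambda>n x. 0}) = J (integrand_scale T R 0 (E `` {\<lambda>n x. 0}))"
      by (simp add: class_scale[OF 0])
    also have "\<dots> = integrand_scale T R 0 (J (E `` {\<lambda>n x. 0}))"
      by (rule J_scale[OF class_mem[OF 0]])
    also have "\<dots> = E `` {\<lambda>n x. 0}"
    proof -
      have "J (E `` {\<lambda>n x. 0}) \<in> integrands T R"
        using J class_mem[OF 0] by (simp add: continuous_linear_operator_def)
      then obtain F where F: "F \<in> C" "J (E `` {\<lambda>n x. 0}) = E `` {F}" by (rule integrandsE)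
      show ?thesis unfolding F(2) class_scale[OF F(1)] by simp
    qed
    finally show ?case by simp
  next
    case (insert u A)
    then have u: "u \<in> {0..T}" and A: "A \<subseteq> {0..T}" by auto
    have ur: "min u r \<in> {0..T}" using u r by (auto simp: min_def)
    note iu = cauchy_const[OF indicator_step_fun[OF u]]
    note iur = cauchy_const[OF indicator_step_fun[OF ur]]
    have "J (E `` {\<lambda>n x. \<Sum>t\<in>insert u A. c t * indicator {0<..t} x})
      = J (E `` {\<lambda>n x. c u * indicator {0<..u} x + (\<Sum>t\<in>A. c t * indicator {0<..t} x)})"
      by (simp only: sum.insert[OF insert.hyps])
    also have "\<dots> = J (integrand_add T R (integrand_scale T R (c u) (E `` {\<lambda>n. indicator {0<..u}}))
        (E `` {\<lambda>n x. \<Sum>t\<in>A. c t * indicator {0<..t} x}))"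
      unfolding class_scale[OF iu] class_add[OF cauchy_scale[OF iu] cauchy_const[OF mem_f[OF A]]] ..
    also have "\<dots> = integrand_add T R (integrand_scale T R (c u) (J (E `` {\<lambda>n. indicator {0<..u}})))
        (J (E `` {\<lambda>n x. \<Sum>t\<in>A. c t * indicator {0<..t} x}))"
    proof -
      have "integrand_scale T R (c u) (E `` {\<lambda>n. indicator {0<..u}}) \<in> integrands T R"
        unfolding class_scale[OF iu] by (rule class_mem[OF cauchy_scale[OF iu]])
      then show ?thesis
        using J_add[OF _ class_mem[OF cauchy_const[OF mem_f[OF A]]]] J_scale[OF class_mem[OF iu]] by simp
    qed
    also have "J (E `` {\<lambda>n. indicator {0<..u}}) = E `` {\<lambda>n. indicator {0<..min u r}}"
      using ind[OF u] by (simp only: integrand_indicator_def)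
    also have "J (E `` {\<lambda>n x. \<Sum>t\<in>A. c t * indicator {0<..t} x})
        = E `` {\<lambda>n x. \<Sum>t\<in>A. c t * indicator {0<..min t r} x}"
      by (rule insert.IH[OF A])
    also have "integrand_add T R (integrand_scale T R (c u) (E `` {\<lambda>n. indicator {0<..min u r}}))
        (E `` {\<lambda>n x. \<Sum>t\<in>A. c t * indicator {0<..min t r} x})
      = E `` {\<lambda>n x. c u * indicator {0<..min u r} x + (\<Sum>t\<in>A. c t * indicator {0<..min t r} x)}"
      unfolding class_scale[OF iur] class_add[OF cauchy_scale[OF iur] cauchy_const[OF mem_g[OF A]]] ..
    finally show ?case by (simp only: sum.insert[OF insert.hyps])
  qed
  have "(\<Sum>t\<in>A. \<Sum>s\<in>A. c t * c s * R (min t r) (min s r)) \<le> K\<^sup>2 * (\<Sum>t\<in>A. \<Sum>s\<in>A. c t * c s * R t s)"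
    if A: "finite A" "A \<subseteq> {0..T}" for A and c :: "real \<Rightarrow> real"
  proof -
    let ?f = "\<lambda>x. \<Sum>t\<in>A. c t * indicator {0<..t} x"
    let ?g = "\<lambda>x. \<Sum>t\<in>A. c t * indicator {0<..min t r} x"
    have "N ?g \<le> K * N ?f"
      using K[OF class_mem[OF cauchy_const[OF mem_f[OF A(2)]]]]
      by (simp only: J_step[OF A] class_norm_const[OF mem_f[OF A(2)]] class_norm_const[OF mem_g[OF A(2)]])
    then have "(N ?g)\<^sup>2 \<le> (K * N ?f)\<^sup>2"
      by (intro power_mono N_nonneg mem_g A)
    then have "step_inner T R ?g ?g \<le> K\<^sup>2 * step_inner T R ?f ?f"
      by (simp only: power_mult_distrib N_sq[OF mem_f[OF A(2)]] N_sq[OF mem_g[OF A(2)]])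
    moreover have "step_inner T R ?f ?f = (\<Sum>t\<in>A. \<Sum>s\<in>A. c t * c s * R t s)"
      by (rule inner_sum_indicator) (use A in auto)
    moreover have "step_inner T R ?g ?g = (\<Sum>t\<in>A. \<Sum>s\<in>A. c t * c s * R (min t r) (min s r))"
      by (rule inner_sum_indicator) (use A r in \<open>auto simp: min_def\<close>)
    ultimately show ?thesis by (simp only:)
  qed
  then show ?thesis unfolding truncation_bounded_def by blast
qed

end

lemma indefinite_wiener_integral_iff:
  assumes "cov_kernel T (covariance M X)"
  shows "has_indefinite_wiener_integral M T X \<longleftrightarrow> (\<forall>r\<in>{0..T}. truncation_bounded T (covariance M X) r)"
  unfolding has_indefinite_wiener_integral_def
  using cov_kernel.truncation_operator_exists[OF assms] cov_kernel.truncation_bounded_of_operator[OF assms]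
  by (metis (mono_tags, lifting))

section \<open>A homogeneous kernel on the half line\<close>

text \<open>This passes between gauge integrals, for which improper power integrals and changes of variables are
available, and Lebesgue integrals over the line.\<close>

lemma absolutely_integrable_iff_bochner:
  fixes f :: "real \<Rightarrow> real"
  assumes "(\<lambda>x. indicator S x * f x) \<in> borel_measurable borel"
  shows "f absolutely_integrable_on S \<and> integral S f = b
    \<longleftrightarrow> has_bochner_integral lborel (\<lambda>x. indicator S x * f x) b"
proof -
  have meas: "(\<lambda>x. indicator S x *\<^sub>R f x) \<in> borel_measurable lborel" using assms by simp
  have "f absolutely_integrable_on S \<longleftrightarrow> integrable lborel (\<lambda>x. indicator S x * f x)"
    using integrable_completion[OF meas] by (simp add: set_integrable_def)
  moreover have "integral S f = (\<integral>x. indicator S x * f x \<partial>lborel)" if "f absolutely_integrable_on S"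
    using set_lebesgue_integral_eq_integral(2)[OF that] integral_completion[OF meas]
    by (simp add: set_lebesgue_integral_def)
  ultimately show ?thesis by (auto simp: has_bochner_integral_iff)
qed

lemma integrable_powr_over_one_plus:
  assumes "-1 < p" "p < 0"
  shows "integrable lborel (\<lambda>w::real. indicator {0<..} w * (w powr p / (1 + w)))"
proof (rule Bochner_Integration.integrable_bound)
  have 1: "has_bochner_integral lborel (\<lambda>w::real. indicator {0..1} w * w powr p) (1 / (p + 1))"
  proof (subst absolutely_integrable_iff_bochner[symmetric])
    show "(\<lambda>w. w powr p) absolutely_integrable_on {0..1} \<and> integral {0..1} (\<lambda>w. w powr p) = 1 / (p + 1)"
      using has_integral_powr_from_0[of p 1] assms
      by (intro conjI nonnegative_absolutely_integrable_1) (auto simp: has_integral_iff)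
  qed simp
  have 2: "has_bochner_integral lborel (\<lambda>w::real. indicator {1..} w * w powr (p - 1)) (- 1 / p)"
  proof (subst absolutely_integrable_iff_bochner[symmetric])
    show "(\<lambda>w. w powr (p - 1)) absolutely_integrable_on {1..} \<and> integral {1..} (\<lambda>w. w powr (p - 1)) = - 1 / p"
      using has_integral_powr_to_inf[of "p - 1" 1] assms
      by (intro conjI nonnegative_absolutely_integrable_1) (auto simp: has_integral_iff)
  qed simp
  show "integrable lborel (\<lambda>w::real. indicator {0..1} w * w powr p + indicator {1..} w * w powr (p - 1))"
    using 1 2 by (intro Bochner_Integration.integrable_add) (auto simp: has_bochner_integral_iff)
  show "AE w in lborel. norm (indicator {0<..} w * (w powr p / (1 + w)))
      \<le> norm (indicator {0..1} w * w powr p + indicator {1..} w * w powr (p - 1) :: real)"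
  proof (intro AE_I2)
    fix w :: real
    consider "w \<le> 0" | "0 < w" "w < 1" | "1 \<le> w" by linarith
    then show "norm (indicator {0<..} w * (w powr p / (1 + w)))
      \<le> norm (indicator {0..1} w * w powr p + indicator {1..} w * w powr (p - 1) :: real)"
    proof cases
      case 2
      then show ?thesis by (simp add: indicator_def divide_le_eq mult_le_cancel_left1 algebra_simps)
    next
      case 3
      have "w powr p / (1 + w) \<le> w powr p / w"
        using 3 by (intro divide_left_mono) auto
      also have "\<dots> = w powr (p - 1)" using 3 by (simp add: powr_diff)
      finally show ?thesis using 3 by (simp add: indicator_def)
    qed simp
  qed
qed simp

text \<open>Scaling \<open>w\<close> by \<open>b\<close> reduces to \<open>b = 1\<close>. The constant is \<open>\<pi> / sin (\<pi> (p + 1))\<close>, of which only the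
positivity matters.\<close>

lemma powr_resolvent_integral:
  assumes "-1 < p" "p < 0"
  obtains c where "c > 0" "\<And>b. b > 0 \<Longrightarrow>
    has_bochner_integral lborel (\<lambda>w::real. indicator {0<..} w * (w powr p / (b + w))) (b powr p * c)"
proof -
  define f where "f w = indicator {0<..} w * (w powr p / (1 + w))" for w :: real
  define c where "c = (\<integral>w. f w \<partial>lborel)"
  have int: "integrable lborel f" unfolding f_def using assms by (rule integrable_powr_over_one_plus)
  have nonneg: "f w \<ge> 0" for w by (simp add: f_def indicator_def)
  have "c \<noteq> 0"
  proof
    assume "c = 0"
    then have "AE w in lborel. f w = 0"
      using integral_nonneg_eq_0_iff_AE[OF int] nonneg by (simp add: c_def)
    then have "AE w in lborel. w \<notin> {0<..<1::real}"
      by eventually_elim (auto simp: f_def)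
    then have "emeasure lborel {0<..<1::real} = 0"
      by (intro AE_iff_measurable[THEN iffD1, rotated 2]) auto
    then show False by simp
  qed
  then have "c > 0" using nonneg by (simp add: c_def integral_nonneg less_le)
  moreover have "has_bochner_integral lborel (\<lambda>w::real. indicator {0<..} w * (w powr p / (b + w))) (b powr p * c)"
    if b: "b > 0" for b
  proof (subst lborel_has_bochner_integral_real_affine_iff[where c = b and t = 0])
    have eq: "indicator {0<..} (0 + b * w) * ((0 + b * w) powr p / (b + (0 + b * w)))
        = b powr p / b * f w" for w
    proof -
      have "b + b * w = b * (1 + w)" by (simp add: algebra_simps)
      then show ?thesis using b by (auto simp: f_def indicator_def powr_mult zero_less_mult_iff)
    qed
    have "has_bochner_integral lborel (\<lambda>w. b powr p / b * f w) (b powr p / b * c)"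
      using int by (intro has_bochner_integral_mult_right) (auto simp: has_bochner_integral_iff c_def)
    then show "has_bochner_integral lborel (\<lambda>w. indicator {0<..} (0 + b * w) * ((0 + b * w) powr p / (b + (0 + b * w))))
        ((b powr p * c) /\<^sub>R \<bar>b\<bar>)"
      unfolding eq using b by (simp add: field_simps)
  qed (use b in simp)
  ultimately show ?thesis by (rule that)
qed

definition pos_powr :: "real \<Rightarrow> real \<Rightarrow> real" where
  "pos_powr \<alpha> x = (if x > 0 then x powr \<alpha> else 0)"

text \<open>For a moving average with kernel \<open>(t - x)\<^sub>+\<^sup>\<alpha>\<close>, this kernel recovers the value at distance \<open>a\<close> to the
left of a point from the values at all distances \<open>y\<close> to its right.\<close>

definition tail_kernel :: "real \<Rightarrow> real \<Rightarrow> real \<Rightarrow> real" where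
  "tail_kernel \<alpha> a y = (if a > 0 \<and> y > 0 then a powr \<alpha> * y powr (- \<alpha>) / (a + y) else 0)"

lemma pos_powr_nonneg [simp]: "pos_powr \<alpha> x \<ge> 0"
  by (simp add: pos_powr_def)

lemma tail_kernel_nonneg [simp]: "tail_kernel \<alpha> a y \<ge> 0"
  by (simp add: tail_kernel_def)

lemma pos_powr_measurable [measurable]: "pos_powr \<alpha> \<in> borel_measurable borel"
  unfolding pos_powr_def by measurable

lemma tail_kernel_measurable [measurable]:
  "(\<lambda>(a, y). tail_kernel \<alpha> a y) \<in> borel_measurable (borel \<Otimes>\<^sub>M borel)"
  unfolding tail_kernel_def by measurable

lemma tail_kernel_measurable_right [measurable]: "tail_kernel \<alpha> a \<in> borel_measurable borel"
  unfolding tail_kernel_def by measurable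

lemma tail_kernel_measurable_left [measurable]: "(\<lambda>a. tail_kernel \<alpha> a y) \<in> borel_measurable borel"
  unfolding tail_kernel_def by measurable

text \<open>Partial fractions reduce the integral to two resolvent integrals. For \<open>\<alpha> > 0\<close> these are taken with
the exponent \<open>- \<alpha>\<close>; for \<open>\<alpha> < 0\<close> they would diverge at infinity, and one power of \<open>w\<close> is first moved
into the denominators.\<close>

lemma powr_difference_integral:
  fixes \<alpha> :: real
  assumes "-1 < \<alpha>" "\<alpha> < 1" "\<alpha> \<noteq> 0"
  obtains k where "k \<noteq> 0" "\<And>b. 0 < b \<Longrightarrow>
    has_bochner_integral lborel
      (\<lambda>w::real. indicator {0<..} w * (w powr (- \<alpha>) * (1 - b) / ((1 + w) * (b + w)))) ((b powr (- \<alpha>) - 1) * k)"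
proof (cases "\<alpha> > 0")
  case True
  obtain c where c: "c > 0" "\<And>b. b > 0 \<Longrightarrow>
      has_bochner_integral lborel (\<lambda>w::real. indicator {0<..} w * (w powr (- \<alpha>) / (b + w))) (b powr (- \<alpha>) * c)"
    using powr_resolvent_integral[of "- \<alpha>"] assms True by auto
  show ?thesis
  proof (rule that[of c])
    fix b :: real assume b: "b > 0"
    have eq: "indicator {0<..} w * (w powr (- \<alpha>) * (1 - b) / ((1 + w) * (b + w)))
       = indicator {0<..} w * (w powr (- \<alpha>) / (b + w)) - indicator {0<..} w * (w powr (- \<alpha>) / (1 + w))"
      for w :: real
    proof (cases "w > 0")
      case True
      then have "1 + w \<noteq> 0" "b + w \<noteq> 0" using b by auto
      then show ?thesis using True by (simp add: divide_simps) (simp add: algebra_simps)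
    qed simp
    show "has_bochner_integral lborel
        (\<lambda>w::real. indicator {0<..} w * (w powr (- \<alpha>) * (1 - b) / ((1 + w) * (b + w)))) ((b powr (- \<alpha>) - 1) * c)"
      unfolding eq left_diff_distrib mult_1_left
      using has_bochner_integral_diff[OF c(2)[OF b] c(2)[of 1]] by simp
  qed (use c in simp)
next
  case False
  then have neg: "\<alpha> < 0" using assms by simp
  obtain c where c: "c > 0" "\<And>b. b > 0 \<Longrightarrow> has_bochner_integral lborel
      (\<lambda>w::real. indicator {0<..} w * (w powr (- \<alpha> - 1) / (b + w))) (b powr (- \<alpha> - 1) * c)"
    using powr_resolvent_integral[of "- \<alpha> - 1"] assms neg by auto
  show ?thesis
  proof (rule that[of "- c"])
    fix b :: real assume b: "b > 0"
    have eq: "indicator {0<..} w * (w powr (- \<alpha>) * (1 - b) / ((1 + w) * (b + w)))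
       = indicator {0<..} w * (w powr (- \<alpha> - 1) / (1 + w))
         - b * (indicator {0<..} w * (w powr (- \<alpha> - 1) / (b + w)))"
      for w :: real
    proof (cases "w > 0")
      case True
      then have "1 + w \<noteq> 0" "b + w \<noteq> 0" using b by auto
      moreover have "w powr (- \<alpha>) = w * w powr (- \<alpha> - 1)" using True by (simp add: powr_diff)
      ultimately show ?thesis using True by (simp add: divide_simps) (simp add: algebra_simps)
    qed simp
    have "b * (b powr (- \<alpha> - 1) * c) = b powr (- \<alpha>) * c" using b by (simp add: powr_diff)
    then show "has_bochner_integral lborel
        (\<lambda>w::real. indicator {0<..} w * (w powr (- \<alpha>) * (1 - b) / ((1 + w) * (b + w)))) ((b powr (- \<alpha>) - 1) * - c)"
      unfolding eq
      using has_bochner_integral_diff[OF c(2)[of 1] has_bochner_integral_mult_right[OF c(2)[OF b], of b]]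
        \<open>b * (b powr (- \<alpha> - 1) * c) = b powr (- \<alpha>) * c\<close>
      by (simp add: left_diff_distrib)
  qed (use c in simp)
qed

text \<open>The substitution \<open>y = \<tau> w / (1 + w)\<close> maps the half line onto \<open>(0,\<tau>)\<close> and turns
\<open>y\<^sup>-\<^sup>\<alpha> (\<tau> - y)\<^sup>\<alpha>\<close> into the pure power \<open>w\<^sup>-\<^sup>\<alpha>\<close>, leaving a rational factor.\<close>

lemma tail_kernel_integral_change:
  fixes \<alpha> a \<tau> v :: real
  assumes "0 < a" "0 < \<tau>"
    and v: "has_bochner_integral lborel
      (\<lambda>w. indicator {0<..} w * (w powr (- \<alpha>) * (1 - a / (a + \<tau>)) / ((1 + w) * (a / (a + \<tau>) + w)))) v"
  shows "has_bochner_integral lborel (\<lambda>y. tail_kernel \<alpha> a y * pos_powr \<alpha> (\<tau> - y)) (a powr \<alpha> * v)"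
proof -
  define g where "g w = \<tau> * w / (1 + w)" for w :: real
  define g' where "g' w = \<tau> / (1 + w)\<^sup>2" for w :: real
  define b where "b = a / (a + \<tau>)"
  let ?f = "\<lambda>y. tail_kernel \<alpha> a y * pos_powr \<alpha> (\<tau> - y)"
  have image: "g ` {0<..} = {0<..<\<tau>}"
  proof (intro equalityI subsetI)
    fix y assume "y \<in> {0<..<\<tau>}"
    then have "y = g (y / (\<tau> - y))" "y / (\<tau> - y) > 0" using assms by (auto simp: g_def field_simps)
    then show "y \<in> g ` {0<..}" by blast
  qed (use assms in \<open>auto simp: g_def field_simps\<close>)
  have inj: "inj_on g {0<..}"
    using assms by (auto simp: inj_on_def g_def field_simps)
  have deriv: "(g has_field_derivative g' w) (at w within {0<..})" if "w \<in> {0<..}" for w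
    unfolding g_def g'_def using that
    by (auto intro!: derivative_eq_intros simp: power2_eq_square field_simps)
  have f_eq: "indicator {0<..} w * (\<bar>g' w\<bar> * ?f (g w))
      = a powr \<alpha> * (indicator {0<..} w * (w powr (- \<alpha>) * (1 - b) / ((1 + w) * (b + w))))" for w
  proof (cases "w > 0")
    case True
    have pos: "g w > 0" "\<tau> - g w > 0"
      using image True by auto
    have \<tau>g: "\<tau> - g w = \<tau> / (1 + w)" using True by (simp add: g_def field_simps)
    have ratio: "g w powr (- \<alpha>) * (\<tau> - g w) powr \<alpha> = w powr (- \<alpha>)"
    proof -
      have "g w powr (- \<alpha>) * (\<tau> - g w) powr \<alpha> = (\<tau> - g w) powr \<alpha> / g w powr \<alpha>"
        by (simp add: powr_minus field_simps)
      also have "\<dots> = ((\<tau> - g w) / g w) powr \<alpha>" using pos by (simp add: powr_divide)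
      also have "(\<tau> - g w) / g w = 1 / w" unfolding \<tau>g using True assms by (simp add: g_def)
      also have "(1 / w) powr \<alpha> = w powr (- \<alpha>)" using True by (simp add: powr_divide powr_minus_divide)
      finally show ?thesis .
    qed
    have rational: "\<tau> / (1 + w)\<^sup>2 / (a + g w) = (1 - b) / ((1 + w) * (b + w))"
    proof -
      have 1: "a + g w = ((a + \<tau>) * w + a) / (1 + w)" using True by (simp add: g_def field_simps)
      have 2: "b + w = ((a + \<tau>) * w + a) / (a + \<tau>)" "1 - b = \<tau> / (a + \<tau>)"
        using assms(1,2) by (simp_all add: b_def field_simps)
      have "\<tau> / (1 + w)\<^sup>2 / (p / (1 + w)) = \<tau> / (a + \<tau>) / ((1 + w) * (p / (a + \<tau>)))"
        if "p > 0" for p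
      proof -
        have "1 + w \<noteq> 0" "a + \<tau> \<noteq> 0" using True assms(1,2) by auto
        then show ?thesis using that by (simp add: divide_simps power2_eq_square)
      qed
      moreover have "(a + \<tau>) * w + a > 0" using assms(1,2) True by (simp add: add_pos_pos)
      ultimately show ?thesis unfolding 1 2 by blast
    qed
    have "\<bar>g' w\<bar> * ?f (g w) = a powr \<alpha> * (g w powr (- \<alpha>) * (\<tau> - g w) powr \<alpha>) * (\<tau> / (1 + w)\<^sup>2 / (a + g w))"
      using pos assms True by (simp add: tail_kernel_def pos_powr_def g'_def)
    also have "\<dots> = a powr \<alpha> * (w powr (- \<alpha>) * (1 - b) / ((1 + w) * (b + w)))"
      unfolding ratio rational by simp
    finally show ?thesis using True by simp
  qed simp
  have ind: "indicator {0<..<\<tau>} y * ?f y = ?f y" for y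
    by (auto simp: indicator_def tail_kernel_def pos_powr_def)
  have "has_bochner_integral lborel (\<lambda>w. indicator {0<..} w * (\<bar>g' w\<bar> * ?f (g w))) (a powr \<alpha> * v)"
    unfolding f_eq using v by (intro has_bochner_integral_mult_right) (simp add: b_def)
  then have "(\<lambda>w. \<bar>g' w\<bar> * ?f (g w)) absolutely_integrable_on {0<..} \<and>
      integral {0<..} (\<lambda>w. \<bar>g' w\<bar> * ?f (g w)) = a powr \<alpha> * v"
    by (subst absolutely_integrable_iff_bochner) (auto simp: g_def g'_def)
  then have "?f absolutely_integrable_on {0<..<\<tau>} \<and> integral {0<..<\<tau>} ?f = a powr \<alpha> * v"
    using has_absolute_integral_change_of_variables_1'[OF _ deriv inj, of ?f "a powr \<alpha> * v"]
    by (simp add: image)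
  then have "has_bochner_integral lborel (\<lambda>y. indicator {0<..<\<tau>} y * ?f y) (a powr \<alpha> * v)"
    by (subst (asm) absolutely_integrable_iff_bochner) auto
  then show ?thesis by (simp only: ind)
qed

text \<open>The constant \<open>\<kappa>\<close> is \<open>sin (\<pi> \<alpha>) / \<pi>\<close>; what matters is that it is the same for all \<open>a\<close> and \<open>\<tau>\<close>, so
that the identity extends to linear combinations over \<open>\<tau>\<close>.\<close>

lemma tail_kernel_reproduces:
  fixes \<alpha> :: real
  assumes "-1 < \<alpha>" "\<alpha> < 1"
  obtains \<kappa> where "\<And>a \<tau>. 0 < a \<Longrightarrow> 0 < \<tau> \<Longrightarrow>
    has_bochner_integral lborel (\<lambda>y. \<kappa> * (tail_kernel \<alpha> a y * pos_powr \<alpha> (\<tau> - y)))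
      ((\<tau> + a) powr \<alpha> - a powr \<alpha>)"
proof (cases "\<alpha> = 0")
  case True
  then show ?thesis by (intro that[of 0]) (auto simp: has_bochner_integral_zero)
next
  case False
  obtain k where k: "k \<noteq> 0" "\<And>b. 0 < b \<Longrightarrow> has_bochner_integral lborel
      (\<lambda>w::real. indicator {0<..} w * (w powr (- \<alpha>) * (1 - b) / ((1 + w) * (b + w)))) ((b powr (- \<alpha>) - 1) * k)"
    using powr_difference_integral[OF assms False] by blast
  show ?thesis
  proof (rule that[of "1 / k"])
    fix a \<tau> :: real assume a: "0 < a" and \<tau>: "0 < \<tau>"
    have "has_bochner_integral lborel (\<lambda>y. 1 / k * (tail_kernel \<alpha> a y * pos_powr \<alpha> (\<tau> - y)))
        (1 / k * (a powr \<alpha> * (((a / (a + \<tau>)) powr (- \<alpha>) - 1) * k)))"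
      using a \<tau> by (intro has_bochner_integral_mult_right tail_kernel_integral_change k) auto
    moreover have "1 / k * (a powr \<alpha> * (((a / (a + \<tau>)) powr (- \<alpha>) - 1) * k)) = (\<tau> + a) powr \<alpha> - a powr \<alpha>"
      using a \<tau> k(1) by (simp add: powr_divide powr_minus field_simps)
    ultimately show "has_bochner_integral lborel (\<lambda>y. 1 / k * (tail_kernel \<alpha> a y * pos_powr \<alpha> (\<tau> - y)))
        ((\<tau> + a) powr \<alpha> - a powr \<alpha>)" by (simp only:)
  qed
qed


lemma ennreal_mult_left_assoc:
  "a \<ge> 0 \<Longrightarrow> b \<ge> 0 \<Longrightarrow> ennreal a * (ennreal b * c) = ennreal (a * b) * c"
  by (simp add: ennreal_mult mult.assoc)

text \<open>Schur test with the weight \<open>y\<^sup>-\<^sup>1\<^sup>/\<^sup>2\<close>, natural for a kernel homogeneous of degree \<open>-1\<close>: both the row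
and the column integrals against it are resolvent integrals, with exponents \<open>- \<alpha> - 1/2\<close> and
\<open>\<alpha> - 1/2\<close>, and these lie in \<open>(-1,0)\<close> exactly because \<open>\<bar>\<alpha>\<bar> < 1/2\<close>.\<close>

lemma tail_kernel_schur:
  assumes "\<bar>\<alpha>\<bar> < 1 / 2"
  obtains S where "S \<ge> 0"
    "\<And>g :: real \<Rightarrow> ennreal. g \<in> borel_measurable borel \<Longrightarrow>
      (\<integral>\<^sup>+a. (\<integral>\<^sup>+y. ennreal (tail_kernel \<alpha> a y) * g y \<partial>lborel)\<^sup>2 \<partial>lborel)
        \<le> ennreal S * (\<integral>\<^sup>+y. indicator {0<..} y * (g y)\<^sup>2 \<partial>lborel)"
proof -
  obtain c1 where c1: "c1 > 0" "\<And>b. b > 0 \<Longrightarrow> has_bochner_integral lborel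
      (\<lambda>w::real. indicator {0<..} w * (w powr (- \<alpha> - 1/2) / (b + w))) (b powr (- \<alpha> - 1/2) * c1)"
    using powr_resolvent_integral[of "- \<alpha> - 1/2"] assms by (auto simp: abs_if split: if_splits)
  obtain c2 where c2: "c2 > 0" "\<And>b. b > 0 \<Longrightarrow> has_bochner_integral lborel
      (\<lambda>w::real. indicator {0<..} w * (w powr (\<alpha> - 1/2) / (b + w))) (b powr (\<alpha> - 1/2) * c2)"
    using powr_resolvent_integral[of "\<alpha> - 1/2"] assms by (auto simp: abs_if split: if_splits)
  have row: "(\<integral>\<^sup>+y. ennreal (tail_kernel \<alpha> a y * y powr (- 1/2)) \<partial>lborel) = ennreal (c1 * a powr (- 1/2))"
    if a: "a > 0" for a
  proof -
    have eq: "tail_kernel \<alpha> a y * y powr (- 1/2)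
        = a powr \<alpha> * (indicator {0<..} y * (y powr (- \<alpha> - 1/2) / (a + y)))" for y
      using a by (simp add: tail_kernel_def powr_diff powr_minus_divide)
    have "a powr \<alpha> * (a powr (- \<alpha> - 1/2) * c1) = c1 * a powr (- 1/2)"
      using a by (simp add: powr_diff powr_minus_divide)
    then have "has_bochner_integral lborel (\<lambda>y. tail_kernel \<alpha> a y * y powr (- 1/2)) (c1 * a powr (- 1/2))"
      using has_bochner_integral_mult_right[OF c1(2)[OF a], of "a powr \<alpha>"] by (simp only: eq)
    then show ?thesis by (simp add: has_bochner_integral_iff nn_integral_eq_integral)
  qed
  have col: "(\<integral>\<^sup>+a. ennreal (a powr (- 1/2) * tail_kernel \<alpha> a y) \<partial>lborel) = ennreal (c2 * y powr (- 1/2))"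
    if y: "y > 0" for y
  proof -
    have eq: "a powr (- 1/2) * tail_kernel \<alpha> a y
        = y powr (- \<alpha>) * (indicator {0<..} a * (a powr (\<alpha> - 1/2) / (y + a)))" for a
      using y by (simp add: tail_kernel_def powr_diff powr_minus_divide add.commute)
    have "y powr (- \<alpha>) * (y powr (\<alpha> - 1/2) * c2) = c2 * y powr (- 1/2)"
      using y by (simp add: powr_diff powr_minus_divide)
    then have "has_bochner_integral lborel (\<lambda>a. a powr (- 1/2) * tail_kernel \<alpha> a y) (c2 * y powr (- 1/2))"
      using has_bochner_integral_mult_right[OF c2(2)[OF y], of "y powr (- \<alpha>)"] by (simp only: eq)
    then show ?thesis by (simp add: has_bochner_integral_iff nn_integral_eq_integral)
  qed
  have "(\<integral>\<^sup>+a. (\<integral>\<^sup>+y. ennreal (tail_kernel \<alpha> a y) * g y \<partial>lborel)\<^sup>2 \<partial>lborel)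
      \<le> ennreal (c1 * c2) * (\<integral>\<^sup>+y. indicator {0<..} y * (g y)\<^sup>2 \<partial>lborel)"
    if [measurable]: "g \<in> borel_measurable borel" for g :: "real \<Rightarrow> ennreal"
  proof -
    have cs: "(\<integral>\<^sup>+y. ennreal (tail_kernel \<alpha> a y) * g y \<partial>lborel)\<^sup>2
        \<le> (\<integral>\<^sup>+y. ennreal (a powr (- 1/2) * tail_kernel \<alpha> a y) * (ennreal (c1 * y powr (1/2)) * (g y)\<^sup>2) \<partial>lborel)"
      for a
    proof (cases "a > 0")
      case a: True
      \<comment> \<open>The factors distribute the kernel so that one square carries the weight alone and the other carries g.\<close>
      define u where "u y = ennreal (sqrt (tail_kernel \<alpha> a y) * y powr (- 1/4))" for y
      define v where "v y = ennreal (sqrt (tail_kernel \<alpha> a y) * y powr (1/4)) * g y" for y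
      have [measurable]: "u \<in> borel_measurable borel" "v \<in> borel_measurable borel"
        unfolding u_def v_def by measurable
      have uv: "ennreal (tail_kernel \<alpha> a y) * g y = u y * v y" for y
      proof (cases "y > 0")
        case True
        have "sqrt (tail_kernel \<alpha> a y) * y powr (- 1/4) * (sqrt (tail_kernel \<alpha> a y) * y powr (1/4))
            = (sqrt (tail_kernel \<alpha> a y) * sqrt (tail_kernel \<alpha> a y)) * (y powr (- 1/4) * y powr (1/4))"
          by (simp only: ac_simps)
        also have "y powr (- 1/4) * y powr (1/4) = 1" using True by (simp flip: powr_add)
        finally show ?thesis
          by (simp add: u_def v_def ennreal_mult_left_assoc)
      qed (simp add: u_def v_def tail_kernel_def)
      have uu: "(u y)\<^sup>2 = ennreal (tail_kernel \<alpha> a y * y powr (- 1/2))" for y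
      proof -
        have "(y powr (- 1/4))\<^sup>2 = y powr (- 1/2)" by (simp add: power2_eq_square flip: powr_add)
        then show ?thesis by (simp add: u_def ennreal_power power_mult_distrib)
      qed
      have vv: "(v y)\<^sup>2 = ennreal (tail_kernel \<alpha> a y * y powr (1/2)) * (g y)\<^sup>2" for y
      proof -
        have "(y powr (1/4))\<^sup>2 = y powr (1/2)" by (simp add: power2_eq_square flip: powr_add)
        then show ?thesis by (simp add: v_def ennreal_power power_mult_distrib)
      qed
      have "(\<integral>\<^sup>+y. ennreal (tail_kernel \<alpha> a y) * g y \<partial>lborel)\<^sup>2 = (\<integral>\<^sup>+y. u y * v y \<partial>lborel)\<^sup>2"
        by (simp only: uv)
      also have "\<dots> \<le> (\<integral>\<^sup>+y. (u y)\<^sup>2 \<partial>lborel) * (\<integral>\<^sup>+y. (v y)\<^sup>2 \<partial>lborel)"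
        by (rule Cauchy_Schwarz_nn_integral) auto
      also have "\<dots> = (\<integral>\<^sup>+y. ennreal (c1 * a powr (- 1/2)) *
          (ennreal (tail_kernel \<alpha> a y * y powr (1/2)) * (g y)\<^sup>2) \<partial>lborel)"
        by (simp only: uu vv row[OF a]) (simp add: nn_integral_cmult)
      also have "\<dots> = (\<integral>\<^sup>+y. ennreal (a powr (- 1/2) * tail_kernel \<alpha> a y) *
          (ennreal (c1 * y powr (1/2)) * (g y)\<^sup>2) \<partial>lborel)"
        using c1(1)
        by (intro nn_integral_cong) (subst (1 2) ennreal_mult_left_assoc, simp_all add: mult_ac)
      finally show ?thesis .
    qed (simp add: tail_kernel_def)
    have "(\<integral>\<^sup>+a. (\<integral>\<^sup>+y. ennreal (tail_kernel \<alpha> a y) * g y \<partial>lborel)\<^sup>2 \<partial>lborel)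
        \<le> (\<integral>\<^sup>+a. \<integral>\<^sup>+y. ennreal (a powr (- 1/2) * tail_kernel \<alpha> a y) *
            (ennreal (c1 * y powr (1/2)) * (g y)\<^sup>2) \<partial>lborel \<partial>lborel)"
      by (intro nn_integral_mono cs)
    also have "\<dots> = (\<integral>\<^sup>+y. \<integral>\<^sup>+a. ennreal (a powr (- 1/2) * tail_kernel \<alpha> a y) *
            (ennreal (c1 * y powr (1/2)) * (g y)\<^sup>2) \<partial>lborel \<partial>lborel)"
      by (rule lborel_pair.Fubini') measurable
    also have "\<dots> = (\<integral>\<^sup>+y. ennreal (c1 * c2) * (indicator {0<..} y * (g y)\<^sup>2) \<partial>lborel)"
    proof (intro nn_integral_cong)
      fix y :: real
      show "(\<integral>\<^sup>+a. ennreal (a powr (- 1/2) * tail_kernel \<alpha> a y) * (ennreal (c1 * y powr (1/2)) * (g y)\<^sup>2) \<partial>lborel)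
          = ennreal (c1 * c2) * (indicator {0<..} y * (g y)\<^sup>2)"
      proof (cases "y > 0")
        case True
        have "c2 * y powr (- 1/2) * (c1 * y powr (1/2)) = c1 * c2 * (y powr (- 1/2) * y powr (1/2))"
          by (simp only: ac_simps)
        also have "y powr (- 1/2) * y powr (1/2) = 1" using True by (simp flip: powr_add)
        finally have eq: "c2 * y powr (- 1/2) * (c1 * y powr (1/2)) = c1 * c2" by simp
        have "(\<integral>\<^sup>+a. ennreal (a powr (- 1/2) * tail_kernel \<alpha> a y) * (ennreal (c1 * y powr (1/2)) * (g y)\<^sup>2) \<partial>lborel)
            = ennreal (c2 * y powr (- 1/2)) * (ennreal (c1 * y powr (1/2)) * (g y)\<^sup>2)"
          by (subst nn_integral_multc) (simp_all only: col[OF True], measurable)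
        also have "\<dots> = ennreal (c1 * c2) * (g y)\<^sup>2"
          unfolding eq[symmetric] using c1(1) c2(1) by (intro ennreal_mult_left_assoc) simp_all
        finally show ?thesis using True by simp
      qed (simp add: tail_kernel_def)
    qed
    also have "\<dots> = ennreal (c1 * c2) * (\<integral>\<^sup>+y. indicator {0<..} y * (g y)\<^sup>2 \<partial>lborel)"
      by (rule nn_integral_cmult) measurable
    finally show ?thesis .
  qed
  moreover have "c1 * c2 \<ge> 0" using c1 c2 by simp
  ultimately show ?thesis using that by blast
qed

text \<open>The function in question is the moving average of a step function supported on the right of \<open>r\<close>. Its
values on the left of \<open>r\<close> are the image under the tail kernel of its values on the right, hence are
controlled in \<open>L\<^sup>2\<close> by the latter. The bound is uniform in \<open>r\<close>, by translation.\<close>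

lemma tail_energy_le:
  assumes "\<bar>\<alpha>\<bar> < 1 / 2"
  obtains L where "L \<ge> 0" "\<And>r A c. finite A \<Longrightarrow> (\<And>t. t \<in> A \<Longrightarrow> r \<le> t) \<Longrightarrow>
    (\<integral>\<^sup>+x. ennreal ((\<Sum>t\<in>A. c t * (pos_powr \<alpha> (t - x) - pos_powr \<alpha> (r - x)))\<^sup>2) \<partial>lborel)
    \<le> ennreal L * (\<integral>\<^sup>+x. indicator {r<..} x *
        ennreal ((\<Sum>t\<in>A. c t * (pos_powr \<alpha> (t - x) - pos_powr \<alpha> (r - x)))\<^sup>2) \<partial>lborel)"
proof -
  obtain \<kappa> where \<kappa>: "\<And>a \<tau>. 0 < a \<Longrightarrow> 0 < \<tau> \<Longrightarrow>
    has_bochner_integral lborel (\<lambda>y. \<kappa> * (tail_kernel \<alpha> a y * pos_powr \<alpha> (\<tau> - y)))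
      ((\<tau> + a) powr \<alpha> - a powr \<alpha>)"
    using tail_kernel_reproduces[of \<alpha>] assms by (auto simp: abs_if split: if_splits)
  obtain S where S: "S \<ge> 0"
    "\<And>g :: real \<Rightarrow> ennreal. g \<in> borel_measurable borel \<Longrightarrow>
      (\<integral>\<^sup>+a. (\<integral>\<^sup>+y. ennreal (tail_kernel \<alpha> a y) * g y \<partial>lborel)\<^sup>2 \<partial>lborel)
        \<le> ennreal S * (\<integral>\<^sup>+y. indicator {0<..} y * (g y)\<^sup>2 \<partial>lborel)"
    using tail_kernel_schur[OF assms] by blast
  have "(\<integral>\<^sup>+x. ennreal ((\<Sum>t\<in>A. c t * (pos_powr \<alpha> (t - x) - pos_powr \<alpha> (r - x)))\<^sup>2) \<partial>lborel)
    \<le> ennreal (S * \<kappa>\<^sup>2 + 1) * (\<integral>\<^sup>+x. indicator {r<..} x *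
        ennreal ((\<Sum>t\<in>A. c t * (pos_powr \<alpha> (t - x) - pos_powr \<alpha> (r - x)))\<^sup>2) \<partial>lborel)"
    if A: "finite A" "\<And>t. t \<in> A \<Longrightarrow> r \<le> t" for r A and c :: "real \<Rightarrow> real"
  proof -
    define \<phi> where "\<phi> x = (\<Sum>t\<in>A. c t * (pos_powr \<alpha> (t - x) - pos_powr \<alpha> (r - x)))" for x
    have \<phi>_meas [measurable]: "\<phi> \<in> borel_measurable borel" unfolding \<phi>_def by measurable
    have repr: "has_bochner_integral lborel (\<lambda>y. \<kappa> * (tail_kernel \<alpha> a y * \<phi> (r + y))) (\<phi> (r - a))"
      if a: "a > 0" for a
    proof -
      have single: "has_bochner_integral lborel (\<lambda>y. \<kappa> * (tail_kernel \<alpha> a y * pos_powr \<alpha> (t - r - y)))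
          (pos_powr \<alpha> (t - (r - a)) - pos_powr \<alpha> (r - (r - a)))" if t: "t \<in> A" for t
      proof (cases "t = r")
        case True
        have eq: "\<kappa> * (tail_kernel \<alpha> a y * pos_powr \<alpha> (t - r - y)) = 0" for y
          using True by (simp add: tail_kernel_def pos_powr_def)
        show ?thesis unfolding eq using True by (simp add: has_bochner_integral_zero)
      next
        case False
        then show ?thesis
          using \<kappa>[OF a, of "t - r"] A(2)[OF t] a by (simp add: pos_powr_def algebra_simps)
      qed
      have "\<kappa> * (tail_kernel \<alpha> a y * \<phi> (r + y))
          = (\<Sum>t\<in>A. c t * (\<kappa> * (tail_kernel \<alpha> a y * pos_powr \<alpha> (t - r - y))))" for y
      proof (cases "y > 0")
        case True
        then have "\<phi> (r + y) = (\<Sum>t\<in>A. c t * pos_powr \<alpha> (t - r - y))"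
          unfolding \<phi>_def by (intro sum.cong refl) (simp add: pos_powr_def algebra_simps)
        then show ?thesis by (simp add: sum_distrib_left algebra_simps)
      qed (simp add: tail_kernel_def)
      moreover have "has_bochner_integral lborel
          (\<lambda>y. \<Sum>t\<in>A. c t * (\<kappa> * (tail_kernel \<alpha> a y * pos_powr \<alpha> (t - r - y)))) (\<phi> (r - a))"
        unfolding \<phi>_def by (intro has_bochner_integral_sum has_bochner_integral_mult_right single)
      ultimately show ?thesis by simp
    qed
    have left: "(\<integral>\<^sup>+x. indicator {..<r} x * ennreal ((\<phi> x)\<^sup>2) \<partial>lborel)
        \<le> ennreal (S * \<kappa>\<^sup>2) * (\<integral>\<^sup>+x. indicator {r<..} x * ennreal ((\<phi> x)\<^sup>2) \<partial>lborel)"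
    proof -
      have "(\<integral>\<^sup>+x. indicator {..<r} x * ennreal ((\<phi> x)\<^sup>2) \<partial>lborel)
          = (\<integral>\<^sup>+a. indicator {..<r} (r + (-1) * a) * ennreal ((\<phi> (r + (-1) * a))\<^sup>2) \<partial>lborel)"
        by (subst nn_integral_real_affine[where c = "-1" and t = r]) auto
      also have "\<dots> \<le> (\<integral>\<^sup>+a. (\<integral>\<^sup>+y. ennreal (tail_kernel \<alpha> a y) * ennreal (\<bar>\<kappa>\<bar> * \<bar>\<phi> (r + y)\<bar>) \<partial>lborel)\<^sup>2 \<partial>lborel)"
      proof (intro nn_integral_mono)
        fix a :: real
        show "indicator {..<r} (r + (-1) * a) * ennreal ((\<phi> (r + (-1) * a))\<^sup>2)
          \<le> (\<integral>\<^sup>+y. ennreal (tail_kernel \<alpha> a y) * ennreal (\<bar>\<kappa>\<bar> * \<bar>\<phi> (r + y)\<bar>) \<partial>lborel)\<^sup>2"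
        proof (cases "a > 0")
          case True
          have "ennreal \<bar>\<phi> (r - a)\<bar> \<le> (\<integral>\<^sup>+y. ennreal (norm (\<kappa> * (tail_kernel \<alpha> a y * \<phi> (r + y)))) \<partial>lborel)"
            using repr[OF True] integral_norm_bound_ennreal[of lborel "\<lambda>y. \<kappa> * (tail_kernel \<alpha> a y * \<phi> (r + y))"]
            by (simp only: has_bochner_integral_iff real_norm_def)
          also have "\<dots> = (\<integral>\<^sup>+y. ennreal (tail_kernel \<alpha> a y) * ennreal (\<bar>\<kappa>\<bar> * \<bar>\<phi> (r + y)\<bar>) \<partial>lborel)"
            by (intro nn_integral_cong) (simp add: abs_mult mult_ac flip: ennreal_mult)
          finally have "(ennreal \<bar>\<phi> (r - a)\<bar>)\<^sup>2 \<le> (\<integral>\<^sup>+y. ennreal (tail_kernel \<alpha> a y) * ennreal (\<bar>\<kappa>\<bar> * \<bar>\<phi> (r + y)\<bar>) \<partial>lborel)\<^sup>2"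
            by (rule power_mono) simp
          then show ?thesis using True by (simp add: ennreal_power)
        qed (simp add: indicator_def)
      qed
      also have "\<dots> \<le> ennreal S * (\<integral>\<^sup>+y. indicator {0<..} y * (ennreal (\<bar>\<kappa>\<bar> * \<bar>\<phi> (r + y)\<bar>))\<^sup>2 \<partial>lborel)"
        by (rule S(2)) measurable
      also have "(\<integral>\<^sup>+y. indicator {0<..} y * (ennreal (\<bar>\<kappa>\<bar> * \<bar>\<phi> (r + y)\<bar>))\<^sup>2 \<partial>lborel)
          = (\<integral>\<^sup>+y. ennreal (\<kappa>\<^sup>2) * (indicator {r<..} (r + 1 * y) * ennreal ((\<phi> (r + 1 * y))\<^sup>2)) \<partial>lborel)"
        by (intro nn_integral_cong) (auto simp: ennreal_power power_mult_distrib ennreal_mult indicator_def)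
      also have "\<dots> = ennreal (\<kappa>\<^sup>2) * (\<integral>\<^sup>+y. indicator {r<..} (r + 1 * y) * ennreal ((\<phi> (r + 1 * y))\<^sup>2) \<partial>lborel)"
        by (rule nn_integral_cmult) measurable
      also have "(\<integral>\<^sup>+y. indicator {r<..} (r + 1 * y) * ennreal ((\<phi> (r + 1 * y))\<^sup>2) \<partial>lborel)
          = (\<integral>\<^sup>+x. indicator {r<..} x * ennreal ((\<phi> x)\<^sup>2) \<partial>lborel)"
        by (subst (2) nn_integral_real_affine[where c = 1 and t = r]) auto
      finally show ?thesis using S(1) by (simp add: ennreal_mult mult.assoc)
    qed
    have "(\<integral>\<^sup>+x. ennreal ((\<phi> x)\<^sup>2) \<partial>lborel)
        = (\<integral>\<^sup>+x. indicator {..<r} x * ennreal ((\<phi> x)\<^sup>2) + indicator {r<..} x * ennreal ((\<phi> x)\<^sup>2) \<partial>lborel)"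
    proof (rule nn_integral_cong_AE)
      show "AE x in lborel. ennreal ((\<phi> x)\<^sup>2)
          = indicator {..<r} x * ennreal ((\<phi> x)\<^sup>2) + indicator {r<..} x * ennreal ((\<phi> x)\<^sup>2)"
        using AE_lborel_singleton[of r] by eventually_elim (auto simp: indicator_def)
    qed
    also have "\<dots> = (\<integral>\<^sup>+x. indicator {..<r} x * ennreal ((\<phi> x)\<^sup>2) \<partial>lborel)
        + (\<integral>\<^sup>+x. indicator {r<..} x * ennreal ((\<phi> x)\<^sup>2) \<partial>lborel)"
      by (rule nn_integral_add) measurable
    also have "\<dots> \<le> ennreal (S * \<kappa>\<^sup>2) * (\<integral>\<^sup>+x. indicator {r<..} x * ennreal ((\<phi> x)\<^sup>2) \<partial>lborel)
        + (\<integral>\<^sup>+x. indicator {r<..} x * ennreal ((\<phi> x)\<^sup>2) \<partial>lborel)"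
      by (intro add_right_mono left)
    also have "\<dots> = ennreal (S * \<kappa>\<^sup>2 + 1) * (\<integral>\<^sup>+x. indicator {r<..} x * ennreal ((\<phi> x)\<^sup>2) \<partial>lborel)"
      using S(1) by (simp add: distrib_right)
    finally show ?thesis unfolding \<phi>_def .
  qed
  note bound = this
  have "S * \<kappa>\<^sup>2 + 1 \<ge> 0" using S(1) by simp
  then show ?thesis by (rule that[OF _ bound])
qed

section \<open>The moving average representation of fractional Brownian motion\<close>

text \<open>The slow decay at \<open>-\<infinity>\<close> needs no separate estimate: the energy on the negative half line is bounded
by the one on the positive half line, where the function is the power \<open>(1 - x)\<^sup>\<alpha>\<close> on \<open>(0,1)\<close>.\<close>

lemma integrable_unit_increment_square:
  assumes "\<bar>\<alpha>\<bar> < 1 / 2"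
  shows "integrable lborel (\<lambda>x. (pos_powr \<alpha> (1 - x) - pos_powr \<alpha> (0 - x))\<^sup>2)"
proof (rule integrableI_nonneg)
  let ?D = "\<lambda>x. (pos_powr \<alpha> (1 - x) - pos_powr \<alpha> (0 - x))\<^sup>2"
  obtain L where L: "L \<ge> 0" "\<And>r A c. finite A \<Longrightarrow> (\<And>t. t \<in> A \<Longrightarrow> r \<le> t) \<Longrightarrow>
    (\<integral>\<^sup>+x. ennreal ((\<Sum>t\<in>A. c t * (pos_powr \<alpha> (t - x) - pos_powr \<alpha> (r - x)))\<^sup>2) \<partial>lborel)
    \<le> ennreal L * (\<integral>\<^sup>+x. indicator {r<..} x *
        ennreal ((\<Sum>t\<in>A. c t * (pos_powr \<alpha> (t - x) - pos_powr \<alpha> (r - x)))\<^sup>2) \<partial>lborel)"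
    using tail_energy_le[OF assms] by blast
  have powr_int: "has_bochner_integral lborel (\<lambda>y::real. indicator {0..1} y * y powr (2 * \<alpha>)) (1 / (2 * \<alpha> + 1))"
  proof (subst absolutely_integrable_iff_bochner[symmetric])
    show "(\<lambda>w. w powr (2 * \<alpha>)) absolutely_integrable_on {0..1} \<and> integral {0..1} (\<lambda>w. w powr (2 * \<alpha>)) = 1 / (2 * \<alpha> + 1)"
      using has_integral_powr_from_0[of "2 * \<alpha>" 1] assms
      by (intro conjI nonnegative_absolutely_integrable_1) (auto simp: has_integral_iff abs_if split: if_splits)
  qed simp
  have "(\<integral>\<^sup>+x. indicator {0<..} x * ennreal (?D x) \<partial>lborel)
      = (\<integral>\<^sup>+y. indicator {0<..} (1 + (-1) * y) * ennreal (?D (1 + (-1) * y)) \<partial>lborel)"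
    by (subst nn_integral_real_affine[where c = "-1" and t = 1]) auto
  also have "\<dots> \<le> (\<integral>\<^sup>+y. ennreal (indicator {0..1} y * y powr (2 * \<alpha>)) \<partial>lborel)"
  proof (intro nn_integral_mono)
    fix y :: real
    have "(y powr \<alpha>)\<^sup>2 = y powr (2 * \<alpha>)" by (simp add: power2_eq_square flip: powr_add)
    then show "indicator {0<..} (1 + (-1) * y) * ennreal (?D (1 + (-1) * y))
        \<le> ennreal (indicator {0..1} y * y powr (2 * \<alpha>))"
      by (auto simp: indicator_def pos_powr_def)
  qed
  also have "\<dots> < \<infinity>"
    using powr_int by (simp add: has_bochner_integral_iff nn_integral_eq_integral)
  finally have fin: "(\<integral>\<^sup>+x. indicator {0<..} x * ennreal (?D x) \<partial>lborel) < \<infinity>" .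
  have "(\<integral>\<^sup>+x. ennreal (?D x) \<partial>lborel) \<le> ennreal L * (\<integral>\<^sup>+x. indicator {0<..} x * ennreal (?D x) \<partial>lborel)"
    using L(2)[of "{1}" 0 "\<lambda>_. 1"] by simp
  also have "\<dots> < \<infinity>" using fin by (simp add: ennreal_mult_less_top)
  finally show "(\<integral>\<^sup>+x. ennreal (?D x) \<partial>lborel) < \<infinity>" .
qed auto

text \<open>The integrand is translation invariant in \<open>(s,t)\<close> and homogeneous, so the unit increment determines
all others.\<close>

lemma increment_energy:
  assumes "\<bar>\<alpha>\<bar> < 1 / 2"
  obtains C where "C > 0" "\<And>s t. has_bochner_integral lborel
    (\<lambda>x. (pos_powr \<alpha> (t - x) - pos_powr \<alpha> (s - x))\<^sup>2) (C * \<bar>t - s\<bar> powr (2 * \<alpha> + 1))"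
proof -
  define D where "D x = (pos_powr \<alpha> (1 - x) - pos_powr \<alpha> (0 - x))\<^sup>2" for x
  define C where "C = (\<integral>x. D x \<partial>lborel)"
  have int: "integrable lborel D"
    unfolding D_def using assms by (rule integrable_unit_increment_square)
  have nonneg: "D x \<ge> 0" for x by (simp add: D_def)
  have "C \<noteq> 0"
  proof
    assume "C = 0"
    then have "AE x in lborel. D x = 0"
      using integral_nonneg_eq_0_iff_AE[OF int] nonneg by (simp add: C_def)
    then have "AE x in lborel. x \<notin> {0<..<1::real}"
      by eventually_elim (auto simp: D_def pos_powr_def)
    then have "emeasure lborel {0<..<1::real} = 0"
      by (intro AE_iff_measurable[THEN iffD1, rotated 2]) auto
    then show False by simp
  qed
  then have "C > 0" using nonneg by (simp add: C_def integral_nonneg less_le)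
  moreover have less: "has_bochner_integral lborel
    (\<lambda>x. (pos_powr \<alpha> (t - x) - pos_powr \<alpha> (s - x))\<^sup>2) (C * (t - s) powr (2 * \<alpha> + 1))" if "s < t" for s t
  proof (subst lborel_has_bochner_integral_real_affine_iff[where c = "t - s" and t = s])
    have scale: "pos_powr \<alpha> ((t - s) * x) = (t - s) powr \<alpha> * pos_powr \<alpha> x" for x
      using that by (auto simp: pos_powr_def powr_mult zero_less_mult_iff)
    have eq: "(pos_powr \<alpha> (t - (s + (t - s) * z)) - pos_powr \<alpha> (s - (s + (t - s) * z)))\<^sup>2
        = (t - s) powr (2 * \<alpha>) * D z" for z
    proof -
      have "t - (s + (t - s) * z) = (t - s) * (1 - z)" "s - (s + (t - s) * z) = (t - s) * (0 - z)"
        by (simp_all add: algebra_simps)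
      moreover have "((t - s) powr \<alpha>)\<^sup>2 = (t - s) powr (2 * \<alpha>)"
        by (simp add: power2_eq_square flip: powr_add)
      ultimately show ?thesis
        by (simp only: scale D_def flip: right_diff_distrib) (simp add: power_mult_distrib)
    qed
    have "has_bochner_integral lborel (\<lambda>z. (t - s) powr (2 * \<alpha>) * D z) ((t - s) powr (2 * \<alpha>) * C)"
      using int by (intro has_bochner_integral_mult_right) (simp add: has_bochner_integral_iff C_def)
    moreover have "(C * (t - s) powr (2 * \<alpha> + 1)) /\<^sub>R \<bar>t - s\<bar> = (t - s) powr (2 * \<alpha>) * C"
      using that by (simp add: powr_add)
    ultimately show "has_bochner_integral lborel
        (\<lambda>z. (pos_powr \<alpha> (t - (s + (t - s) * z)) - pos_powr \<alpha> (s - (s + (t - s) * z)))\<^sup>2)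
        ((C * (t - s) powr (2 * \<alpha> + 1)) /\<^sub>R \<bar>t - s\<bar>)"
      by (simp only: eq)
  qed (use that in simp)
  have "has_bochner_integral lborel
    (\<lambda>x. (pos_powr \<alpha> (t - x) - pos_powr \<alpha> (s - x))\<^sup>2) (C * \<bar>t - s\<bar> powr (2 * \<alpha> + 1))" for s t
  proof (cases s t rule: linorder_cases)
    case greater
    then show ?thesis using less[of t s] by (simp add: power2_commute abs_if)
  qed (use less in \<open>auto simp: has_bochner_integral_zero\<close>)
  with \<open>C > 0\<close> show ?thesis by (rule that)
qed

text \<open>The integrand of the Mandelbrot-van Ness representation of fractional Brownian motion as a stochastic
integral with respect to white noise on the line.\<close>

definition mvn_kernel :: "real \<Rightarrow> real \<Rightarrow> real \<Rightarrow> real" where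
  "mvn_kernel H t x = pos_powr (H - 1/2) (t - x) - pos_powr (H - 1/2) (0 - x)"

lemma mvn_kernel_measurable [measurable]: "mvn_kernel H t \<in> borel_measurable borel"
  unfolding mvn_kernel_def by measurable

text \<open>By polarisation, since the difference of the kernels at \<open>t\<close> and at \<open>s\<close> is again an increment, with
energy proportional to \<open>\<bar>t - s\<bar>\<^sup>2\<^sup>H\<close>.\<close>

lemma mvn_kernel_covariance:
  assumes "0 < H" "H < 1"
  obtains C where "C > 0" "\<And>s t. s \<ge> 0 \<Longrightarrow> t \<ge> 0 \<Longrightarrow>
    has_bochner_integral lborel (\<lambda>x. mvn_kernel H t x * mvn_kernel H s x) (C * fbm_cov H t s)"
proof -
  have \<alpha>: "\<bar>H - 1/2\<bar> < 1/2" using assms by (auto simp: abs_if)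
  obtain C where C: "C > 0" "\<And>s t. has_bochner_integral lborel
    (\<lambda>x. (pos_powr (H - 1/2) (t - x) - pos_powr (H - 1/2) (s - x))\<^sup>2) (C * \<bar>t - s\<bar> powr (2 * (H - 1/2) + 1))"
    using increment_energy[OF \<alpha>] by blast
  have exponent: "2 * (H - 1/2) + 1 = 2 * H" by simp
  have "has_bochner_integral lborel (\<lambda>x. mvn_kernel H t x * mvn_kernel H s x) (C * fbm_cov H t s)"
    if "s \<ge> 0" "t \<ge> 0" for s t
  proof -
    have "has_bochner_integral lborel (\<lambda>x. 1/2 * ((mvn_kernel H t x)\<^sup>2 + (mvn_kernel H s x)\<^sup>2
        - (pos_powr (H - 1/2) (t - x) - pos_powr (H - 1/2) (s - x))\<^sup>2))
      (1/2 * (C * \<bar>t - 0\<bar> powr (2 * H) + C * \<bar>s - 0\<bar> powr (2 * H) - C * \<bar>t - s\<bar> powr (2 * H)))"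
      unfolding mvn_kernel_def using C(2)
      by (intro has_bochner_integral_mult_right has_bochner_integral_diff has_bochner_integral_add)
        (simp_all only: exponent)
    moreover have "1/2 * ((mvn_kernel H t x)\<^sup>2 + (mvn_kernel H s x)\<^sup>2
        - (pos_powr (H - 1/2) (t - x) - pos_powr (H - 1/2) (s - x))\<^sup>2) = mvn_kernel H t x * mvn_kernel H s x" for x
      by (simp add: mvn_kernel_def power2_eq_square algebra_simps)
    moreover have "1/2 * (C * \<bar>t - 0\<bar> powr (2 * H) + C * \<bar>s - 0\<bar> powr (2 * H) - C * \<bar>t - s\<bar> powr (2 * H))
        = C * fbm_cov H t s"
      using that by (simp add: fbm_cov_def field_simps)
    ultimately show ?thesis by (simp only:)
  qed
  with C(1) show ?thesis by (rule that)
qed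

lemma mvn_kernel_sum_energy:
  assumes C: "\<And>s t. s \<ge> 0 \<Longrightarrow> t \<ge> 0 \<Longrightarrow>
      has_bochner_integral lborel (\<lambda>x. mvn_kernel H t x * mvn_kernel H s x) (C * fbm_cov H t s)"
    and b: "\<And>t. t \<in> A \<Longrightarrow> b t \<ge> 0"
  shows "has_bochner_integral lborel (\<lambda>x. (\<Sum>t\<in>A. c t * mvn_kernel H (b t) x)\<^sup>2)
      (C * (\<Sum>t\<in>A. \<Sum>s\<in>A. c t * c s * fbm_cov H (b t) (b s)))"
proof -
  have "has_bochner_integral lborel
      (\<lambda>x. \<Sum>t\<in>A. \<Sum>s\<in>A. c t * c s * (mvn_kernel H (b t) x * mvn_kernel H (b s) x))
      (\<Sum>t\<in>A. \<Sum>s\<in>A. c t * c s * (C * fbm_cov H (b t) (b s)))"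
    by (intro has_bochner_integral_sum has_bochner_integral_mult_right C b)
  moreover have "(\<Sum>t\<in>A. \<Sum>s\<in>A. c t * c s * (mvn_kernel H (b t) x * mvn_kernel H (b s) x))
      = (\<Sum>t\<in>A. c t * mvn_kernel H (b t) x)\<^sup>2" for x
    by (simp add: power2_eq_square sum_product mult_ac)
  moreover have "(\<Sum>t\<in>A. \<Sum>s\<in>A. c t * c s * (C * fbm_cov H (b t) (b s)))
      = C * (\<Sum>t\<in>A. \<Sum>s\<in>A. c t * c s * fbm_cov H (b t) (b s))"
    by (simp add: sum_distrib_left mult_ac)
  ultimately show ?thesis by (simp only:)
qed

lemma fbm_cov_psd:
  assumes "0 < H" "H < 1" "\<And>t. t \<in> A \<Longrightarrow> b t \<ge> 0"
  shows "0 \<le> (\<Sum>t\<in>A. \<Sum>s\<in>A. c t * c s * fbm_cov H (b t) (b s))"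
proof -
  obtain C where C: "C > 0" "\<And>s t. s \<ge> 0 \<Longrightarrow> t \<ge> 0 \<Longrightarrow>
    has_bochner_integral lborel (\<lambda>x. mvn_kernel H t x * mvn_kernel H s x) (C * fbm_cov H t s)"
    using mvn_kernel_covariance[OF assms(1,2)] by blast
  have "(\<integral>x. (\<Sum>t\<in>A. c t * mvn_kernel H (b t) x)\<^sup>2 \<partial>lborel)
      = C * (\<Sum>t\<in>A. \<Sum>s\<in>A. c t * c s * fbm_cov H (b t) (b s))"
    by (intro has_bochner_integral_integral_eq mvn_kernel_sum_energy C(2) assms(3))
  moreover have "0 \<le> (\<integral>x. (\<Sum>t\<in>A. c t * mvn_kernel H (b t) x)\<^sup>2 \<partial>lborel)"
    by (rule Bochner_Integration.integral_nonneg) simp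
  ultimately have "0 \<le> C * (\<Sum>t\<in>A. \<Sum>s\<in>A. c t * c s * fbm_cov H (b t) (b s))" by simp
  then show ?thesis using C(1) by (simp add: zero_le_mult_iff)
qed

text \<open>Splitting the integrand at \<open>r\<close> splits its moving average as \<open>\<phi> = \<psi> + \<theta>\<close>. As \<open>\<psi>\<close> vanishes on the
right of \<open>r\<close>, the part \<open>\<theta>\<close> coincides with \<open>\<phi>\<close> there, and its total energy is controlled by its energy
on that side.\<close>

lemma fbm_truncation_bound:
  assumes H: "0 < H" "H < 1" and r: "r \<ge> 0"
  obtains K where "K \<ge> 0" "\<And>A c. finite A \<Longrightarrow> (\<And>t. t \<in> A \<Longrightarrow> t \<ge> 0) \<Longrightarrow>
    (\<Sum>t\<in>A. \<Sum>s\<in>A. c t * c s * fbm_cov H (min t r) (min s r))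
      \<le> K * (\<Sum>t\<in>A. \<Sum>s\<in>A. c t * c s * fbm_cov H t s)"
proof -
  define \<alpha> where "\<alpha> = H - 1/2"
  have \<alpha>: "\<bar>\<alpha>\<bar> < 1/2" using H by (auto simp: \<alpha>_def abs_if)
  obtain C where C: "C > 0" "\<And>s t. s \<ge> 0 \<Longrightarrow> t \<ge> 0 \<Longrightarrow>
    has_bochner_integral lborel (\<lambda>x. mvn_kernel H t x * mvn_kernel H s x) (C * fbm_cov H t s)"
    using mvn_kernel_covariance[OF H] by blast
  obtain L where L: "L \<ge> 0" "\<And>r A c. finite A \<Longrightarrow> (\<And>t. t \<in> A \<Longrightarrow> r \<le> t) \<Longrightarrow>
    (\<integral>\<^sup>+x. ennreal ((\<Sum>t\<in>A. c t * (pos_powr \<alpha> (t - x) - pos_powr \<alpha> (r - x)))\<^sup>2) \<partial>lborel)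
    \<le> ennreal L * (\<integral>\<^sup>+x. indicator {r<..} x *
        ennreal ((\<Sum>t\<in>A. c t * (pos_powr \<alpha> (t - x) - pos_powr \<alpha> (r - x)))\<^sup>2) \<partial>lborel)"
    using tail_energy_le[OF \<alpha>] by blast
  have "(\<Sum>t\<in>A. \<Sum>s\<in>A. c t * c s * fbm_cov H (min t r) (min s r))
      \<le> (2 + 2 * L) * (\<Sum>t\<in>A. \<Sum>s\<in>A. c t * c s * fbm_cov H t s)"
    if A: "finite A" "\<And>t. t \<in> A \<Longrightarrow> t \<ge> 0" for A and c :: "real \<Rightarrow> real"
  proof -
    define \<phi> where "\<phi> x = (\<Sum>t\<in>A. c t * mvn_kernel H t x)" for x
    define \<psi> where "\<psi> x = (\<Sum>t\<in>A. c t * mvn_kernel H (min t r) x)" for x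
    define \<theta> where "\<theta> x = (\<Sum>t\<in>{t\<in>A. r \<le> t}. c t * (pos_powr \<alpha> (t - x) - pos_powr \<alpha> (r - x)))" for x
    let ?E = "\<Sum>t\<in>A. \<Sum>s\<in>A. c t * c s * fbm_cov H t s"
    let ?E' = "\<Sum>t\<in>A. \<Sum>s\<in>A. c t * c s * fbm_cov H (min t r) (min s r)"
    have [measurable]: "\<phi> \<in> borel_measurable borel" "\<psi> \<in> borel_measurable borel" "\<theta> \<in> borel_measurable borel"
      unfolding \<phi>_def \<psi>_def \<theta>_def by measurable
    have \<theta>_eq: "\<theta> x = \<phi> x - \<psi> x" for x
    proof -
      have "\<theta> x = (\<Sum>t\<in>A. if r \<le> t then c t * (pos_powr \<alpha> (t - x) - pos_powr \<alpha> (r - x)) else 0)"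
        unfolding \<theta>_def using A(1) by (intro sum.inter_filter)
      also have "\<dots> = (\<Sum>t\<in>A. c t * mvn_kernel H t x - c t * mvn_kernel H (min t r) x)"
        by (intro sum.cong refl) (auto simp: mvn_kernel_def \<alpha>_def min_def algebra_simps)
      finally show ?thesis by (simp add: \<phi>_def \<psi>_def sum_subtractf)
    qed
    have \<psi>_right: "\<psi> x = 0" if "x > r" for x
      unfolding \<psi>_def using that r by (intro sum.neutral) (auto simp: mvn_kernel_def pos_powr_def)
    have int_\<phi>: "(\<integral>\<^sup>+x. ennreal ((\<phi> x)\<^sup>2) \<partial>lborel) = ennreal (C * ?E)"
      using mvn_kernel_sum_energy[OF C(2), where A = A and b = "\<lambda>t. t" and c = c] A(2)
      by (simp add: \<phi>_def has_bochner_integral_iff nn_integral_eq_integral)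
    have int_\<psi>: "(\<integral>\<^sup>+x. ennreal ((\<psi> x)\<^sup>2) \<partial>lborel) = ennreal (C * ?E')"
      using mvn_kernel_sum_energy[OF C(2), where A = A and b = "\<lambda>t. min t r" and c = c] A(2) r
      by (simp add: \<psi>_def has_bochner_integral_iff nn_integral_eq_integral)
    have "(\<integral>\<^sup>+x. ennreal ((\<theta> x)\<^sup>2) \<partial>lborel) \<le> ennreal L * (\<integral>\<^sup>+x. indicator {r<..} x * ennreal ((\<theta> x)\<^sup>2) \<partial>lborel)"
      unfolding \<theta>_def using A(1) by (intro L(2)) auto
    also have "\<dots> \<le> ennreal L * (\<integral>\<^sup>+x. ennreal ((\<phi> x)\<^sup>2) \<partial>lborel)"
      by (intro mult_left_mono nn_integral_mono) (auto simp: indicator_def \<theta>_eq \<psi>_right)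
    finally have \<theta>_le: "(\<integral>\<^sup>+x. ennreal ((\<theta> x)\<^sup>2) \<partial>lborel) \<le> ennreal L * ennreal (C * ?E)"
      by (simp only: int_\<phi>)
    have E_nonneg: "?E \<ge> 0"
      using fbm_cov_psd[OF H, of A "\<lambda>t. t" c] A(2) by simp
    \<comment> \<open>The truncated integrand belongs to the difference of the two moving averages.\<close>
    have "ennreal (C * ?E') \<le> (\<integral>\<^sup>+x. 2 * ennreal ((\<phi> x)\<^sup>2) + 2 * ennreal ((\<theta> x)\<^sup>2) \<partial>lborel)"
      unfolding int_\<psi>[symmetric]
    proof (intro nn_integral_mono)
      fix x :: real
      have "0 \<le> (\<phi> x + \<theta> x)\<^sup>2" by simp
      then have "(\<psi> x)\<^sup>2 \<le> 2 * (\<phi> x)\<^sup>2 + 2 * (\<theta> x)\<^sup>2"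
        unfolding \<theta>_eq by (simp add: power2_eq_square algebra_simps)
      then have "ennreal ((\<psi> x)\<^sup>2) \<le> ennreal (2 * (\<phi> x)\<^sup>2 + 2 * (\<theta> x)\<^sup>2)" by (rule ennreal_leI)
      then show "ennreal ((\<psi> x)\<^sup>2) \<le> 2 * ennreal ((\<phi> x)\<^sup>2) + 2 * ennreal ((\<theta> x)\<^sup>2)"
        by (simp add: ennreal_mult)
    qed
    also have "\<dots> = 2 * ennreal (C * ?E) + 2 * (\<integral>\<^sup>+x. ennreal ((\<theta> x)\<^sup>2) \<partial>lborel)"
      by (simp add: nn_integral_add nn_integral_cmult int_\<phi>)
    also have "\<dots> \<le> 2 * ennreal (C * ?E) + 2 * (ennreal L * ennreal (C * ?E))"
      by (intro add_left_mono mult_left_mono \<theta>_le) simp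
    also have "\<dots> = ennreal (2 * (C * ?E) + 2 * (L * (C * ?E)))"
      using L(1) C(1) E_nonneg by (simp add: ennreal_mult)
    finally have "C * ?E' \<le> 2 * (C * ?E) + 2 * (L * (C * ?E))"
      using L(1) C(1) E_nonneg by (subst (asm) ennreal_le_iff) auto
    also have "\<dots> = C * ((2 + 2 * L) * ?E)" by (simp add: algebra_simps)
    finally show ?thesis using C(1) by simp
  qed
  then show ?thesis using L(1) by (intro that[of "2 + 2 * L"]) auto
qed

section \<open>The form on bounded measurable functions\<close>

text \<open>Integrals obtained from antiderivatives, in the form needed for \<^const>\<open>fbm_form\<close>. Indicators of
\<open>(0,s]\<close> differ from those of \<open>[0,s]\<close> on a null set.\<close>

lemma has_integral_imp_bochner_lebesgue_on:
  fixes f :: "real \<Rightarrow> real"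
  assumes "(f has_integral I) {0..s}" "\<And>x. x \<in> {0..s} \<Longrightarrow> f x \<ge> 0"
    and [measurable]: "f \<in> borel_measurable borel" and s: "0 \<le> s" "s \<le> T"
  shows "has_bochner_integral (lebesgue_on {0..T}) (\<lambda>v. indicator {0<..s} v * f v) I"
proof -
  have "f absolutely_integrable_on {0..s} \<and> integral {0..s} f = I"
    using assms(1,2) by (auto simp: has_integral_iff intro!: nonnegative_absolutely_integrable_1)
  then have "has_bochner_integral lborel (\<lambda>x. indicator {0..s} x * f x) I"
    by (subst (asm) absolutely_integrable_iff_bochner) auto
  then have "has_bochner_integral lborel (\<lambda>v. indicator {0..T} v *\<^sub>R (indicator {0<..s} v * f v)) I"
  proof (subst has_bochner_integral_cong_AE[where g = "\<lambda>x. indicator {0..s} x * f x"])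
    show "AE v in lborel. indicator {0..T} v *\<^sub>R (indicator {0<..s} v * f v) = indicator {0..s} v * f v"
      using AE_lborel_singleton[of 0] by eventually_elim (use s in \<open>auto simp: indicator_def\<close>)
  qed auto
  then have "has_bochner_integral lebesgue (\<lambda>v. indicator {0..T} v *\<^sub>R (indicator {0<..s} v * f v)) I"
    by (auto simp: has_bochner_integral_iff integrable_completion integral_completion)
  then show ?thesis by (subst has_bochner_integral_restrict_space) auto
qed

lemma fbm_cov_kernel:
  assumes "0 < H" "H < 1"
  shows "cov_kernel T (fbm_cov H)"
proof
  fix A and c :: "real \<Rightarrow> real" assume sub: "A \<subseteq> {0..T}"
  show "0 \<le> (\<Sum>t\<in>A. \<Sum>s\<in>A. c t * c s * fbm_cov H t s)"
    by (rule fbm_cov_psd[OF assms]) (use sub in auto)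
qed (simp_all add: fbm_cov_def abs_minus_commute)

locale long_memory =
  fixes H T :: real
  assumes H: "1/2 < H" "H < 1" and T: "T > 0"
begin

abbreviation "\<mu> \<equiv> lebesgue_on {0..T}"

definition riesz :: "real \<Rightarrow> real \<Rightarrow> real" where
  "riesz u v = \<bar>u - v\<bar> powr (2 * H - 2)"

text \<open>The inner integral of \<^const>\<open>fbm_form\<close>. Evaluating the form as an iterated integral, with this
function as an intermediate step, avoids any joint measurability argument.\<close>

definition potential :: "(real \<Rightarrow> real) \<Rightarrow> real \<Rightarrow> real" where
  "potential g u = (\<integral>v. g v * riesz u v \<partial>\<mu>)"

lemma finite_measure_\<mu>: "finite_measure \<mu>"
  by (rule finite_measure_lebesgue_on) simp

lemma space_\<mu>: "space \<mu> = {0..T}"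
  by (simp add: space_restrict_space)

lemma borel_imp_measurable_\<mu>: "f \<in> borel_measurable borel \<Longrightarrow> f \<in> borel_measurable \<mu>"
  by (simp add: measurable_completion measurable_restrict_space1)

lemma fbm_form_eq_potential: "fbm_form H T f g = H * (2 * H - 1) * (\<integral>u. f u * potential g u \<partial>\<mu>)"
proof -
  have lebesgue_on: "(LINT x:{0..T}|lebesgue. h x) = (\<integral>x. h x \<partial>\<mu>)" for h :: "real \<Rightarrow> real"
    by (simp add: set_lebesgue_integral_def integral_restrict_space)
  show ?thesis
    by (simp add: fbm_form_def lebesgue_on potential_def riesz_def mult.assoc)
qed

lemma riesz_nonneg: "riesz u v \<ge> 0"
  by (simp add: riesz_def)

lemma riesz_measurable [measurable]: "riesz u \<in> borel_measurable borel"
  unfolding riesz_def by measurable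

text \<open>An antiderivative of \<open>\<bar>x\<bar>\<^sup>2\<^sup>H\<^sup>-\<^sup>2\<close>, of which \<open>prim2\<close> below is in turn an antiderivative. Both are
continuous at \<open>0\<close>, so that the singularity of the kernel is harmless.\<close>

definition prim :: "real \<Rightarrow> real" where
  "prim x = (max 0 x powr (2 * H - 1) - max 0 (- x) powr (2 * H - 1)) / (2 * H - 1)"

definition prim2 :: "real \<Rightarrow> real" where
  "prim2 x = \<bar>x\<bar> powr (2 * H) / (2 * H * (2 * H - 1))"

lemma prim_continuous: "continuous_on S prim"
  unfolding prim_def using H by (intro continuous_intros continuous_on_powr') auto

lemma prim2_continuous: "continuous_on S prim2"
  unfolding prim2_def using H by (intro continuous_intros continuous_on_powr') auto

lemma prim_measurable [measurable]: "prim \<in> borel_measurable borel"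
  by (rule borel_measurable_continuous_onI[OF prim_continuous])

lemma prim_deriv:
  assumes "x \<noteq> 0"
  shows "(prim has_real_derivative \<bar>x\<bar> powr (2 * H - 2)) (at x)"
proof (cases "x > 0")
  case True
  have "((\<lambda>x. x powr (2 * H - 1) / (2 * H - 1)) has_real_derivative \<bar>x\<bar> powr (2 * H - 2)) (at x)"
    using True H by (auto intro!: derivative_eq_intros)
  then show ?thesis
    by (rule has_field_derivative_transform_within_open[where S = "{0<..}"])
      (use True H in \<open>auto simp: prim_def\<close>)
next
  case False
  then have "((\<lambda>x. - ((- x) powr (2 * H - 1)) / (2 * H - 1)) has_real_derivative \<bar>x\<bar> powr (2 * H - 2)) (at x)"
    using assms H by (auto intro!: derivative_eq_intros)
  then show ?thesis
    by (rule has_field_derivative_transform_within_open[where S = "{..<0}"])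
      (use False assms H in \<open>auto simp: prim_def\<close>)
qed

lemma prim2_deriv:
  assumes "x \<noteq> 0"
  shows "(prim2 has_real_derivative prim x) (at x)"
proof (cases "x > 0")
  case True
  have "((\<lambda>x. x powr (2 * H) / (2 * H * (2 * H - 1))) has_real_derivative prim x) (at x)"
    using True H by (auto intro!: derivative_eq_intros simp: prim_def)
  then show ?thesis
    by (rule has_field_derivative_transform_within_open[where S = "{0<..}"])
      (use True H in \<open>auto simp: prim2_def\<close>)
next
  case False
  then have "((\<lambda>x. (- x) powr (2 * H) / (2 * H * (2 * H - 1))) has_real_derivative prim x) (at x)"
    using assms H by (auto intro!: derivative_eq_intros simp: prim_def)
  then show ?thesis
    by (rule has_field_derivative_transform_within_open[where S = "{..<0}"])
      (use False assms H in \<open>auto simp: prim2_def\<close>)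
qed

lemma riesz_indicator_integral:
  assumes s: "s \<in> {0..T}"
  shows "has_bochner_integral \<mu> (\<lambda>v. indicator {0<..s} v * riesz u v) (prim (s - u) + prim u)"
proof (rule has_integral_imp_bochner_lebesgue_on)
  have "(riesz u has_integral (prim (s - u) - prim (0 - u))) {0..s}"
  proof (rule fundamental_theorem_of_calculus_interior_strong[where S = "{u}"])
    fix v assume v: "v \<in> {0<..<s} - {u}"
    have "((\<lambda>v. prim (v - u)) has_real_derivative (\<bar>v - u\<bar> powr (2 * H - 2) * 1)) (at v)"
      by (rule DERIV_chain2[where f = prim and g = "\<lambda>v. v - u"])
        (use v in \<open>auto intro!: prim_deriv derivative_eq_intros\<close>)
    then show "((\<lambda>v. prim (v - u)) has_vector_derivative riesz u v) (at v)"
      by (simp add: has_real_derivative_iff_has_vector_derivative riesz_def abs_minus_commute)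
  next
    show "continuous_on {0..s} (\<lambda>v. prim (v - u))"
      by (rule continuous_on_compose2[OF prim_continuous[of UNIV]]) (auto intro!: continuous_intros)
  qed (use s in auto)
  moreover have "prim (0 - u) = - prim u" by (simp add: prim_def diff_divide_distrib)
  ultimately show "(riesz u has_integral (prim (s - u) + prim u)) {0..s}" by simp
qed (use s riesz_nonneg in auto)

lemma potential_indicator: "s \<in> {0..T} \<Longrightarrow> potential (indicator {0<..s}) u = prim (s - u) + prim u"
  unfolding potential_def using riesz_indicator_integral by (rule has_bochner_integral_integral_eq)

text \<open>The double integral of \<open>H (2H - 1) \<bar>u - v\<bar>\<^sup>2\<^sup>H\<^sup>-\<^sup>2\<close> over \<open>(0,t] \<times> (0,s]\<close> is the covariance of
fractional Brownian motion.\<close>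

lemma form_indicator_integral:
  assumes t: "t \<in> {0..T}" and s: "s \<in> {0..T}"
  shows "has_bochner_integral \<mu> (\<lambda>u. indicator {0<..t} u * potential (indicator {0<..s}) u)
    (fbm_cov H t s / (H * (2 * H - 1)))"
proof (rule has_integral_imp_bochner_lebesgue_on)
  have "(potential (indicator {0<..s}) has_integral
      ((prim2 t - prim2 (s - t)) - (prim2 0 - prim2 (s - 0)))) {0..t}"
  proof (rule fundamental_theorem_of_calculus_interior_strong[where S = "{s}"])
    fix u assume u: "u \<in> {0<..<t} - {s}"
    have "((\<lambda>u. prim2 (s - u)) has_real_derivative (prim (s - u) * (- 1))) (at u)"
      by (rule DERIV_chain2[where f = prim2 and g = "\<lambda>u. s - u"])
        (use u in \<open>auto intro!: prim2_deriv derivative_eq_intros\<close>)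
    from DERIV_diff[OF prim2_deriv[of u] this]
    have "((\<lambda>u. prim2 u - prim2 (s - u)) has_real_derivative potential (indicator {0<..s}) u) (at u)"
      using u by (simp add: potential_indicator[OF s] add.commute)
    then show "((\<lambda>u. prim2 u - prim2 (s - u)) has_vector_derivative potential (indicator {0<..s}) u) (at u)"
      by (simp add: has_real_derivative_iff_has_vector_derivative)
  next
    show "continuous_on {0..t} (\<lambda>u. prim2 u - prim2 (s - u))"
      by (intro continuous_intros continuous_on_compose2[OF prim2_continuous[of UNIV]]) auto
  qed (use t in auto)
  moreover have "(prim2 t - prim2 (s - t)) - (prim2 0 - prim2 (s - 0)) = fbm_cov H t s / (H * (2 * H - 1))"
  proof -
    have "\<bar>s - t\<bar> = \<bar>t - s\<bar>" by simp
    then show ?thesis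
      using t s by (simp add: prim2_def fbm_cov_def add_divide_distrib diff_divide_distrib mult.assoc)
  qed
  ultimately show "(potential (indicator {0<..s}) has_integral (fbm_cov H t s / (H * (2 * H - 1)))) {0..t}" by simp
next
  fix u show "potential (indicator {0<..s}) u \<ge> 0"
    unfolding potential_def by (intro Bochner_Integration.integral_nonneg) (simp add: riesz_nonneg)
next
  show "potential (indicator {0<..s}) \<in> borel_measurable borel"
    unfolding potential_indicator[OF s, abs_def] by measurable
qed (use t in auto)

lemma fbm_form_step:
  assumes "step_rep T A c f" "step_rep T B d g"
  shows "fbm_form H T f g = (\<Sum>t\<in>A. \<Sum>s\<in>B. c t * d s * fbm_cov H t s)"
proof -
  have f: "f = (\<lambda>x. \<Sum>t\<in>A. c t * indicator {0<..t} x)" and g: "g = (\<lambda>x. \<Sum>t\<in>B. d t * indicator {0<..t} x)"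
    and sub: "A \<subseteq> {0..T}" "B \<subseteq> {0..T}"
    using assms by (simp_all only: step_rep_def)
  have pot: "potential g u = (\<Sum>s\<in>B. d s * potential (indicator {0<..s}) u)" for u
  proof -
    have "has_bochner_integral \<mu> (\<lambda>v. \<Sum>s\<in>B. d s * (indicator {0<..s} v * riesz u v))
        (\<Sum>s\<in>B. d s * (prim (s - u) + prim u))"
      using sub by (intro has_bochner_integral_sum has_bochner_integral_mult_right riesz_indicator_integral) auto
    then have "(\<integral>v. (\<Sum>s\<in>B. d s * (indicator {0<..s} v * riesz u v)) \<partial>\<mu>) = (\<Sum>s\<in>B. d s * (prim (s - u) + prim u))"
      by (rule has_bochner_integral_integral_eq)
    moreover have "(\<Sum>s\<in>B. d s * (prim (s - u) + prim u)) = (\<Sum>s\<in>B. d s * potential (indicator {0<..s}) u)"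
      using sub by (intro sum.cong refl) (auto simp: potential_indicator subset_iff)
    ultimately show ?thesis
      unfolding potential_def[of g] unfolding g sum_distrib_right mult.assoc by (rule trans)
  qed
  have "has_bochner_integral \<mu> (\<lambda>u. \<Sum>t\<in>A. \<Sum>s\<in>B. c t * d s * (indicator {0<..t} u * potential (indicator {0<..s}) u))
      (\<Sum>t\<in>A. \<Sum>s\<in>B. c t * d s * (fbm_cov H t s / (H * (2 * H - 1))))"
    using sub by (intro has_bochner_integral_sum has_bochner_integral_mult_right form_indicator_integral) auto
  then have "(\<integral>u. (\<Sum>t\<in>A. \<Sum>s\<in>B. c t * d s * (indicator {0<..t} u * potential (indicator {0<..s}) u)) \<partial>\<mu>)
     = (\<Sum>t\<in>A. \<Sum>s\<in>B. c t * d s * (fbm_cov H t s / (H * (2 * H - 1))))"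
    by (rule has_bochner_integral_integral_eq)
  also have "(\<lambda>u. \<Sum>t\<in>A. \<Sum>s\<in>B. c t * d s * (indicator {0<..t} u * potential (indicator {0<..s}) u))
      = (\<lambda>u. f u * potential g u)"
    by (intro ext) (simp only: pot f sum_product mult_ac)
  also have "(\<Sum>t\<in>A. \<Sum>s\<in>B. c t * d s * (fbm_cov H t s / (H * (2 * H - 1))))
      = (\<Sum>t\<in>A. \<Sum>s\<in>B. c t * d s * fbm_cov H t s) / (H * (2 * H - 1))"
    by (simp add: sum_divide_distrib)
  finally show ?thesis using H by (simp add: fbm_form_eq_potential)
qed

definition bounded_measurable :: "(real \<Rightarrow> real) set" where
  "bounded_measurable = {f \<in> borel_measurable \<mu>. \<exists>b. \<forall>x\<in>{0..T}. \<bar>f x\<bar> \<le> b}"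

lemma AE_\<mu>_nonzero: "AE x in \<mu>. x \<noteq> 0"
proof -
  have "AE v in lebesgue. v \<noteq> (0::real)" by (rule AE_completion[OF AE_lborel_singleton])
  then show ?thesis by (subst AE_restrict_space_iff) auto
qed

lemma riesz_integrable: "integrable \<mu> (riesz u)"
proof -
  have "integrable \<mu> (\<lambda>v. indicator {0<..T} v * riesz u v)"
    using riesz_indicator_integral[of T u] T by (auto simp: has_bochner_integral_iff)
  moreover have "AE v in \<mu>. indicator {0<..T} v * riesz u v = riesz u v"
    using AE_\<mu>_nonzero AE_space by eventually_elim (auto simp: space_\<mu>)
  ultimately show ?thesis
    by (subst integrable_cong_AE[where g = "\<lambda>v. indicator {0<..T} v * riesz u v"])
      (auto intro!: borel_imp_measurable_\<mu>)
qed

lemma potential_integrand_integrable: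
  assumes "g \<in> bounded_measurable"
  shows "integrable \<mu> (\<lambda>v. g v * riesz u v)"
proof -
  obtain b where b: "\<And>x. x \<in> {0..T} \<Longrightarrow> \<bar>g x\<bar> \<le> b" and g: "g \<in> borel_measurable \<mu>"
    using assms unfolding bounded_measurable_def by blast
  show ?thesis
  proof (rule Bochner_Integration.integrable_bound)
    show "integrable \<mu> (\<lambda>v. b * riesz u v)" by (intro integrable_mult_right riesz_integrable)
    show "AE v in \<mu>. norm (g v * riesz u v) \<le> norm (b * riesz u v)"
    proof (rule AE_I2)
      fix v assume "v \<in> space \<mu>"
      then have "\<bar>g v\<bar> \<le> \<bar>b\<bar>" using b[of v] by (simp add: space_\<mu>)
      then show "norm (g v * riesz u v) \<le> norm (b * riesz u v)"
        by (simp add: abs_mult mult_right_mono)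
    qed
  qed (intro borel_measurable_times g borel_imp_measurable_\<mu> riesz_measurable)
qed

lemma prim_bound: "x \<le> T \<Longrightarrow> prim x \<le> T powr (2 * H - 1) / (2 * H - 1)"
proof -
  assume "x \<le> T"
  then have "max 0 x powr (2 * H - 1) \<le> T powr (2 * H - 1)" using H T by (intro powr_mono2) auto
  then have "max 0 x powr (2 * H - 1) - max 0 (- x) powr (2 * H - 1) \<le> T powr (2 * H - 1)"
    using powr_ge_zero[of "max 0 (- x)" "2 * H - 1"] by linarith
  then show ?thesis unfolding prim_def using H by (intro divide_right_mono) auto
qed

lemma potential_bound:
  assumes g: "g \<in> bounded_measurable" "\<And>x. x \<in> {0..T} \<Longrightarrow> \<bar>g x\<bar> \<le> b" and u: "u \<in> {0..T}" and "b \<ge> 0"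
  shows "\<bar>potential g u\<bar> \<le> b * (2 * T powr (2 * H - 1) / (2 * H - 1))"
proof -
  have "\<bar>potential g u\<bar> \<le> (\<integral>v. norm (g v * riesz u v) \<partial>\<mu>)"
    unfolding potential_def using integral_norm_bound[of \<mu>] by simp
  also have "\<dots> \<le> (\<integral>v. b * riesz u v \<partial>\<mu>)"
    using g by (intro integral_mono integrable_norm potential_integrand_integrable integrable_mult_right riesz_integrable)
      (auto simp: space_\<mu> abs_mult riesz_nonneg intro!: mult_right_mono)
  also have "\<dots> = b * (\<integral>v. riesz u v \<partial>\<mu>)" by simp
  also have "(\<integral>v. riesz u v \<partial>\<mu>) = (\<integral>v. indicator {0<..T} v * riesz u v \<partial>\<mu>)"
  proof (rule integral_cong_AE)
    show "AE v in \<mu>. riesz u v = indicator {0<..T} v * riesz u v"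
      using AE_\<mu>_nonzero AE_space by eventually_elim (auto simp: space_\<mu>)
  qed (auto intro!: borel_imp_measurable_\<mu>)
  also have "\<dots> = prim (T - u) + prim u"
    using riesz_indicator_integral[of T u] T by (intro has_bochner_integral_integral_eq) auto
  also have "\<dots> \<le> 2 * T powr (2 * H - 1) / (2 * H - 1)"
    using prim_bound[of "T - u"] prim_bound[of u] u by simp
  finally show ?thesis using \<open>b \<ge> 0\<close> by (simp add: mult_left_mono)
qed

lemma step_fun_bounded_measurable: "f \<in> step_funs T \<Longrightarrow> f \<in> bounded_measurable"
proof -
  assume "f \<in> step_funs T"
  then obtain A c where "step_rep T A c f" by (auto simp: step_funs_def)
  then have f: "f = (\<lambda>x. \<Sum>t\<in>A. c t * indicator {0<..t} x)" by (simp only: step_rep_def)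
  have "\<bar>f x\<bar> \<le> (\<Sum>t\<in>A. \<bar>c t\<bar>)" for x
    unfolding f by (rule sum_abs[THEN order_trans], rule sum_mono) (simp add: indicator_def)
  moreover have "f \<in> borel_measurable \<mu>"
    unfolding f by (rule borel_imp_measurable_\<mu>) measurable
  ultimately show ?thesis by (auto simp: bounded_measurable_def)
qed

lemma potential_step_measurable: "f \<in> step_funs T \<Longrightarrow> potential f \<in> borel_measurable \<mu>"
proof -
  assume "f \<in> step_funs T"
  then obtain A c where "step_rep T A c f" by (auto simp: step_funs_def)
  then have f: "f = (\<lambda>x. \<Sum>t\<in>A. c t * indicator {0<..t} x)" and sub: "A \<subseteq> {0..T}" by (simp_all only: step_rep_def)
  have "potential f u = (\<Sum>s\<in>A. c s * (prim (s - u) + prim u))" for u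
  proof -
    have "has_bochner_integral \<mu> (\<lambda>v. \<Sum>s\<in>A. c s * (indicator {0<..s} v * riesz u v))
        (\<Sum>s\<in>A. c s * (prim (s - u) + prim u))"
      using sub by (intro has_bochner_integral_sum has_bochner_integral_mult_right riesz_indicator_integral) auto
    then show ?thesis
      unfolding potential_def f sum_distrib_right mult.assoc by (rule has_bochner_integral_integral_eq)
  qed
  then have "potential f = (\<lambda>u. \<Sum>s\<in>A. c s * (prim (s - u) + prim u))" by (rule ext)
  then show ?thesis by (simp only:) (rule borel_imp_measurable_\<mu>, measurable)
qed


sublocale kernel: cov_kernel T "fbm_cov H"
  using H by (intro fbm_cov_kernel) auto

lemma step_fun_zero: "f \<in> step_funs T \<Longrightarrow> f 0 = 0"
  by (auto simp: step_funs_def step_rep_def)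

text \<open>On each cell of an equidistant partition the step function takes the value of \<open>h\<close> at the right
endpoint, which belongs to the cell.\<close>

lemma continuous_step_approx:
  assumes h: "continuous_on {0..T} h" and e: "e > 0"
  obtains s where "s \<in> step_funs T" "\<And>x. x \<in> {0<..T} \<Longrightarrow> \<bar>s x - h x\<bar> < e"
proof -
  obtain d where d: "d > 0" "\<And>x y. x \<in> {0..T} \<Longrightarrow> y \<in> {0..T} \<Longrightarrow> dist y x < d \<Longrightarrow> dist (h y) (h x) < e"
    using compact_uniformly_continuous[OF h] e unfolding uniformly_continuous_on_def by (meson compact_Icc)
  obtain m :: nat where m: "T / d < real m" using reals_Archimedean2 by blast
  then have m_pos: "real m > 0" using T d(1) by (smt (verit) divide_pos_pos)
  define p where "p i = T * real i / real m" for i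
  have p_mono: "i \<le> j \<Longrightarrow> p i \<le> p j" for i j
    using T m_pos by (simp add: p_def divide_right_mono)
  have p_mem: "i \<le> m \<Longrightarrow> p i \<in> {0..T}" for i
    using T m_pos by (simp add: p_def field_simps)
  define s where "s x = (\<Sum>i<m. h (p (Suc i)) * indicator {0<..p (Suc i)} x)
      - (\<Sum>i<m. h (p (Suc i)) * indicator {0<..p i} x)" for x
  have "s \<in> step_funs T"
    unfolding s_def
    by (intro kernel.diff_mem kernel.sum_mem indicator_step_fun p_mem) auto
  moreover have "\<bar>s x - h x\<bar> < e" if x: "x \<in> {0<..T}" for x
  proof -
    \<comment> \<open>The cell containing x ends at the first partition point not smaller than x.\<close>
    define j where "j = (LEAST j. x \<le> p j)"
    have "x \<le> p m" using x m_pos by (simp add: p_def)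
    then have j: "x \<le> p j" and "j \<le> m" unfolding j_def by (auto intro: LeastI Least_le)
    have "j \<noteq> 0"
    proof
      assume "j = 0"
      then show False using j x by (simp add: p_def)
    qed
    then obtain k where k: "j = Suc k" using not0_implies_Suc by blast
    have pk: "p k < x" using not_less_Least[of k "\<lambda>j. x \<le> p j"] k by (simp add: j_def)
    have "k < m" using k \<open>j \<le> m\<close> by simp
    have "h (p (Suc i)) * indicator {0<..p (Suc i)} x - h (p (Suc i)) * indicator {0<..p i} x
        = (if i = k then h (p (Suc k)) else 0)" for i
    proof (cases i k rule: linorder_cases)
      case less
      then have "p (Suc i) \<le> p k" "p i \<le> p k" by (auto intro!: p_mono)
      then show ?thesis using less pk by (auto simp: indicator_def)
    next
      case equal
      then show ?thesis using pk j k x by (auto simp: indicator_def)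
    next
      case greater
      then have "p (Suc k) \<le> p i" "p (Suc k) \<le> p (Suc i)" by (auto intro!: p_mono)
      then show ?thesis using greater j k x by (auto simp: indicator_def)
    qed
    then have "s x = (\<Sum>i<m. if i = k then h (p (Suc k)) else 0)"
      unfolding s_def sum_subtractf[symmetric] by (simp only:)
    then have "s x = h (p (Suc k))" using \<open>k < m\<close> by simp
    moreover have "dist (p (Suc k)) x < d"
    proof -
      have "dist (p (Suc k)) x \<le> p (Suc k) - p k" using j k pk by (simp add: dist_real_def)
      also have "\<dots> = T / m" by (simp add: p_def distrib_left add_divide_distrib)
      also have "\<dots> < d" using m m_pos d(1) by (simp add: field_simps)
      finally show ?thesis .
    qed
    ultimately show ?thesis
      using d(2)[of x "p (Suc k)"] x p_mem[of "Suc k"] \<open>k < m\<close> by (simp add: dist_real_def)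
  qed
  ultimately show ?thesis by (rule that)
qed

text \<open>A measurable function is an almost everywhere limit of continuous functions. Clamping these to
\<open>[-b,b]\<close> keeps the limit and gives a uniform bound; step functions then approximate them uniformly.\<close>

lemma bounded_measurable_approx:
  assumes f: "f \<in> bounded_measurable" and b: "\<And>x. x \<in> {0..T} \<Longrightarrow> \<bar>f x\<bar> \<le> b"
  obtains s where "\<And>n. s n \<in> step_funs T" "\<And>n x. x \<in> {0..T} \<Longrightarrow> \<bar>s n x\<bar> \<le> b + 1"
    "AE x in \<mu>. (\<lambda>n. s n x) \<longlonglongrightarrow> f x"
proof -
  have b_nonneg: "b \<ge> 0" using b[of 0] T by simp
  have "f \<in> borel_measurable \<mu>" using f by (simp add: bounded_measurable_def)
  then have "(\<lambda>x. if x \<in> {0..T} then f x else 0) \<in> borel_measurable lebesgue"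
    by (rule borel_measurable_if_I) simp
  then have "(\<lambda>x. if x \<in> {0..T} then f x else 0) measurable_on UNIV"
    by (rule lebesgue_measurable_imp_measurable_on_real) simp
  then obtain Z g where Z: "negligible Z" and g: "\<And>n. continuous_on UNIV (g n)"
    and lim: "\<And>x. x \<notin> Z \<Longrightarrow> (\<lambda>n. g n x) \<longlonglongrightarrow> (if x \<in> {0..T} then f x else 0)"
    unfolding measurable_on_def by auto
  define h where "h n x = max (- b) (min b (g n x))" for n x
  have h_cont: "continuous_on {0..T} (h n)" for n
    unfolding h_def by (intro continuous_intros continuous_on_subset[OF g]) auto
  have "\<exists>s. s \<in> step_funs T \<and> (\<forall>x\<in>{0<..T}. \<bar>s x - h n x\<bar> < 1 / real (Suc n))" for n
    using continuous_step_approx[OF h_cont[of n], of "1 / real (Suc n)"] by (metis of_nat_0_less_iff zero_less_Suc zero_less_divide_1_iff)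
  then obtain s where s: "\<And>n. s n \<in> step_funs T" and sh: "\<And>n x. x \<in> {0<..T} \<Longrightarrow> \<bar>s n x - h n x\<bar> < 1 / real (Suc n)"
    by metis
  show ?thesis
  proof (rule that[OF s])
    fix n x assume x: "x \<in> {0..T}"
    show "\<bar>s n x\<bar> \<le> b + 1"
    proof (cases "x = 0")
      case True
      then show ?thesis using step_fun_zero[OF s] b_nonneg by simp
    next
      case False
      have "\<bar>s n x - h n x\<bar> < 1 / real (Suc n)" using sh x False by simp
      also have "\<dots> \<le> 1" by simp
      finally have "\<bar>s n x - h n x\<bar> < 1" .
      moreover have "\<bar>h n x\<bar> \<le> b" using b_nonneg by (auto simp: h_def)
      ultimately show ?thesis by linarith
    qed
  next
    have "AE x in lebesgue. x \<notin> Z" using Z by (intro AE_not_in) (simp add: negligible_iff_null_sets)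
    then have "AE x in \<mu>. x \<notin> Z" by (subst AE_restrict_space_iff) auto
    then show "AE x in \<mu>. (\<lambda>n. s n x) \<longlonglongrightarrow> f x"
      using AE_space AE_\<mu>_nonzero
    proof eventually_elim
      case (elim x)
      then have x: "x \<in> {0..T}" "x \<in> {0<..T}" by (auto simp: space_\<mu>)
      have "(\<lambda>n. h n x) \<longlonglongrightarrow> max (- b) (min b (f x))"
        unfolding h_def using lim[OF elim(1)] x(1) by (intro tendsto_intros) simp
      also have "max (- b) (min b (f x)) = f x" using b[OF x(1)] by auto
      finally have "(\<lambda>n. h n x) \<longlonglongrightarrow> f x" .
      moreover have "(\<lambda>n. s n x - h n x) \<longlonglongrightarrow> 0"
        by (rule Lim_null_comparison[OF _ LIMSEQ_Suc[OF lim_1_over_n]])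
          (use sh[OF x(2)] in \<open>auto intro!: always_eventually less_imp_le\<close>)
      ultimately have "(\<lambda>n. (s n x - h n x) + h n x) \<longlonglongrightarrow> 0 + f x" by (intro tendsto_add)
      then show ?case by simp
    qed
  qed
qed

lemma bounded_measurableD: "f \<in> bounded_measurable \<Longrightarrow> f \<in> borel_measurable \<mu>"
  by (simp add: bounded_measurable_def)

lemma bounded_measurable_bound:
  assumes "f \<in> bounded_measurable"
  obtains b where "b \<ge> 0" "\<And>x. x \<in> {0..T} \<Longrightarrow> \<bar>f x\<bar> \<le> b"
proof -
  obtain b where b: "\<And>x. x \<in> {0..T} \<Longrightarrow> \<bar>f x\<bar> \<le> b"
    using assms unfolding bounded_measurable_def by blast
  moreover have "b \<ge> 0" using b[of 0] T by simp
  ultimately show ?thesis using that by blast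
qed

lemma potential_tendsto:
  assumes s: "\<And>n. s n \<in> bounded_measurable" "\<And>n x. x \<in> {0..T} \<Longrightarrow> \<bar>s n x\<bar> \<le> b"
    and f: "f \<in> bounded_measurable" and lim: "AE x in \<mu>. (\<lambda>n. s n x) \<longlonglongrightarrow> f x"
  shows "(\<lambda>n. potential (s n) u) \<longlonglongrightarrow> potential f u"
  unfolding potential_def
proof (rule integral_dominated_convergence[where w = "\<lambda>v. b * riesz u v"])
  show "(\<lambda>v. f v * riesz u v) \<in> borel_measurable \<mu>"
    "\<And>n. (\<lambda>v. s n v * riesz u v) \<in> borel_measurable \<mu>"
    by (intro borel_measurable_times bounded_measurableD s f borel_imp_measurable_\<mu> riesz_measurable)+
  show "integrable \<mu> (\<lambda>v. b * riesz u v)" by (intro integrable_mult_right riesz_integrable)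
  show "AE v in \<mu>. (\<lambda>n. s n v * riesz u v) \<longlonglongrightarrow> f v * riesz u v"
    using lim by eventually_elim (intro tendsto_intros)
  show "AE v in \<mu>. norm (s n v * riesz u v) \<le> b * riesz u v" for n
    using AE_space by eventually_elim (auto simp: space_\<mu> abs_mult riesz_nonneg intro!: mult_right_mono s(2))
qed

text \<open>For step functions the potential is explicit, and in general it is a pointwise limit of such.\<close>

lemma potential_measurable:
  assumes f: "f \<in> bounded_measurable"
  shows "potential f \<in> borel_measurable \<mu>"
proof -
  obtain b where b: "b \<ge> 0" "\<And>x. x \<in> {0..T} \<Longrightarrow> \<bar>f x\<bar> \<le> b" using bounded_measurable_bound[OF f] by blast
  obtain s where s: "\<And>n. s n \<in> step_funs T" "\<And>n x. x \<in> {0..T} \<Longrightarrow> \<bar>s n x\<bar> \<le> b + 1"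
    "AE x in \<mu>. (\<lambda>n. s n x) \<longlonglongrightarrow> f x"
    using bounded_measurable_approx[OF f b(2)] by blast
  show ?thesis
    by (rule borel_measurable_LIMSEQ_real[OF potential_tendsto potential_step_measurable])
      (use s f step_fun_bounded_measurable in auto)
qed

lemma form_integrand_bound:
  assumes g: "g \<in> bounded_measurable" "\<And>x. x \<in> {0..T} \<Longrightarrow> \<bar>g x\<bar> \<le> d"
    and f: "\<bar>y\<bar> \<le> b" and u: "u \<in> {0..T}"
  shows "norm (y * potential g u) \<le> b * (d * (2 * T powr (2 * H - 1) / (2 * H - 1)))"
proof -
  have "d \<ge> 0" "b \<ge> 0" using g(2)[of 0] T f by auto
  then show ?thesis
    unfolding real_norm_def abs_mult by (intro mult_mono potential_bound f g u) auto
qed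

lemma form_integrand_integrable:
  assumes f: "f \<in> bounded_measurable" and g: "g \<in> bounded_measurable"
  shows "integrable \<mu> (\<lambda>u. f u * potential g u)"
proof -
  interpret finite_measure \<mu> by (rule finite_measure_\<mu>)
  obtain b where b: "b \<ge> 0" "\<And>x. x \<in> {0..T} \<Longrightarrow> \<bar>f x\<bar> \<le> b" using bounded_measurable_bound[OF f] by blast
  obtain d where d: "d \<ge> 0" "\<And>x. x \<in> {0..T} \<Longrightarrow> \<bar>g x\<bar> \<le> d" using bounded_measurable_bound[OF g] by blast
  show ?thesis
  proof (rule integrable_const_bound)
    show "AE u in \<mu>. norm (f u * potential g u) \<le> b * (d * (2 * T powr (2 * H - 1) / (2 * H - 1)))"
      by (rule AE_I2, rule form_integrand_bound) (use g b(2) d(2) in \<open>auto simp: space_\<mu>\<close>)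
  qed (intro borel_measurable_times bounded_measurableD f potential_measurable g)
qed

lemma fbm_form_tendsto:
  assumes s: "\<And>n. s n \<in> bounded_measurable" "\<And>n x. x \<in> {0..T} \<Longrightarrow> \<bar>s n x\<bar> \<le> b"
    and f: "f \<in> bounded_measurable" and lims: "AE x in \<mu>. (\<lambda>n. s n x) \<longlonglongrightarrow> f x"
    and t: "\<And>n. t n \<in> bounded_measurable" "\<And>n x. x \<in> {0..T} \<Longrightarrow> \<bar>t n x\<bar> \<le> d"
    and g: "g \<in> bounded_measurable" and limt: "AE x in \<mu>. (\<lambda>n. t n x) \<longlonglongrightarrow> g x"
  shows "(\<lambda>n. fbm_form H T (s n) (t n)) \<longlonglongrightarrow> fbm_form H T f g"
  unfolding fbm_form_eq_potential
proof (rule tendsto_mult_left,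
    rule integral_dominated_convergence[where w = "\<lambda>_. b * (d * (2 * T powr (2 * H - 1) / (2 * H - 1)))"])
  show "(\<lambda>u. f u * potential g u) \<in> borel_measurable \<mu>"
    "\<And>n. (\<lambda>u. s n u * potential (t n) u) \<in> borel_measurable \<mu>"
    by (intro borel_measurable_times bounded_measurableD potential_measurable s t f g)+
  show "integrable \<mu> (\<lambda>_. b * (d * (2 * T powr (2 * H - 1) / (2 * H - 1))))"
    by (rule finite_measure.integrable_const[OF finite_measure_\<mu>])
  show "AE u in \<mu>. (\<lambda>n. s n u * potential (t n) u) \<longlonglongrightarrow> f u * potential g u"
    using lims by eventually_elim (intro tendsto_mult potential_tendsto[OF t g limt])
  show "AE u in \<mu>. norm (s n u * potential (t n) u) \<le> b * (d * (2 * T powr (2 * H - 1) / (2 * H - 1)))" for n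
    by (rule AE_I2, rule form_integrand_bound) (use t s(2) in \<open>auto simp: space_\<mu>\<close>)
qed

lemma fbm_form_step_approx:
  assumes f: "f \<in> bounded_measurable"
  obtains s b where "\<And>n. s n \<in> step_funs T" "\<And>n x. x \<in> {0..T} \<Longrightarrow> \<bar>s n x\<bar> \<le> b"
    "AE x in \<mu>. (\<lambda>n. s n x) \<longlonglongrightarrow> f x"
proof -
  obtain b where b: "b \<ge> 0" "\<And>x. x \<in> {0..T} \<Longrightarrow> \<bar>f x\<bar> \<le> b" using bounded_measurable_bound[OF f] by blast
  obtain s where s: "\<And>n. s n \<in> step_funs T" "\<And>n x. x \<in> {0..T} \<Longrightarrow> \<bar>s n x\<bar> \<le> b + 1"
    "AE x in \<mu>. (\<lambda>n. s n x) \<longlonglongrightarrow> f x"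
    using bounded_measurable_approx[OF f b(2)] by blast
  show ?thesis by (rule that[OF s])
qed

lemma fbm_form_eq_step_inner:
  assumes f: "f \<in> step_funs T" and g: "g \<in> step_funs T"
  shows "fbm_form H T f g = step_inner T (fbm_cov H) f g"
proof -
  obtain A c where A: "step_rep T A c f" using f by (auto simp: step_funs_def)
  obtain B d where B: "step_rep T B d g" using g by (auto simp: step_funs_def)
  show ?thesis by (simp only: fbm_form_step[OF A B] kernel.step_inner_rep[OF A B])
qed

text \<open>Symmetry and positivity hold on step functions, where the form is given by the covariance kernel, and
pass to bounded measurable functions by approximation.\<close>

sublocale form: semi_inner bounded_measurable "fbm_form H T"
proof
  show "(\<lambda>x. 0) \<in> bounded_measurable" by (auto simp: bounded_measurable_def)
next
  fix f g assume f: "f \<in> bounded_measurable" and g: "g \<in> bounded_measurable"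
  obtain b where b: "\<And>x. x \<in> {0..T} \<Longrightarrow> \<bar>f x\<bar> \<le> b" using bounded_measurable_bound[OF f] by blast
  obtain d where d: "\<And>x. x \<in> {0..T} \<Longrightarrow> \<bar>g x\<bar> \<le> d" using bounded_measurable_bound[OF g] by blast
  have "\<bar>f x + g x\<bar> \<le> b + d" if "x \<in> {0..T}" for x using b[OF that] d[OF that] by linarith
  moreover have "(\<lambda>x. f x + g x) \<in> borel_measurable \<mu>"
    by (intro borel_measurable_add bounded_measurableD f g)
  ultimately show "(\<lambda>x. f x + g x) \<in> bounded_measurable" unfolding bounded_measurable_def by blast
next
  fix f a assume f: "f \<in> bounded_measurable"
  obtain b where b: "\<And>x. x \<in> {0..T} \<Longrightarrow> \<bar>f x\<bar> \<le> b" using bounded_measurable_bound[OF f] by blast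
  have "\<bar>a * f x\<bar> \<le> \<bar>a\<bar> * b" if "x \<in> {0..T}" for x
    using b[OF that] by (simp add: abs_mult mult_left_mono)
  moreover have "(\<lambda>x. a * f x) \<in> borel_measurable \<mu>"
    by (intro borel_measurable_times borel_measurable_const bounded_measurableD f)
  ultimately show "(\<lambda>x. a * f x) \<in> bounded_measurable" unfolding bounded_measurable_def by blast
next
  fix f g h assume f: "f \<in> bounded_measurable" and g: "g \<in> bounded_measurable" and h: "h \<in> bounded_measurable"
  show "fbm_form H T (\<lambda>x. f x + g x) h = fbm_form H T f h + fbm_form H T g h"
    using form_integrand_integrable[OF f h] form_integrand_integrable[OF g h]
    by (simp add: fbm_form_eq_potential distrib_right distrib_left)
next
  fix f h a assume f: "f \<in> bounded_measurable" and h: "h \<in> bounded_measurable"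
  show "fbm_form H T (\<lambda>x. a * f x) h = a * fbm_form H T f h"
    by (simp add: fbm_form_eq_potential mult.assoc)
next
  fix f g assume f: "f \<in> bounded_measurable" and g: "g \<in> bounded_measurable"
  obtain s b where s: "\<And>n. s n \<in> step_funs T" "\<And>n x. x \<in> {0..T} \<Longrightarrow> \<bar>s n x\<bar> \<le> b"
    "AE x in \<mu>. (\<lambda>n. s n x) \<longlonglongrightarrow> f x" using fbm_form_step_approx[OF f] by blast
  obtain t d where t: "\<And>n. t n \<in> step_funs T" "\<And>n x. x \<in> {0..T} \<Longrightarrow> \<bar>t n x\<bar> \<le> d"
    "AE x in \<mu>. (\<lambda>n. t n x) \<longlonglongrightarrow> g x" using fbm_form_step_approx[OF g] by blast
  note s' = step_fun_bounded_measurable[OF s(1)] and t' = step_fun_bounded_measurable[OF t(1)]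
  have "(\<lambda>n. fbm_form H T (s n) (t n)) \<longlonglongrightarrow> fbm_form H T f g"
    by (rule fbm_form_tendsto[OF s' s(2) f s(3) t' t(2) g t(3)])
  moreover have "(\<lambda>n. fbm_form H T (t n) (s n)) \<longlonglongrightarrow> fbm_form H T g f"
    by (rule fbm_form_tendsto[OF t' t(2) g t(3) s' s(2) f s(3)])
  moreover have "fbm_form H T (s n) (t n) = fbm_form H T (t n) (s n)" for n
    using kernel.form_sym[OF s(1) t(1)] by (simp only: fbm_form_eq_step_inner[OF s(1) t(1)] fbm_form_eq_step_inner[OF t(1) s(1)])
  ultimately show "fbm_form H T f g = fbm_form H T g f" by (simp only: LIMSEQ_unique)
next
  fix f assume f: "f \<in> bounded_measurable"
  obtain s b where s: "\<And>n. s n \<in> step_funs T" "\<And>n x. x \<in> {0..T} \<Longrightarrow> \<bar>s n x\<bar> \<le> b"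
    "AE x in \<mu>. (\<lambda>n. s n x) \<longlonglongrightarrow> f x" using fbm_form_step_approx[OF f] by blast
  note s' = step_fun_bounded_measurable[OF s(1)]
  have "(\<lambda>n. fbm_form H T (s n) (s n)) \<longlonglongrightarrow> fbm_form H T f f"
    by (rule fbm_form_tendsto[OF s' s(2) f s(3) s' s(2) f s(3)])
  moreover have "fbm_form H T (s n) (s n) \<ge> 0" for n
    using kernel.form_pos[OF s(1)] by (simp only: fbm_form_eq_step_inner[OF s(1) s(1)])
  ultimately show "0 \<le> fbm_form H T f f" by (intro LIMSEQ_le_const) auto
qed

lemma truncate_bounded_measurable:
  assumes f: "f \<in> bounded_measurable"
  shows "truncate r f \<in> bounded_measurable"
proof -
  obtain b where b: "b \<ge> 0" "\<And>x. x \<in> {0..T} \<Longrightarrow> \<bar>f x\<bar> \<le> b" using bounded_measurable_bound[OF f] by blast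
  have "\<bar>truncate r f x\<bar> \<le> b" if "x \<in> {0..T}" for x
    using b(1) b(2)[OF that] by (auto simp: truncate_def indicator_def)
  moreover have "truncate r f \<in> borel_measurable \<mu>"
    unfolding truncate_def
    by (intro borel_measurable_times bounded_measurableD f borel_imp_measurable_\<mu> borel_measurable_indicator) simp
  ultimately show ?thesis unfolding bounded_measurable_def by blast
qed

lemma fbm_form_truncate_le:
  assumes r: "r \<in> {0..T}"
  obtains K where "\<And>f. f \<in> bounded_measurable \<Longrightarrow>
    fbm_form H T (truncate r f) (truncate r f) \<le> K * fbm_form H T f f"
proof -
  have H0: "0 < H" and r0: "0 \<le> r" using H r by auto
  obtain K where K: "\<And>A c. finite A \<Longrightarrow> (\<And>t. t \<in> A \<Longrightarrow> t \<ge> 0) \<Longrightarrow>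
    (\<Sum>t\<in>A. \<Sum>s\<in>A. c t * c s * fbm_cov H (min t r) (min s r))
      \<le> K * (\<Sum>t\<in>A. \<Sum>s\<in>A. c t * c s * fbm_cov H t s)"
    using fbm_truncation_bound[OF H0 H(2) r0] by blast
  have step: "fbm_form H T (truncate r s) (truncate r s) \<le> K * fbm_form H T s s" if s: "s \<in> step_funs T" for s
  proof -
    obtain A c where A: "step_rep T A c s" using s by (auto simp: step_funs_def)
    have eq: "s = (\<lambda>x. \<Sum>t\<in>A. c t * indicator {0<..t} x)" and sub: "finite A" "A \<subseteq> {0..T}"
      using A by (simp_all only: step_rep_def)
    have "fbm_form H T (truncate r s) (truncate r s)
        = step_inner T (fbm_cov H) (truncate r s) (truncate r s)"
      by (intro fbm_form_eq_step_inner kernel.truncate_mem s r)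
    also have "\<dots> = (\<Sum>t\<in>A. \<Sum>s\<in>A. c t * c s * fbm_cov H (min t r) (min s r))"
      unfolding eq truncate_sum by (rule kernel.inner_sum_indicator) (use sub r in \<open>auto simp: min_def\<close>)
    also have "\<dots> \<le> K * (\<Sum>t\<in>A. \<Sum>s\<in>A. c t * c s * fbm_cov H t s)"
      using sub by (intro K) auto
    also have "\<dots> = K * fbm_form H T s s"
      by (simp only: fbm_form_step[OF A A])
    finally show ?thesis .
  qed
  show ?thesis
  proof (rule that[of K])
    fix f assume f: "f \<in> bounded_measurable"
    obtain s b where s: "\<And>n. s n \<in> step_funs T" "\<And>n x. x \<in> {0..T} \<Longrightarrow> \<bar>s n x\<bar> \<le> b"
      "AE x in \<mu>. (\<lambda>n. s n x) \<longlonglongrightarrow> f x" using fbm_form_step_approx[OF f] by blast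
    note s' = step_fun_bounded_measurable[OF s(1)]
    have b: "\<bar>truncate r (s n) x\<bar> \<le> b" if "x \<in> {0..T}" for n x
    proof -
      have "\<bar>truncate r (s n) x\<bar> \<le> \<bar>s n x\<bar>" by (simp add: truncate_def indicator_def)
      then show ?thesis using s(2)[OF that, of n] by linarith
    qed
    have lim: "AE x in \<mu>. (\<lambda>n. truncate r (s n) x) \<longlonglongrightarrow> truncate r f x"
      using s(3) unfolding truncate_def by eventually_elim (intro tendsto_intros)
    have "(\<lambda>n. fbm_form H T (truncate r (s n)) (truncate r (s n))) \<longlonglongrightarrow> fbm_form H T (truncate r f) (truncate r f)"
      by (rule fbm_form_tendsto[OF truncate_bounded_measurable[OF s'] b truncate_bounded_measurable[OF f] lim
            truncate_bounded_measurable[OF s'] b truncate_bounded_measurable[OF f] lim])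
    moreover have "(\<lambda>n. K * fbm_form H T (s n) (s n)) \<longlonglongrightarrow> K * fbm_form H T f f"
      by (intro tendsto_mult_left fbm_form_tendsto[OF s' s(2) f s(3) s' s(2) f s(3)])
    ultimately show "fbm_form H T (truncate r f) (truncate r f) \<le> K * fbm_form H T f f"
      by (rule LIMSEQ_le) (use step s(1) in auto)
  qed
qed

end

section \<open>Square integrable processes\<close>

definition square_integrable :: "'a measure \<Rightarrow> ('a \<Rightarrow> real) set" where
  "square_integrable M = {Y \<in> borel_measurable M. integrable M (\<lambda>\<omega>. (Y \<omega>)\<^sup>2)}"

lemma square_integrable_measurable: "Y \<in> square_integrable M \<Longrightarrow> Y \<in> borel_measurable M"
  by (simp add: square_integrable_def)

lemma square_integrable_mult:
  assumes Y: "Y \<in> square_integrable M" and Z: "Z \<in> square_integrable M"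
  shows "integrable M (\<lambda>\<omega>. Y \<omega> * Z \<omega>)"
proof (rule Bochner_Integration.integrable_bound)
  show "integrable M (\<lambda>\<omega>. (Y \<omega>)\<^sup>2 + (Z \<omega>)\<^sup>2)"
    using Y Z by (simp add: square_integrable_def)
  show "(\<lambda>\<omega>. Y \<omega> * Z \<omega>) \<in> borel_measurable M"
    by (intro borel_measurable_times square_integrable_measurable Y Z)
  have "norm (y * z) \<le> norm (y\<^sup>2 + z\<^sup>2)" for y z :: real
  proof -
    have "2 * (\<bar>y\<bar> * \<bar>z\<bar>) \<le> y\<^sup>2 + z\<^sup>2" using sum_squares_bound[of "\<bar>y\<bar>" "\<bar>z\<bar>"] by (simp add: mult.assoc)
    moreover have "0 \<le> \<bar>y\<bar> * \<bar>z\<bar>" by simp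
    ultimately have "\<bar>y\<bar> * \<bar>z\<bar> \<le> y\<^sup>2 + z\<^sup>2" by linarith
    then show ?thesis by (simp add: abs_mult)
  qed
  then show "AE \<omega> in M. norm (Y \<omega> * Z \<omega>) \<le> norm ((Y \<omega>)\<^sup>2 + (Z \<omega>)\<^sup>2)" by simp
qed

lemma semi_inner_square_integrable:
  "semi_inner (square_integrable M) (\<lambda>Y Z. \<integral>\<omega>. Y \<omega> * Z \<omega> \<partial>M)"
proof
  fix f g assume f: "f \<in> square_integrable M" and g: "g \<in> square_integrable M"
  have "(f \<omega> + g \<omega>)\<^sup>2 = (f \<omega>)\<^sup>2 + (2 * (f \<omega> * g \<omega>) + (g \<omega>)\<^sup>2)" for \<omega>
    by (simp add: power2_sum)
  moreover have "integrable M (\<lambda>\<omega>. (f \<omega>)\<^sup>2 + (2 * (f \<omega> * g \<omega>) + (g \<omega>)\<^sup>2))"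
    using f g square_integrable_mult[OF f g]
    by (intro Bochner_Integration.integrable_add integrable_mult_right) (simp_all add: square_integrable_def)
  moreover have "(\<lambda>\<omega>. f \<omega> + g \<omega>) \<in> borel_measurable M"
    by (intro borel_measurable_add square_integrable_measurable f g)
  ultimately show "(\<lambda>\<omega>. f \<omega> + g \<omega>) \<in> square_integrable M"
    by (simp add: square_integrable_def)
next
  fix f g h assume *: "f \<in> square_integrable M" "g \<in> square_integrable M" "h \<in> square_integrable M"
  show "(\<integral>\<omega>. (f \<omega> + g \<omega>) * h \<omega> \<partial>M) = (\<integral>\<omega>. f \<omega> * h \<omega> \<partial>M) + (\<integral>\<omega>. g \<omega> * h \<omega> \<partial>M)"
    using square_integrable_mult[OF *(1,3)] square_integrable_mult[OF *(2,3)] by (simp add: distrib_right)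
next
  fix f and a :: real assume f: "f \<in> square_integrable M"
  have "(\<lambda>\<omega>. a * f \<omega>) \<in> borel_measurable M"
    by (intro borel_measurable_times borel_measurable_const square_integrable_measurable f)
  then show "(\<lambda>\<omega>. a * f \<omega>) \<in> square_integrable M"
    using f by (simp add: square_integrable_def power_mult_distrib)
next
  fix f g :: "'a \<Rightarrow> real"
  show "(\<integral>\<omega>. f \<omega> * g \<omega> \<partial>M) = (\<integral>\<omega>. g \<omega> * f \<omega> \<partial>M)" by (simp only: mult.commute)
qed (simp_all add: square_integrable_def mult.assoc)

lemma covariance_kernel:
  assumes sq: "\<And>t. t \<in> {0..T} \<Longrightarrow> X t \<in> square_integrable M"
    and zero: "\<And>t. t \<in> {0..T} \<Longrightarrow> covariance M X 0 t = 0"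
  shows "cov_kernel T (covariance M X)"
proof
  interpret L2: semi_inner "square_integrable M" "\<lambda>Y Z. \<integral>\<omega>. Y \<omega> * Z \<omega> \<partial>M"
    by (rule semi_inner_square_integrable)
  fix A and c :: "real \<Rightarrow> real" assume A: "finite A" "A \<subseteq> {0..T}"
  have mem: "X t \<in> square_integrable M" if "t \<in> A" for t using sq A(2) that by auto
  have "(\<Sum>t\<in>A. \<Sum>s\<in>A. c t * c s * covariance M X t s)
      = (\<integral>\<omega>. (\<Sum>t\<in>A. c t * X t \<omega>) * (\<Sum>t\<in>A. c t * X t \<omega>) \<partial>M)"
    unfolding covariance_def by (rule L2.form_sum_sum[OF mem, symmetric])
  also have "\<dots> \<ge> 0" by simp
  finally show "0 \<le> (\<Sum>t\<in>A. \<Sum>s\<in>A. c t * c s * covariance M X t s)" .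
qed (use zero in \<open>simp_all add: covariance_def mult.commute\<close>)

lemma centered_gaussian_square_integrable:
  assumes "prob_space M" and Y: "centered_gaussian M Y"
  shows "Y \<in> square_integrable M" "integrable M Y" "(\<integral>\<omega>. Y \<omega> \<partial>M) = 0"
proof -
  interpret prob_space M by fact
  have "Y \<in> square_integrable M \<and> integrable M Y \<and> (\<integral>\<omega>. Y \<omega> \<partial>M) = 0"
  proof (cases "Y \<in> borel_measurable M \<and> (AE \<omega> in M. Y \<omega> = 0)")
    case True
    then have [measurable]: "Y \<in> borel_measurable M" and ae: "AE \<omega> in M. Y \<omega> = 0" by auto
    have "integrable M Y \<longleftrightarrow> integrable M (\<lambda>_. 0 :: real)"
      by (rule integrable_cong_AE) (use ae in auto)
    moreover have "integrable M (\<lambda>\<omega>. (Y \<omega>)\<^sup>2) \<longleftrightarrow> integrable M (\<lambda>_. 0 :: real)"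
    proof (rule integrable_cong_AE)
      show "AE \<omega> in M. (Y \<omega>)\<^sup>2 = 0" using ae by eventually_elim simp
    qed auto
    moreover have "(\<integral>\<omega>. Y \<omega> \<partial>M) = (\<integral>\<omega>. 0 \<partial>M)"
      by (rule integral_cong_AE) (use ae in auto)
    ultimately show ?thesis by (simp add: square_integrable_def)
  next
    case False
    then obtain s where s: "s > 0" and D: "distributed M lborel Y (normal_density 0 s)"
      using Y unfolding centered_gaussian_def by blast
    have [measurable]: "Y \<in> borel_measurable M" using distributed_measurable[OF D] by simp
    have moment: "integrable M (\<lambda>\<omega>. (Y \<omega>) ^ k)" for k
      using distributed_integrable[OF D, of "\<lambda>x. x ^ k"] integrable_normal_moment[OF s, of 0 k]
      by simp
    have "expectation Y = 0" by (rule normal_distributed_expectation[OF s D])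
    then show ?thesis using moment[of 1] moment[of 2] by (simp add: square_integrable_def)
  qed
  then show "Y \<in> square_integrable M" "integrable M Y" "(\<integral>\<omega>. Y \<omega> \<partial>M) = 0" by auto
qed

lemma gaussian_process_marginal:
  assumes X: "centered_gaussian_process M T X" and t: "t \<in> {0..T}"
  shows "centered_gaussian M (X t)"
proof -
  have "centered_gaussian M (\<lambda>\<omega>. \<Sum>u\<in>{t}. 1 * X u \<omega>)"
    using X t unfolding centered_gaussian_process_def
    by (elim conjE allE[of _ "{t}"] allE[of _ "\<lambda>_. 1"]) auto
  then show ?thesis by simp
qed

lemma gaussian_process_kernel:
  assumes "prob_space M" and X: "centered_gaussian_process M T X" and T: "T > 0"
  shows "cov_kernel T (covariance M X)"
proof (rule covariance_kernel)
  note sq = centered_gaussian_square_integrable(1)[OF assms(1) gaussian_process_marginal[OF X]]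
  show "\<And>t. t \<in> {0..T} \<Longrightarrow> X t \<in> square_integrable M" by (rule sq)
  fix t assume t: "t \<in> {0..T}"
  have "X 0 \<in> borel_measurable M" "X t \<in> borel_measurable M"
    using sq[of 0] sq[OF t] T by (auto simp: square_integrable_def)
  moreover have "AE \<omega> in M. X 0 \<omega> = 0" using X by (simp add: centered_gaussian_process_def)
  then have "AE \<omega> in M. X 0 \<omega> * X t \<omega> = 0" by eventually_elim simp
  ultimately have "(\<integral>\<omega>. X 0 \<omega> * X t \<omega> \<partial>M) = (\<integral>\<omega>. 0 \<partial>M)"
    by (intro integral_cong_AE) auto
  then show "covariance M X 0 t = 0" by (simp add: covariance_def)
qed

section \<open>Indefinite Wiener integrals of the three classes of processes\<close>

lemma fbm_has_indefinite_wiener_integral: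
  assumes M: "prob_space M" and T: "T > 0" and B: "fractional_brownian_motion M T H B"
  shows "has_indefinite_wiener_integral M T B"
proof -
  have H: "0 < H" "H < 1" and gp: "centered_gaussian_process M T B"
    and cov: "\<And>t s. t \<in> {0..T} \<Longrightarrow> s \<in> {0..T} \<Longrightarrow> covariance M B t s = fbm_cov H t s"
    using B by (auto simp: fractional_brownian_motion_def)
  show ?thesis
    unfolding indefinite_wiener_integral_iff[OF gaussian_process_kernel[OF M gp T]]
  proof
    fix r assume r: "r \<in> {0..T}"
    then have r0: "0 \<le> r" by simp
    obtain K where K: "\<And>A c. finite A \<Longrightarrow> (\<And>t. t \<in> A \<Longrightarrow> t \<ge> 0) \<Longrightarrow>
      (\<Sum>t\<in>A. \<Sum>s\<in>A. c t * c s * fbm_cov H (min t r) (min s r))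
        \<le> K * (\<Sum>t\<in>A. \<Sum>s\<in>A. c t * c s * fbm_cov H t s)"
      using fbm_truncation_bound[OF H r0] by blast
    show "truncation_bounded T (covariance M B) r"
      unfolding truncation_bounded_def
    proof (intro exI[of _ K] allI impI)
      fix A and c :: "real \<Rightarrow> real" assume A: "finite A" "A \<subseteq> {0..T}"
      have mem: "t \<in> {0..T}" "min t r \<in> {0..T}" if "t \<in> A" for t
        using A(2) r that by (auto simp: min_def)
      have "(\<Sum>t\<in>A. \<Sum>s\<in>A. c t * c s * covariance M B (min t r) (min s r))
          = (\<Sum>t\<in>A. \<Sum>s\<in>A. c t * c s * fbm_cov H (min t r) (min s r))"
        by (intro sum.cong refl) (simp only: cov mem)
      also have "\<dots> \<le> K * (\<Sum>t\<in>A. \<Sum>s\<in>A. c t * c s * fbm_cov H t s)"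
        by (rule K) (use A in auto)
      also have "(\<Sum>t\<in>A. \<Sum>s\<in>A. c t * c s * fbm_cov H t s) = (\<Sum>t\<in>A. \<Sum>s\<in>A. c t * c s * covariance M B t s)"
        by (intro sum.cong refl) (simp only: cov mem)
      finally show "(\<Sum>t\<in>A. \<Sum>s\<in>A. c t * c s * covariance M B (min t r) (min s r))
          \<le> K * (\<Sum>t\<in>A. \<Sum>s\<in>A. c t * c s * covariance M B t s)" .
    qed
  qed
qed

lemma independent_processes_uncorrelated:
  assumes M: "prob_space M" and X: "centered_gaussian_process M T X" and Y: "centered_gaussian_process M T Y"
    and indep: "independent_processes M T X Y" and t: "t \<in> {0..T}" and s: "s \<in> {0..T}"
  shows "(\<integral>\<omega>. X t \<omega> * Y s \<omega> \<partial>M) = 0"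
proof -
  interpret prob_space M by fact
  have "indep_var borel ((\<lambda>p. p t) \<circ> (\<lambda>\<omega>. \<lambda>t\<in>{0..T}. X t \<omega>)) borel ((\<lambda>p. p s) \<circ> (\<lambda>\<omega>. \<lambda>t\<in>{0..T}. Y t \<omega>))"
    using indep unfolding independent_processes_def
    by (rule indep_var_compose) (use t s in \<open>auto intro!: measurable_component_singleton\<close>)
  then have "indep_var borel (X t) borel (Y s)"
    using t s by (simp add: comp_def)
  from indep_var_lebesgue_integral[OF this]
  show ?thesis
    using centered_gaussian_square_integrable[OF M gaussian_process_marginal[OF X t]]
      centered_gaussian_square_integrable[OF M gaussian_process_marginal[OF Y s]] by simp
qed

text \<open>The mixed terms vanish because the processes are centered and independent at any pair of times.\<close>

lemma independent_sum_covariance: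
  assumes M: "prob_space M" and X: "centered_gaussian_process M T X" and Y: "centered_gaussian_process M T Y"
    and indep: "independent_processes M T X Y" and t: "t \<in> {0..T}" and s: "s \<in> {0..T}"
  shows "covariance M (\<lambda>t \<omega>. X t \<omega> + \<gamma> * Y t \<omega>) t s = covariance M X t s + \<gamma>\<^sup>2 * covariance M Y t s"
proof -
  interpret L2: semi_inner "square_integrable M" "\<lambda>Y Z. \<integral>\<omega>. Y \<omega> * Z \<omega> \<partial>M"
    by (rule semi_inner_square_integrable)
  note X_mem = centered_gaussian_square_integrable(1)[OF M gaussian_process_marginal[OF X]]
  note Y_mem = centered_gaussian_square_integrable(1)[OF M gaussian_process_marginal[OF Y]]
  have uncorr: "(\<integral>\<omega>. X t \<omega> * Y s \<omega> \<partial>M) = 0" "(\<integral>\<omega>. Y t \<omega> * X s \<omega> \<partial>M) = 0"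
    using independent_processes_uncorrelated[OF M X Y indep t s]
      independent_processes_uncorrelated[OF M X Y indep s t] by (simp_all add: mult.commute)
  note mem = X_mem[OF t] X_mem[OF s] L2.scale_mem[OF Y_mem[OF t], of \<gamma>] L2.scale_mem[OF Y_mem[OF s], of \<gamma>]
  show ?thesis
    unfolding covariance_def
      L2.form_add[OF mem(1,3) L2.add_mem[OF mem(2,4)]]
      L2.form_add_right[OF mem(2,4,1)] L2.form_add_right[OF mem(2,4,3)]
      L2.form_scale_right[OF Y_mem[OF s] mem(1)] L2.form_scale[OF Y_mem[OF t] mem(2)]
      L2.form_scale_right[OF Y_mem[OF s] mem(3)] L2.form_scale[OF Y_mem[OF t] Y_mem[OF s]] uncorr
    by (simp add: power2_eq_square)
qed

lemma truncation_bounded_sum: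
  assumes R1: "cov_kernel T R1" "truncation_bounded T R1 r" and R2: "cov_kernel T R2" "truncation_bounded T R2 r"
    and a: "a \<ge> 0" and r: "r \<in> {0..T}"
    and R: "\<And>t s. t \<in> {0..T} \<Longrightarrow> s \<in> {0..T} \<Longrightarrow> R t s = R1 t s + a * R2 t s"
  shows "truncation_bounded T R r"
proof -
  obtain K1 where K1: "\<And>A c. finite A \<Longrightarrow> A \<subseteq> {0..T} \<Longrightarrow>
      (\<Sum>t\<in>A. \<Sum>s\<in>A. c t * c s * R1 (min t r) (min s r)) \<le> K1 * (\<Sum>t\<in>A. \<Sum>s\<in>A. c t * c s * R1 t s)"
    using R1(2) unfolding truncation_bounded_def by blast
  obtain K2 where K2: "\<And>A c. finite A \<Longrightarrow> A \<subseteq> {0..T} \<Longrightarrow>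
      (\<Sum>t\<in>A. \<Sum>s\<in>A. c t * c s * R2 (min t r) (min s r)) \<le> K2 * (\<Sum>t\<in>A. \<Sum>s\<in>A. c t * c s * R2 t s)"
    using R2(2) unfolding truncation_bounded_def by blast
  show ?thesis
    unfolding truncation_bounded_def
  proof (intro exI[of _ "max K1 K2"] allI impI)
    fix A and c :: "real \<Rightarrow> real" assume A: "finite A" "A \<subseteq> {0..T}"
    have mem: "t \<in> {0..T}" "min t r \<in> {0..T}" if "t \<in> A" for t
      using A(2) r that by (auto simp: min_def)
    let ?S = "\<lambda>R. \<Sum>t\<in>A. \<Sum>s\<in>A. c t * c s * R t s"
    let ?S' = "\<lambda>R. \<Sum>t\<in>A. \<Sum>s\<in>A. c t * c s * R (min t r) (min s r)"
    have S: "?S R = ?S R1 + a * ?S R2"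
    proof -
      have "?S R = (\<Sum>t\<in>A. \<Sum>s\<in>A. c t * c s * R1 t s + a * (c t * c s * R2 t s))"
        by (intro sum.cong refl) (simp only: R mem, simp add: algebra_simps)
      then show ?thesis by (simp add: sum.distrib sum_distrib_left)
    qed
    have S': "?S' R = ?S' R1 + a * ?S' R2"
    proof -
      have "?S' R = (\<Sum>t\<in>A. \<Sum>s\<in>A. c t * c s * R1 (min t r) (min s r) + a * (c t * c s * R2 (min t r) (min s r)))"
        by (intro sum.cong refl) (simp only: R mem, simp add: algebra_simps)
      then show ?thesis by (simp add: sum.distrib sum_distrib_left)
    qed
    have pos: "?S R1 \<ge> 0" "?S R2 \<ge> 0"
      using cov_kernel.kernel_psd[OF R1(1) A] cov_kernel.kernel_psd[OF R2(1) A] by blast+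
    have "?S' R1 \<le> max K1 K2 * ?S R1"
      using K1[OF A, of c] pos(1) by (smt (verit) mult_right_mono max.cobounded1)
    moreover have "?S' R2 \<le> max K1 K2 * ?S R2"
      using K2[OF A, of c] pos(2) by (smt (verit) mult_right_mono max.cobounded2)
    then have "a * ?S' R2 \<le> a * (max K1 K2 * ?S R2)" using a by (rule mult_left_mono)
    ultimately show "?S' R \<le> max K1 K2 * ?S R"
      unfolding S S' by (simp add: distrib_left mult.left_commute)
  qed
qed

lemma independent_sum_has_indefinite_wiener_integral:
  assumes M: "prob_space M" and T: "T > 0"
    and X: "centered_gaussian_process M T X" and Y: "centered_gaussian_process M T Y"
    and indep: "independent_processes M T X Y"
    and iX: "has_indefinite_wiener_integral M T X" and iY: "has_indefinite_wiener_integral M T Y"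
  shows "has_indefinite_wiener_integral M T (\<lambda>t \<omega>. X t \<omega> + \<gamma> * Y t \<omega>)"
proof -
  interpret L2: semi_inner "square_integrable M" "\<lambda>Y Z. \<integral>\<omega>. Y \<omega> * Z \<omega> \<partial>M"
    by (rule semi_inner_square_integrable)
  note X_mem = centered_gaussian_square_integrable(1)[OF M gaussian_process_marginal[OF X]]
  note Y_mem = centered_gaussian_square_integrable(1)[OF M gaussian_process_marginal[OF Y]]
  note kX = gaussian_process_kernel[OF M X T] and kY = gaussian_process_kernel[OF M Y T]
  note cov = independent_sum_covariance[OF M X Y indep, of _ _ \<gamma>]
  have "cov_kernel T (covariance M (\<lambda>t \<omega>. X t \<omega> + \<gamma> * Y t \<omega>))"
  proof (rule covariance_kernel)
    show "(\<lambda>\<omega>. X t \<omega> + \<gamma> * Y t \<omega>) \<in> square_integrable M" if "t \<in> {0..T}" for t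
      using that by (intro L2.add_mem L2.scale_mem X_mem Y_mem)
    show "covariance M (\<lambda>t \<omega>. X t \<omega> + \<gamma> * Y t \<omega>) 0 t = 0" if "t \<in> {0..T}" for t
      using cov[of 0 t] that T cov_kernel.kernel_zero[OF kX that] cov_kernel.kernel_zero[OF kY that] by simp
  qed
  then show ?thesis
    using iX iY truncation_bounded_sum[OF kX _ kY _ zero_le_power2 _ cov]
    by (simp add: indefinite_wiener_integral_iff kX kY)
qed

context long_memory
begin

text \<open>The isometry property of the Wiener integral, extended from step functions to bounded measurable
integrands by \<open>L\<^sup>2\<close>-approximation on both sides.\<close>

lemma fbm_wiener_integral_covariance:
  assumes M: "prob_space M" and B: "fractional_brownian_motion M T H B"
    and f: "f \<in> bounded_measurable" and g: "g \<in> bounded_measurable"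
    and Y: "is_wiener_integral M T B (fbm_integrand H T f) Y"
    and Z: "is_wiener_integral M T B (fbm_integrand H T g) Z"
  shows "(\<integral>\<omega>. Y \<omega> * Z \<omega> \<partial>M) = fbm_form H T f g"
proof -
  interpret L2: semi_inner "square_integrable M" "\<lambda>Y Z. \<integral>\<omega>. Y \<omega> * Z \<omega> \<partial>M"
    by (rule semi_inner_square_integrable)
  have gp: "centered_gaussian_process M T B"
    and cov: "\<And>t s. t \<in> {0..T} \<Longrightarrow> s \<in> {0..T} \<Longrightarrow> covariance M B t s = fbm_cov H t s"
    using B by (auto simp: fractional_brownian_motion_def)
  note B_mem = centered_gaussian_square_integrable(1)[OF M gaussian_process_marginal[OF gp]]
  have step_mem: "S \<in> square_integrable M" if S: "step_wiener M T B F S" for F S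
  proof -
    obtain A c where A: "step_rep T A c F" and ae: "AE \<omega> in M. S \<omega> = (\<Sum>t\<in>A. c t * B t \<omega>)"
      and meas: "S \<in> borel_measurable M"
      using S by (auto simp: step_wiener_def)
    have sub: "A \<subseteq> {0..T}" using A by (simp add: step_rep_def)
    have sum: "(\<lambda>\<omega>. \<Sum>t\<in>A. c t * B t \<omega>) \<in> square_integrable M"
      using sub B_mem by (intro L2.sum_mem) auto
    then have "integrable M (\<lambda>\<omega>. (S \<omega>)\<^sup>2) \<longleftrightarrow> integrable M (\<lambda>\<omega>. (\<Sum>t\<in>A. c t * B t \<omega>)\<^sup>2)"
      using meas ae by (intro integrable_cong_AE) (auto simp: square_integrable_def)
    then show ?thesis using sum meas by (simp add: square_integrable_def)
  qed
  have isometry: "(\<integral>\<omega>. S \<omega> * S' \<omega> \<partial>M) = fbm_form H T F F'"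
    if S: "step_wiener M T B F S" and S': "step_wiener M T B F' S'" for F F' S S'
  proof -
    obtain A c where A: "step_rep T A c F" and ae: "AE \<omega> in M. S \<omega> = (\<Sum>t\<in>A. c t * B t \<omega>)"
      using S by (auto simp: step_wiener_def)
    obtain A' c' where A': "step_rep T A' c' F'" and ae': "AE \<omega> in M. S' \<omega> = (\<Sum>t\<in>A'. c' t * B t \<omega>)"
      using S' by (auto simp: step_wiener_def)
    have sub: "A \<subseteq> {0..T}" "A' \<subseteq> {0..T}" using A A' by (simp_all add: step_rep_def)
    have mem: "(\<lambda>\<omega>. \<Sum>t\<in>A. c t * B t \<omega>) \<in> square_integrable M"
      "(\<lambda>\<omega>. \<Sum>t\<in>A'. c' t * B t \<omega>) \<in> square_integrable M"
      using sub B_mem by (auto intro!: L2.sum_mem)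
    have "(\<integral>\<omega>. S \<omega> * S' \<omega> \<partial>M) = (\<integral>\<omega>. (\<Sum>t\<in>A. c t * B t \<omega>) * (\<Sum>t\<in>A'. c' t * B t \<omega>) \<partial>M)"
    proof (rule integral_cong_AE)
      show "(\<lambda>\<omega>. S \<omega> * S' \<omega>) \<in> borel_measurable M"
        by (intro borel_measurable_times square_integrable_measurable step_mem[OF S] step_mem[OF S'])
      show "(\<lambda>\<omega>. (\<Sum>t\<in>A. c t * B t \<omega>) * (\<Sum>t\<in>A'. c' t * B t \<omega>)) \<in> borel_measurable M"
        by (intro borel_measurable_times square_integrable_measurable mem)
      show "AE \<omega> in M. S \<omega> * S' \<omega> = (\<Sum>t\<in>A. c t * B t \<omega>) * (\<Sum>t\<in>A'. c' t * B t \<omega>)"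
        using ae ae' by eventually_elim simp
    qed
    also have "\<dots> = (\<Sum>t\<in>A. c t * (\<integral>\<omega>. B t \<omega> * (\<Sum>t\<in>A'. c' t * B t \<omega>) \<partial>M))"
      using sub B_mem mem by (intro L2.form_sum) auto
    also have "\<dots> = (\<Sum>t\<in>A. c t * (\<Sum>s\<in>A'. c' s * fbm_cov H t s))"
    proof (intro sum.cong refl arg_cong2[where f = "(*)"])
      fix t assume "t \<in> A"
      then have t: "t \<in> {0..T}" using sub by auto
      have "(\<integral>\<omega>. B t \<omega> * (\<Sum>s\<in>A'. c' s * B s \<omega>) \<partial>M) = (\<integral>\<omega>. (\<Sum>s\<in>A'. c' s * B s \<omega>) * B t \<omega> \<partial>M)"
        by (simp only: mult.commute)
      also have "\<dots> = (\<Sum>s\<in>A'. c' s * (\<integral>\<omega>. B s \<omega> * B t \<omega> \<partial>M))"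
        using sub B_mem t by (intro L2.form_sum) auto
      also have "\<dots> = (\<Sum>s\<in>A'. c' s * fbm_cov H t s)"
      proof (intro sum.cong refl arg_cong2[where f = "(*)"])
        fix s assume "s \<in> A'"
        then have "s \<in> {0..T}" using sub by auto
        then show "(\<integral>\<omega>. B s \<omega> * B t \<omega> \<partial>M) = fbm_cov H t s"
          using cov[OF t, of s] by (simp add: covariance_def mult.commute)
      qed
      finally show "(\<integral>\<omega>. B t \<omega> * (\<Sum>s\<in>A'. c' s * B s \<omega>) \<partial>M) = (\<Sum>s\<in>A'. c' s * fbm_cov H t s)" .
    qed
    also have "\<dots> = fbm_form H T F F'"
      by (simp only: fbm_form_step[OF A A'] sum_distrib_left mult.assoc)
    finally show ?thesis .
  qed
  have approx: "\<exists>F S. (\<forall>n. step_wiener M T B (F n) (S n)) \<and> (\<forall>n. F n \<in> bounded_measurable)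
      \<and> (\<lambda>n. form.N (\<lambda>x. F n x - h x)) \<longlonglongrightarrow> 0 \<and> (\<lambda>n. L2.N (\<lambda>\<omega>. S n \<omega> - W \<omega>)) \<longlonglongrightarrow> 0"
    if W: "is_wiener_integral M T B (fbm_integrand H T h) W" for h W
  proof -
    obtain F S where F: "F \<in> fbm_integrand H T h" and S: "\<And>n. step_wiener M T B (F n) (S n)"
      and lim: "(\<lambda>n. \<integral>\<omega>. (S n \<omega> - W \<omega>)\<^sup>2 \<partial>M) \<longlonglongrightarrow> 0"
      using W unfolding is_wiener_integral_def by blast
    have "(\<lambda>n. form.N (\<lambda>x. F n x - h x)) \<longlonglongrightarrow> 0"
      using F tendsto_real_sqrt[of _ 0] unfolding fbm_integrand_def form.N_def by force
    moreover have "F n \<in> bounded_measurable" for n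
      using F by (auto simp: fbm_integrand_def intro!: step_fun_bounded_measurable)
    moreover have "(\<lambda>n. L2.N (\<lambda>\<omega>. S n \<omega> - W \<omega>)) \<longlonglongrightarrow> 0"
      using tendsto_real_sqrt[OF lim] by (simp add: L2.N_def power2_eq_square)
    ultimately show ?thesis using S by blast
  qed
  obtain F S where S: "\<And>n. step_wiener M T B (F n) (S n)" and F: "\<And>n. F n \<in> bounded_measurable"
    and limF: "(\<lambda>n. form.N (\<lambda>x. F n x - f x)) \<longlonglongrightarrow> 0" and limS: "(\<lambda>n. L2.N (\<lambda>\<omega>. S n \<omega> - Y \<omega>)) \<longlonglongrightarrow> 0"
    using approx[OF Y] by blast
  obtain G U where U: "\<And>n. step_wiener M T B (G n) (U n)" and G: "\<And>n. G n \<in> bounded_measurable"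
    and limG: "(\<lambda>n. form.N (\<lambda>x. G n x - g x)) \<longlonglongrightarrow> 0" and limU: "(\<lambda>n. L2.N (\<lambda>\<omega>. U n \<omega> - Z \<omega>)) \<longlonglongrightarrow> 0"
    using approx[OF Z] by blast
  have Y_mem: "Y \<in> square_integrable M" and Z_mem: "Z \<in> square_integrable M"
    using Y Z by (auto simp: is_wiener_integral_def square_integrable_def)
  have "(\<lambda>n. (\<integral>\<omega>. S n \<omega> * U n \<omega> \<partial>M) - (\<integral>\<omega>. Y \<omega> * Z \<omega> \<partial>M)) \<longlonglongrightarrow> 0"
    by (rule L2.form_tendsto_same[OF step_mem[OF S] Y_mem step_mem[OF U] Z_mem limS limU tendsto_const
          L2.N_tendsto[OF step_mem[OF U] Z_mem limU]])
  moreover have "(\<lambda>n. fbm_form H T (F n) (G n) - fbm_form H T f g) \<longlonglongrightarrow> 0"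
    by (rule form.form_tendsto_same[OF F f G g limF limG tendsto_const form.N_tendsto[OF G g limG]])
  ultimately show ?thesis
    unfolding isometry[OF S U] LIM_zero_iff by (rule LIMSEQ_unique)
qed

text \<open>The variance of \<open>\<Sum> c\<^sub>t X\<^sub>t\<close> is the form evaluated at \<open>\<Sum> c\<^sub>t \<sigma> 1\<^bsub>(0,t]\<^esub>\<close>, and replacing each \<open>t\<close> by
\<open>min t r\<close> truncates this integrand.\<close>

lemma wiener_process_has_indefinite_wiener_integral:
  assumes M: "prob_space M" and B: "fractional_brownian_motion M T H B"
    and \<sigma>: "\<sigma> \<in> bounded_measurable" and X: "fractional_wiener_process M T H B \<sigma> X"
  shows "has_indefinite_wiener_integral M T X"
proof -
  have wiener: "is_wiener_integral M T B (fbm_integrand H T (truncate t \<sigma>)) (X t)" if "t \<in> {0..T}" for t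
    using X that by (simp add: fractional_wiener_process_def truncate_def)
  have cov: "covariance M X t s = fbm_form H T (truncate t \<sigma>) (truncate s \<sigma>)"
    if "t \<in> {0..T}" "s \<in> {0..T}" for t s
    unfolding covariance_def using wiener that
    by (intro fbm_wiener_integral_covariance[OF M B] truncate_bounded_measurable \<sigma>)
  have kernel: "cov_kernel T (covariance M X)"
  proof (rule covariance_kernel)
    show "X t \<in> square_integrable M" if "t \<in> {0..T}" for t
      using wiener[OF that] by (simp add: is_wiener_integral_def square_integrable_def)
    have "truncate 0 \<sigma> = (\<lambda>x. 0)" by (simp add: truncate_def)
    then show "covariance M X 0 t = 0" if "t \<in> {0..T}" for t
      using cov[of 0 t] that T form.form_zero[OF truncate_bounded_measurable[OF \<sigma>]] by simp
  qed
  show ?thesis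
    unfolding indefinite_wiener_integral_iff[OF kernel]
  proof
    fix r assume r: "r \<in> {0..T}"
    obtain K where K: "\<And>f. f \<in> bounded_measurable \<Longrightarrow>
        fbm_form H T (truncate r f) (truncate r f) \<le> K * fbm_form H T f f"
      using fbm_form_truncate_le[OF r] by blast
    show "truncation_bounded T (covariance M X) r"
      unfolding truncation_bounded_def
    proof (intro exI[of _ K] allI impI)
      fix A and c :: "real \<Rightarrow> real" assume A: "finite A" "A \<subseteq> {0..T}"
      have mem: "t \<in> {0..T}" "min t r \<in> {0..T}" if "t \<in> A" for t
        using A(2) r that by (auto simp: min_def)
      define f where "f x = (\<Sum>t\<in>A. c t * truncate t \<sigma> x)" for x
      have trunc: "truncate r f = (\<lambda>x. \<Sum>t\<in>A. c t * truncate (min t r) \<sigma> x)"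
        unfolding f_def truncate_def sum_distrib_right
        by (intro ext sum.cong refl) (auto simp: indicator_def)
      have "(\<Sum>t\<in>A. \<Sum>s\<in>A. c t * c s * covariance M X (min t r) (min s r))
          = (\<Sum>t\<in>A. \<Sum>s\<in>A. c t * c s * fbm_form H T (truncate (min t r) \<sigma>) (truncate (min s r) \<sigma>))"
        by (intro sum.cong refl) (simp only: cov mem)
      also have "\<dots> = fbm_form H T (truncate r f) (truncate r f)"
        unfolding trunc by (rule form.form_sum_sum[symmetric]) (rule truncate_bounded_measurable[OF \<sigma>])
      also have "\<dots> \<le> K * fbm_form H T f f"
        unfolding f_def by (intro K form.sum_mem truncate_bounded_measurable \<sigma>)
      also have "fbm_form H T f f = (\<Sum>t\<in>A. \<Sum>s\<in>A. c t * c s * fbm_form H T (truncate t \<sigma>) (truncate s \<sigma>))"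
        unfolding f_def by (rule form.form_sum_sum) (rule truncate_bounded_measurable[OF \<sigma>])
      also have "\<dots> = (\<Sum>t\<in>A. \<Sum>s\<in>A. c t * c s * covariance M X t s)"
        by (intro sum.cong refl) (simp only: cov mem)
      finally show "(\<Sum>t\<in>A. \<Sum>s\<in>A. c t * c s * covariance M X (min t r) (min s r))
          \<le> K * (\<Sum>t\<in>A. \<Sum>s\<in>A. c t * c s * covariance M X t s)" .
    qed
  qed
qed

end

theorem theorem5p2:
  fixes M :: "'a measure" and T :: real
  assumes "prob_space M" and "complete_measure M" and "T > 0"
  shows
    "(\<forall>H B. 0 < H \<and> H < 1 \<and> fractional_brownian_motion M T H B \<longrightarrow>
        has_indefinite_wiener_integral M T B) \<and>
     (\<forall>H B \<sigma> \<epsilon> X.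
        1/2 < H \<and> H < 1 \<and> fractional_brownian_motion M T H B \<and>
        0 < \<epsilon> \<and> \<epsilon> < 1 \<and>
        \<sigma> \<in> borel_measurable (lebesgue_on {0..T}) \<and>
        (\<forall>s\<in>{0..T}. \<epsilon> \<le> \<sigma> s \<and> \<sigma> s \<le> 1 / \<epsilon>) \<and>
        fractional_wiener_process M T H B \<sigma> X \<longrightarrow>
        has_indefinite_wiener_integral M T X) \<and>
     (\<forall>X1 X2 \<gamma>.
        \<gamma> \<noteq> 0 \<and>
        centered_gaussian_process M T X1 \<and> centered_gaussian_process M T X2 \<and>
        independent_processes M T X1 X2 \<and>
        has_indefinite_wiener_integral M T X1 \<and>
        has_indefinite_wiener_integral M T X2 \<longrightarrow>
        has_indefinite_wiener_integral M T (\<lambda>t \<omega>. X1 t \<omega> + \<gamma> * X2 t \<omega>))"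
proof (intro conjI allI impI; elim conjE)
  fix H B assume "fractional_brownian_motion M T H B"
  then show "has_indefinite_wiener_integral M T B"
    by (rule fbm_has_indefinite_wiener_integral[OF assms(1,3)])
next
  fix H B \<sigma> \<epsilon> X
  assume H: "1/2 < H" "H < 1" and B: "fractional_brownian_motion M T H B" and \<epsilon>: "0 < \<epsilon>"
    and \<sigma>: "\<sigma> \<in> borel_measurable (lebesgue_on {0..T})" "\<forall>s\<in>{0..T}. \<epsilon> \<le> \<sigma> s \<and> \<sigma> s \<le> 1 / \<epsilon>"
    and X: "fractional_wiener_process M T H B \<sigma> X"
  interpret long_memory H T by standard (use H assms(3) in auto)
  have "\<bar>\<sigma> s\<bar> \<le> 1 / \<epsilon>" if "s \<in> {0..T}" for s using \<sigma>(2) \<epsilon> that by force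
  then have "\<sigma> \<in> bounded_measurable" using \<sigma>(1) unfolding bounded_measurable_def by blast
  then show "has_indefinite_wiener_integral M T X"
    by (rule wiener_process_has_indefinite_wiener_integral[OF assms(1) B _ X])
next
  fix X1 X2 \<gamma>
  assume "centered_gaussian_process M T X1" "centered_gaussian_process M T X2"
    "independent_processes M T X1 X2"
    "has_indefinite_wiener_integral M T X1" "has_indefinite_wiener_integral M T X2"
  then show "has_indefinite_wiener_integral M T (\<lambda>t \<omega>. X1 t \<omega> + \<gamma> * X2 t \<omega>)"
    by (rule independent_sum_has_indefinite_wiener_integral[OF assms(1,3)])
qed

end
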